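(* Let $\Omega$ be a finite set of cardinality $d\ge 3$, let $T_d$ be the $d$-regular tree with a fixed legal coloring $l:E\to\Omega$ and base vertex $b$, and let $p$ be a prime. Let $F\le F'\le\widehat{F}\le\mathrm{Sym}(\Omega)$ and let $F(p)\le F$ be a $p$-Sylow subgroup of $F$. Assume that $F\backslash\Omega=F(p)\backslash\Omega$ (that is, $F$ and $F(p)$ have the same orbits on $\Omega$) and that $N_{F'_{\omega}}(F(p)_{\omega})=F(p)_{\omega}$ for all $\omega\in\Omega$. Then $$\mathrm{G}(F,F')_{(p)}=\mathrm{G}(F(p),F'),$$ where the $p$-localization $\mathrm{G}(F,F')_{(p)}$ is formed with respect to the local $p$-Sylow subgroup $S=\mathrm{U}(F(p))_b$ of $\mathrm{G}(F,F')$.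
   Context: Graphs are in Serre's sense: $T_d=(V,E)$ has vertex set $V$ and a set $E$ of oriented edges, with origin and terminus maps $o,t:E\to V$ and a fixed-point-free involution $e\mapsto\overline{e}$ on $E$ reversing orientation. For $x\in V$ let $E(x)=\{e\in E\mid o(e)=x\}$. A legal coloring is a map $l:E\to\Omega$ such that $l(e)=l(\overline{e})$ for all $e\in E$ and, for every $x\in V$, the restriction $l_x:=l|_{E(x)}:E(x)\to\Omega$ is a bijection. For $g\in\mathrm{Aut}(T_d)$ and $x\in V$ put $\sigma(g,x):=l_{gx}\circ g\circ l_x^{-1}\in\mathrm{Sym}(\Omega)$. For $F\le\mathrm{Sym}(\Omega)$ define: - $\mathrm{U}(F):=\{g\in\mathrm{Aut}(T_d)\mid \forall x\in V:\ \sigma(g,x)\in F\}$, with the subspace topology from $\mathrm{Aut}(T_d)$, which carries the permutation topology for its action on $V$; - $\mathrm{G}(F):=\{g\in\mathrm{Aut}(T_d)\mid \{x\in V\mid\sigma(g,x)\notin F\}\text{ is finite}\}$, a group equipped with the unique group topology making the inclusion $\mathrm{U}(F)\to\mathrm{G}(F)$ continuous and open; - $\widehat{F}:=\prod_{i\in I}\mathrm{Sym}(\Omega_i)\le\mathrm{Sym}(\Omega)$, where $\Omega=\bigsqcup_{i\in I}\Omega_i$ is the partition $F\backslash\Omega$ of $\Omega$ into $F$-orbits; - for $F\le F'\le\widehat{F}$, $\mathrm{G}(F,F'):=\mathrm{G}(F)\cap\mathrm{U}(F')$, topologized as a subgroup of $\mathrm{G}(F)$ (so $\mathrm{U}(F)$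 is an open subgroup). Subscripts $b$ and $\omega$ denote point stabilizers. A local $p$-Sylow subgroup of a totally disconnected locally compact group $G$ is a maximal pro-$p$ subgroup of a compact open subgroup of $G$. For groups $H\le G$, the commensurator is $\mathrm{Comm}_G(H):=\{g\in G\mid [H:H\cap gHg^{-1}]<\infty\text{ and }[gHg^{-1}:gHg^{-1}\cap H]<\infty\}$. The $p$-localization $G_{(p)}$ of $G$ is $\mathrm{Comm}_G(S)$ for a local $p$-Sylow subgroup $S$ of $G$, equipped with the unique group topology making the inclusion $S\to\mathrm{Comm}_G(S)$ continuous and open. *)

theory Defs
  imports
    "HOL-Analysis.Analysis"
    "HOL-Algebra.Group_Action"
    "HOL-Computational_Algebra.Primes"
    "Graph_Theory.Bidirected_Digraph"
    "Graph_Theory.Digraph_Component"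
begin

text \<open>
  A graph in the sense of Serre is a bidirected digraph: \<open>tail\<close> and \<open>head\<close> are the origin and
  terminus maps and \<open>arev\<close> is the edge inversion, fixed-point-free on \<open>arcs\<close> (and, by
  convention of the library, the identity elsewhere).  In such a digraph every geometric
  edge gives a directed cycle \<open>[e, arev e]\<close>, so the library's \<open>tree\<close> (no directed cycles at all)
  does not apply.  Circuits of length one (loops) and two (pairs of parallel geometric edges)
  are excluded below.
\<close>

definition serre_tree :: "('v, 'e) pre_digraph \<Rightarrow> ('e \<Rightarrow> 'e) \<Rightarrow> bool" where
  "serre_tree T arev \<longleftrightarrow> bidirected_digraph T arev \<and> Digraph_Component.connected T \<and>
     (\<forall>p. pre_digraph.cycle T p \<longrightarrow> (\<exists>e \<in> arcs T. p = [e, arev e]))"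

definition regular_tree :: "nat \<Rightarrow> ('v, 'e) pre_digraph \<Rightarrow> ('e \<Rightarrow> 'e) \<Rightarrow> bool" where
  "regular_tree d T arev \<longleftrightarrow> serre_tree T arev \<and>
     (\<forall>x \<in> verts T. finite (out_arcs T x) \<and> out_degree T x = d)"

definition legal_coloring ::
    "('v, 'e) pre_digraph \<Rightarrow> ('e \<Rightarrow> 'e) \<Rightarrow> 'c set \<Rightarrow> ('e \<Rightarrow> 'c) \<Rightarrow> bool" where
  "legal_coloring T arev \<Omega> l \<longleftrightarrow>
     (\<forall>e \<in> arcs T. l e \<in> \<Omega> \<and> l (arev e) = l e) \<and>
     (\<forall>x \<in> verts T. bij_betw l (out_arcs T x) \<Omega>)"

definition Sym :: "'a set \<Rightarrow> ('a \<Rightarrow> 'a) monoid" where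
  "Sym A = \<lparr>carrier = {\<pi>. \<pi> permutes A}, mult = (\<circ>), one = id\<rparr>"

definition perm_orbits :: "'c set \<Rightarrow> ('c \<Rightarrow> 'c) set \<Rightarrow> 'c set set" where
  "perm_orbits \<Omega> F = orbits ((Sym \<Omega>)\<lparr>carrier := F\<rparr>) \<Omega> (\<lambda>\<pi>. \<pi>)"

definition perm_stab :: "'c set \<Rightarrow> ('c \<Rightarrow> 'c) set \<Rightarrow> 'c \<Rightarrow> ('c \<Rightarrow> 'c) set" where
  "perm_stab \<Omega> F \<omega> = stabilizer ((Sym \<Omega>)\<lparr>carrier := F\<rparr>) (\<lambda>\<pi>. \<pi>) \<omega>"

text \<open>
  The product of the groups \<open>Sym B\<close>, with \<open>B\<close> ranging over the orbits of \<open>F\<close>, as a subset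
  of \<open>Sym \<Omega>\<close>: the component in \<open>Sym B\<close> of a permutation is its restriction to \<open>B\<close>.
\<close>

definition orbit_hull :: "'c set \<Rightarrow> ('c \<Rightarrow> 'c) set \<Rightarrow> ('c \<Rightarrow> 'c) set" where
  "orbit_hull \<Omega> F =
     {\<pi> \<in> carrier (Sym \<Omega>). \<forall>B \<in> perm_orbits \<Omega> F. restrict_id \<pi> B \<in> carrier (Sym B)}"

definition sylow_subgroup :: "nat \<Rightarrow> 'a set \<Rightarrow> 'a monoid \<Rightarrow> bool" where
  "sylow_subgroup p P G \<longleftrightarrow> subgroup P G \<and> card P = p ^ multiplicity p (order G)"

type_synonym 'a top_group = "'a monoid \<times> 'a topology"

fun topological_group :: "'a top_group \<Rightarrow> bool" where
  "topological_group (G, \<tau>) \<longleftrightarrow> group G \<and> topspace \<tau> = carrier G \<and>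
     continuous_map (prod_topology \<tau> \<tau>) \<tau> (\<lambda>(x, y). x \<otimes>\<^bsub>G\<^esub> y) \<and>
     continuous_map \<tau> \<tau> (\<lambda>x. inv\<^bsub>G\<^esub> x)"

fun top_subgroup :: "'a top_group \<Rightarrow> 'a set \<Rightarrow> 'a top_group" where
  "top_subgroup (G, \<tau>) H = (G\<lparr>carrier := H\<rparr>, subtopology \<tau> H)"

text \<open>
  The unique group topology on \<open>G\<close> that makes the inclusion of a topologized subgroup (with
  topology \<open>\<sigma>\<close>, so with carrier \<open>topspace \<sigma>\<close>) continuous and open.
\<close>

definition extension_topology :: "'a monoid \<Rightarrow> 'a topology \<Rightarrow> 'a topology" where
  "extension_topology G \<sigma> =
     (THE \<tau>. topological_group (G, \<tau>) \<and> continuous_map \<sigma> \<tau> (\<lambda>x. x) \<and> open_map \<sigma> \<tau> (\<lambda>x. x))"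

fun profinite :: "'a top_group \<Rightarrow> bool" where
  "profinite (G, \<tau>) \<longleftrightarrow> topological_group (G, \<tau>) \<and> compact_space \<tau> \<and> Hausdorff_space \<tau> \<and>
     (\<forall>C. connectedin \<tau> C \<longrightarrow> (\<exists>x. C \<subseteq> {x}))"

text \<open>An infinite index is ruled out below because the library's cardinality is then \<open>0\<close>.\<close>

fun pro_p :: "nat \<Rightarrow> 'a top_group \<Rightarrow> bool" where
  "pro_p p (G, \<tau>) \<longleftrightarrow> profinite (G, \<tau>) \<and>
     (\<forall>N. N \<lhd> G \<and> openin \<tau> N \<longrightarrow> (\<exists>n. card (rcosets\<^bsub>G\<^esub> N) = p ^ n))"

definition pro_p_subgroup :: "nat \<Rightarrow> 'a set \<Rightarrow> 'a top_group \<Rightarrow> bool" where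
  "pro_p_subgroup p P X \<longleftrightarrow> subgroup P (fst X) \<and> pro_p p (top_subgroup X P)"

fun local_sylow :: "nat \<Rightarrow> 'a set \<Rightarrow> 'a top_group \<Rightarrow> bool" where
  "local_sylow p S (G, \<tau>) \<longleftrightarrow>
     (\<exists>K. subgroup K G \<and> compactin \<tau> K \<and> openin \<tau> K \<and>
          pro_p_subgroup p S (G, \<tau>) \<and> S \<subseteq> K \<and>
          (\<forall>P. pro_p_subgroup p P (G, \<tau>) \<and> S \<subseteq> P \<and> P \<subseteq> K \<longrightarrow> P = S))"

definition conjugate :: "'a monoid \<Rightarrow> 'a \<Rightarrow> 'a set \<Rightarrow> 'a set" where
  "conjugate G g H = g <#\<^bsub>G\<^esub> H #>\<^bsub>G\<^esub> inv\<^bsub>G\<^esub> g"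

definition commensurator :: "'a monoid \<Rightarrow> 'a set \<Rightarrow> 'a set" where
  "commensurator G H = {g \<in> carrier G.
     finite (rcosets\<^bsub>G\<lparr>carrier := H\<rparr>\<^esub> (H \<inter> conjugate G g H)) \<and>
     finite (rcosets\<^bsub>G\<lparr>carrier := conjugate G g H\<rparr>\<^esub> (conjugate G g H \<inter> H))}"

text \<open>
  The prime \<open>p\<close> enters only through the requirement that \<open>S\<close> be a local \<open>p\<close>-Sylow subgroup.
\<close>

fun localization :: "'a top_group \<Rightarrow> 'a set \<Rightarrow> 'a top_group" where
  "localization (G, \<tau>) S =
     (let C = G\<lparr>carrier := commensurator G S\<rparr>
      in (C, extension_topology C (subtopology \<tau> S)))"

text \<open>An automorphism is the pair of its actions on vertices and on edges.\<close>

definition aut_group ::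
    "('v, 'e) pre_digraph \<Rightarrow> ('e \<Rightarrow> 'e) \<Rightarrow> (('v \<Rightarrow> 'v) \<times> ('e \<Rightarrow> 'e)) monoid" where
  "aut_group T arev = (Sym (verts T) \<times>\<times> Sym (arcs T))
     \<lparr>carrier := {(f, h). f permutes verts T \<and> h permutes arcs T \<and>
        (\<forall>e \<in> arcs T. tail T (h e) = f (tail T e) \<and> head T (h e) = f (head T e) \<and>
                       h (arev e) = arev (h e))}\<rparr>"

text \<open>The permutation topology for the action on the vertex set: finite intersections of the
  generators are the cosets of pointwise stabilizers of finite sets of vertices.\<close>

definition aut_topology ::
    "('v, 'e) pre_digraph \<Rightarrow> ('e \<Rightarrow> 'e) \<Rightarrow> (('v \<Rightarrow> 'v) \<times> ('e \<Rightarrow> 'e)) topology" where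
  "aut_topology T arev = topology_generated_by
     {{g \<in> carrier (aut_group T arev). fst g x = y} | x y. x \<in> verts T \<and> y \<in> verts T}"

definition local_action ::
    "('v, 'e) pre_digraph \<Rightarrow> 'c set \<Rightarrow> ('e \<Rightarrow> 'c) \<Rightarrow> ('v \<Rightarrow> 'v) \<times> ('e \<Rightarrow> 'e) \<Rightarrow> 'v \<Rightarrow> 'c \<Rightarrow> 'c" where
  "local_action T \<Omega> l g x = restrict_id (l \<circ> snd g \<circ> inv_into (out_arcs T x) l) \<Omega>"

definition U_set :: "('v, 'e) pre_digraph \<Rightarrow> ('e \<Rightarrow> 'e) \<Rightarrow> 'c set \<Rightarrow> ('e \<Rightarrow> 'c) \<Rightarrow>
    ('c \<Rightarrow> 'c) set \<Rightarrow> (('v \<Rightarrow> 'v) \<times> ('e \<Rightarrow> 'e)) set" where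
  "U_set T arev \<Omega> l F =
     {g \<in> carrier (aut_group T arev). \<forall>x \<in> verts T. local_action T \<Omega> l g x \<in> F}"

definition U_group :: "('v, 'e) pre_digraph \<Rightarrow> ('e \<Rightarrow> 'e) \<Rightarrow> 'c set \<Rightarrow> ('e \<Rightarrow> 'c) \<Rightarrow>
    ('c \<Rightarrow> 'c) set \<Rightarrow> (('v \<Rightarrow> 'v) \<times> ('e \<Rightarrow> 'e)) top_group" where
  "U_group T arev \<Omega> l F =
     top_subgroup (aut_group T arev, aut_topology T arev) (U_set T arev \<Omega> l F)"

definition G_set :: "('v, 'e) pre_digraph \<Rightarrow> ('e \<Rightarrow> 'e) \<Rightarrow> 'c set \<Rightarrow> ('e \<Rightarrow> 'c) \<Rightarrow>
    ('c \<Rightarrow> 'c) set \<Rightarrow> (('v \<Rightarrow> 'v) \<times> ('e \<Rightarrow> 'e)) set" where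
  "G_set T arev \<Omega> l F =
     {g \<in> carrier (aut_group T arev). finite {x \<in> verts T. local_action T \<Omega> l g x \<notin> F}}"

definition G_group :: "('v, 'e) pre_digraph \<Rightarrow> ('e \<Rightarrow> 'e) \<Rightarrow> 'c set \<Rightarrow> ('e \<Rightarrow> 'c) \<Rightarrow>
    ('c \<Rightarrow> 'c) set \<Rightarrow> (('v \<Rightarrow> 'v) \<times> ('e \<Rightarrow> 'e)) top_group" where
  "G_group T arev \<Omega> l F =
     (let H = (aut_group T arev)\<lparr>carrier := G_set T arev \<Omega> l F\<rparr>
      in (H, extension_topology H (snd (U_group T arev \<Omega> l F))))"

definition GG_group :: "('v, 'e) pre_digraph \<Rightarrow> ('e \<Rightarrow> 'e) \<Rightarrow> 'c set \<Rightarrow> ('e \<Rightarrow> 'c) \<Rightarrow>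
    ('c \<Rightarrow> 'c) set \<Rightarrow> ('c \<Rightarrow> 'c) set \<Rightarrow> (('v \<Rightarrow> 'v) \<times> ('e \<Rightarrow> 'e)) top_group" where
  "GG_group T arev \<Omega> l F F' =
     top_subgroup (G_group T arev \<Omega> l F) (G_set T arev \<Omega> l F \<inter> U_set T arev \<Omega> l F')"

definition U_stab :: "('v, 'e) pre_digraph \<Rightarrow> ('e \<Rightarrow> 'e) \<Rightarrow> 'c set \<Rightarrow> ('e \<Rightarrow> 'c) \<Rightarrow>
    ('c \<Rightarrow> 'c) set \<Rightarrow> 'v \<Rightarrow> (('v \<Rightarrow> 'v) \<times> ('e \<Rightarrow> 'e)) set" where
  "U_stab T arev \<Omega> l F b = stabilizer (fst (U_group T arev \<Omega> l F)) fst b"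

end

theory Submission
  imports Defs "HOL-Algebra.Sylow" "HOL-Algebra.Multiplicative_Group"
begin

text \<open>
  Reading colours along paths from the root identifies vertices with reduced words, so an
  automorphism is the same thing as an image of the root together with a family of local
  permutations that agree along edges.  Hence any such family prescribed on a ball can be extended
  outwards with values in \<open>F(p)\<close>, as soon as the prescribed permutations move colours within
  \<open>F(p)\<close>-orbits.  This yields that the pointwise stabilizer in \<open>S\<close> of the ball through \<open>x\<close>
  acts around \<open>x\<close> as all of \<open>F(p)\<^sub>\<omega>\<close>, where \<open>\<omega>\<close> is the colour of the edge from \<open>x\<close> to the root.

  Sylow property: if \<open>P\<close> is pro-\<open>p\<close> with \<open>S \<subseteq> P \<subseteq> U(F)\<^sub>b\<close>, then the local action at \<open>x\<close> of the
  ball stabilizer in \<open>P\<close> is a \<open>p\<close>-group between \<open>F(p)\<^sub>\<omega>\<close> and \<open>F\<^sub>\<omega>\<close>; since \<open>F\<close> and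
  \<open>F(p)\<close> have the same orbits, \<open>F(p)\<^sub>\<omega>\<close> is Sylow in \<open>F\<^sub>\<omega>\<close>, so the two agree.  Correcting by
  elements of \<open>S\<close> and inducting on the distance from the root gives \<open>P = S\<close>.

  Commensurator: if \<open>g\<close> commensurates \<open>S\<close>, then \<open>g\<^sup>-\<^sup>1\<close> conjugates the stabilizer in \<open>S\<close> of some
  ball into \<open>S\<close>.  Outside this ball the local action of \<open>g\<^sup>-\<^sup>1\<close> therefore conjugates \<open>F(p)\<^sub>\<omega>\<close> into
  \<open>F(p)\<close>; after composition with an element of \<open>F(p)\<close> it lies in the normalizer of
  \<open>F(p)\<^sub>\<omega>\<close> in \<open>F'\<^sub>\<omega>\<close>, which is \<open>F(p)\<^sub>\<omega>\<close> by hypothesis.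
\<close>

section \<open>Group topologies defined by a base of subgroups\<close>

text \<open>Two obstacles shape the proof. The claim is an equality of topological groups whose
  topologies are given by a definite description, so existence and uniqueness of each must be
  established. All topologies involved are therefore brought into one form, generated by the left
  cosets of a directed family of subgroups, namely fixators of finite vertex sets in some subgroup;
  equality of topologies then becomes comparison of families. That such a family defines a group
  topology on \<open>G(F)\<close> is a fact about trees: an element has only finitely many singular
  vertices, and conjugation by it is harmless for an automorphism that is trivial around them.
  Secondly, the hypothesis on orbits concerns \<open>F\<close> and \<open>F(p)\<close>, whereas the
  argument needs point stabilizers and elements of \<open>F'\<close>. It enters twice: equal orbits
  have p-power length, so passing to stabilizers removes the same power of p from both orders; and
  since \<open>F'\<close> lies in the orbit hull, an element of \<open>F'\<close> moves a given
  colour just as some element of \<open>F(p)\<close> does, which makes the correction into the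
  stabilizer possible.\<close>

definition coset_topology :: "'a monoid \<Rightarrow> 'a set set \<Rightarrow> 'a topology" where
  "coset_topology G \<N> =
     topology (\<lambda>W. W \<subseteq> carrier G \<and> (\<forall>g \<in> W. \<exists>N \<in> \<N>. \<forall>k \<in> N. g \<otimes>\<^bsub>G\<^esub> k \<in> W))"

text \<open>No invariance under conjugation is assumed here: traces on subgroups and open cosets
  need only a directed family of subgroups. The condition that makes the group operations continuous
  is added as \<open>conj\<close> where it is required, because for \<open>G(F)\<close> it is a
  theorem of its own (\<open>G_conj\<close>).\<close>

locale subgroup_base = group G for G :: "'a monoid" (structure) +
  fixes \<N> :: "'a set set"
  assumes nonempty: "\<N> \<noteq> {}"
    and subgroups: "N \<in> \<N> \<Longrightarrow> subgroup N G"
    and directed: "M \<in> \<N> \<Longrightarrow> N \<in> \<N> \<Longrightarrow> \<exists>L \<in> \<N>. L \<subseteq> M \<inter> N"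
begin

lemma openin_coset_topology:
  "openin (coset_topology G \<N>) W \<longleftrightarrow>
     W \<subseteq> carrier G \<and> (\<forall>g \<in> W. \<exists>N \<in> \<N>. \<forall>k \<in> N. g \<otimes> k \<in> W)"
proof -
  have "istopology (\<lambda>W. W \<subseteq> carrier G \<and> (\<forall>g \<in> W. \<exists>N \<in> \<N>. \<forall>k \<in> N. g \<otimes> k \<in> W))"
    unfolding istopology_def
  proof (intro conjI allI impI ballI)
    fix S T g
    assume S: "S \<subseteq> carrier G \<and> (\<forall>g\<in>S. \<exists>N\<in>\<N>. \<forall>k\<in>N. g \<otimes> k \<in> S)"
      and T: "T \<subseteq> carrier G \<and> (\<forall>g\<in>T. \<exists>N\<in>\<N>. \<forall>k\<in>N. g \<otimes> k \<in> T)"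
      and g: "g \<in> S \<inter> T"
    from S g obtain M where "M \<in> \<N>" "\<forall>k\<in>M. g \<otimes> k \<in> S" by blast
    moreover from T g obtain N where "N \<in> \<N>" "\<forall>k\<in>N. g \<otimes> k \<in> T" by blast
    moreover obtain L where "L \<in> \<N>" "L \<subseteq> M \<inter> N"
      using directed calculation by blast
    ultimately show "\<exists>N\<in>\<N>. \<forall>k\<in>N. g \<otimes> k \<in> S \<inter> T"
      by blast
  next
    fix K g
    assume K: "\<forall>S\<in>K. S \<subseteq> carrier G \<and> (\<forall>g\<in>S. \<exists>N\<in>\<N>. \<forall>k\<in>N. g \<otimes> k \<in> S)" and "g \<in> \<Union>K"
    then obtain S where "S \<in> K" "g \<in> S" by blast
    moreover from this K obtain N where "N \<in> \<N>" "\<forall>k\<in>N. g \<otimes> k \<in> S" by blast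
    ultimately show "\<exists>N\<in>\<N>. \<forall>k\<in>N. g \<otimes> k \<in> \<Union>K" by blast
  qed auto
  then show ?thesis
    unfolding coset_topology_def by simp
qed

lemma openin_coset_topologyE:
  assumes "openin (coset_topology G \<N>) W" "g \<in> W"
  obtains N where "N \<in> \<N>" "\<And>k. k \<in> N \<Longrightarrow> g \<otimes> k \<in> W"
  using assms unfolding openin_coset_topology by blast

lemma openin_coset_topologyI:
  assumes "W \<subseteq> carrier G" "\<And>g. g \<in> W \<Longrightarrow> \<exists>N \<in> \<N>. \<forall>k \<in> N. g \<otimes> k \<in> W"
  shows "openin (coset_topology G \<N>) W"
  using assms unfolding openin_coset_topology by simp

lemma topspace_coset_topology [simp]: "topspace (coset_topology G \<N>) = carrier G"
proof -
  have "openin (coset_topology G \<N>) (carrier G)"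
    unfolding openin_coset_topology using nonempty subgroups
    by (metis ex_in_conv m_closed order_refl subgroup.mem_carrier)
  then show ?thesis
    by (meson openin_coset_topology openin_subset openin_topspace subset_antisym)
qed

lemma openin_left_coset:
  assumes "g \<in> carrier G" "N \<in> \<N>"
  shows "openin (coset_topology G \<N>) ((\<lambda>k. g \<otimes> k) ` N)"
proof -
  interpret N: subgroup N G using assms subgroups by auto
  have "g \<otimes> k \<otimes> k' \<in> (\<lambda>k. g \<otimes> k) ` N" if "k \<in> N" "k' \<in> N" for k k'
    using that assms by (intro image_eqI[where x = "k \<otimes> k'"]) (auto simp: m_assoc)
  then show ?thesis
    unfolding openin_coset_topology using assms by (auto intro!: bexI[of _ N])
qed

text \<open>Both operations reduce to moving a small factor past a fixed element:
  \<open>x m y n = x y (y^-1 m y) n\<close> and \<open>(x k)^-1 = x^-1 (x k^-1 x^-1)\<close>. The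
  assumption \<open>conj\<close> keeps the conjugated factor inside \<open>N\<close>.\<close>

lemma topological_group_coset_topology:
  assumes conj: "\<And>g N. g \<in> carrier G \<Longrightarrow> N \<in> \<N> \<Longrightarrow> \<exists>M \<in> \<N>. \<forall>k \<in> M. g \<otimes> k \<otimes> inv g \<in> N"
  shows "topological_group (G, coset_topology G \<N>)"
proof -
  let ?T = "coset_topology G \<N>"
  have mult: "continuous_map (prod_topology ?T ?T) ?T (\<lambda>(x, y). x \<otimes> y)"
    unfolding continuous_map_def
  proof (intro conjI allI impI)
    fix W assume W: "openin ?T W"
    show "openin (prod_topology ?T ?T) {p \<in> topspace (prod_topology ?T ?T). (case p of (x, y) \<Rightarrow> x \<otimes> y) \<in> W}"
      unfolding openin_prod_topology_alt
    proof (intro allI impI)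
      fix x y assume "(x, y) \<in> {p \<in> topspace (prod_topology ?T ?T). (case p of (x, y) \<Rightarrow> x \<otimes> y) \<in> W}"
      then have xy: "x \<in> carrier G" "y \<in> carrier G" "x \<otimes> y \<in> W" by auto
      then obtain N where N: "N \<in> \<N>" "\<forall>k\<in>N. x \<otimes> y \<otimes> k \<in> W"
        using W unfolding openin_coset_topology by auto
      interpret N: subgroup N G using N subgroups by auto
      obtain M where M: "M \<in> \<N>" "\<forall>k \<in> M. inv y \<otimes> k \<otimes> inv (inv y) \<in> N"
        using conj[of "inv y" N] xy N by auto
      interpret M: subgroup M G using M subgroups by auto
      have "x \<otimes> m \<otimes> (y \<otimes> n) \<in> W" if m: "m \<in> M" and n: "n \<in> N" for m n
      proof -
        have "inv y \<otimes> m \<otimes> y \<otimes> n \<in> N"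
          using M(2) m n xy by auto
        then have "x \<otimes> y \<otimes> (inv y \<otimes> m \<otimes> y \<otimes> n) \<in> W"
          using N(2) by blast
        moreover have "x \<otimes> y \<otimes> (inv y \<otimes> m \<otimes> y \<otimes> n) = x \<otimes> m \<otimes> (y \<otimes> n)"
          using xy m n by (simp add: m_assoc) (simp add: m_assoc[symmetric])
        ultimately show ?thesis by simp
      qed
      moreover have "x \<in> (\<lambda>k. x \<otimes> k) ` M" "y \<in> (\<lambda>k. y \<otimes> k) ` N"
        using xy by (auto intro!: image_eqI[of _ _ \<one>])
      ultimately show "\<exists>U V. openin ?T U \<and> openin ?T V \<and> x \<in> U \<and> y \<in> V \<and>
          U \<times> V \<subseteq> {p \<in> topspace (prod_topology ?T ?T). (case p of (x, y) \<Rightarrow> x \<otimes> y) \<in> W}"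
        using xy M N openin_left_coset[of x M] openin_left_coset[of y N]
        by (intro exI[of _ "(\<lambda>k. x \<otimes> k) ` M"] exI[of _ "(\<lambda>k. y \<otimes> k) ` N"]) auto
    qed
  qed auto
  have "continuous_map ?T ?T (\<lambda>x. inv x)"
    unfolding continuous_map_def
  proof (intro conjI allI impI)
    fix W assume W: "openin ?T W"
    show "openin ?T {x \<in> topspace ?T. inv x \<in> W}"
      unfolding openin_coset_topology
    proof (intro conjI ballI)
      fix x assume "x \<in> {x \<in> topspace ?T. inv x \<in> W}"
      then have x: "x \<in> carrier G" "inv x \<in> W" by auto
      then obtain N where N: "N \<in> \<N>" "\<forall>k\<in>N. inv x \<otimes> k \<in> W"
        using W unfolding openin_coset_topology by auto
      interpret N: subgroup N G using N subgroups by auto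
      obtain M where M: "M \<in> \<N>" "\<forall>k \<in> M. x \<otimes> k \<otimes> inv x \<in> N"
        using conj x N by meson
      interpret M: subgroup M G using M subgroups by auto
      have "inv (x \<otimes> k) \<in> W" if k: "k \<in> M" for k
      proof -
        have "inv x \<otimes> (x \<otimes> inv k \<otimes> inv x) \<in> W"
          using M(2) N(2) k by blast
        then show ?thesis
          using x k by (simp add: inv_mult_group m_assoc[symmetric])
      qed
      then show "\<exists>N\<in>\<N>. \<forall>k\<in>N. x \<otimes> k \<in> {x \<in> topspace ?T. inv x \<in> W}"
        using M x by (intro bexI[of _ M]) auto
    qed auto
  qed auto
  with mult show ?thesis
    by (simp add: is_group)
qed

lemma subgroup_base_Int:
  assumes "subgroup L G"
  shows "subgroup_base (G\<lparr>carrier := L\<rparr>) ((\<inter>) L ` \<N>)"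
proof -
  interpret L: group "G\<lparr>carrier := L\<rparr>"
    using assms subgroup.subgroup_is_group is_group by blast
  show ?thesis
  proof (intro subgroup_base.intro subgroup_base_axioms.intro L.is_group)
    fix N assume "N \<in> (\<inter>) L ` \<N>"
    then obtain M where "M \<in> \<N>" "N = L \<inter> M" by auto
    then show "subgroup N (G\<lparr>carrier := L\<rparr>)"
      using subgroup_incl[OF subgroups_Inter_pair[OF assms] assms] subgroups by simp
  next
    fix M N assume "M \<in> (\<inter>) L ` \<N>" "N \<in> (\<inter>) L ` \<N>"
    then obtain M' N' where MN: "M' \<in> \<N>" "N' \<in> \<N>" "M = L \<inter> M'" "N = L \<inter> N'" by blast
    then obtain K where "K \<in> \<N>" "K \<subseteq> M' \<inter> N'" using directed[of M' N'] by metis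
    then show "\<exists>K\<in>(\<inter>) L ` \<N>. K \<subseteq> M \<inter> N"
      using MN by (intro bexI[of _ "L \<inter> K"]) auto
  qed (simp add: nonempty)
qed

lemma subtopology_coset_topology:
  assumes L: "subgroup L G"
  shows "subtopology (coset_topology G \<N>) L = coset_topology (G\<lparr>carrier := L\<rparr>) ((\<inter>) L ` \<N>)"
proof -
  interpret B: subgroup_base "G\<lparr>carrier := L\<rparr>" "(\<inter>) L ` \<N>"
    using subgroup_base_Int[OF L] .
  interpret L: subgroup L G by fact
  have "(\<exists>T. openin (coset_topology G \<N>) T \<and> W = T \<inter> L) \<longleftrightarrow>
      openin (coset_topology (G\<lparr>carrier := L\<rparr>) ((\<inter>) L ` \<N>)) W" for W
  proof
    assume "\<exists>T. openin (coset_topology G \<N>) T \<and> W = T \<inter> L"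
    then obtain T where T: "openin (coset_topology G \<N>) T" "W = T \<inter> L" by blast
    have key: "\<exists>N\<in>(\<inter>) L ` \<N>. \<forall>k\<in>N. g \<otimes> k \<in> W" if "g \<in> W" for g
    proof -
      have g: "g \<in> T" "g \<in> L" using that T by simp_all
      obtain N where N: "N \<in> \<N>" "\<And>k. k \<in> N \<Longrightarrow> g \<otimes> k \<in> T"
        using openin_coset_topologyE[OF T(1) g(1)] by metis
      have "\<forall>k\<in>L \<inter> N. g \<otimes> k \<in> W"
        using T(2) N(2) g(2) L.m_closed by simp
      then show ?thesis
        using N(1) by (rule bexI[OF _ imageI])
    qed
    show "openin (coset_topology (G\<lparr>carrier := L\<rparr>) ((\<inter>) L ` \<N>)) W"
    proof (rule B.openin_coset_topologyI)
      show "W \<subseteq> carrier (G\<lparr>carrier := L\<rparr>)" using T by simp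
    qed (use key in simp)
  next
    assume W: "openin (coset_topology (G\<lparr>carrier := L\<rparr>) ((\<inter>) L ` \<N>)) W"
    then have WL: "W \<subseteq> L" and "\<forall>g\<in>W. \<exists>N. N \<in> \<N> \<and> (\<forall>k\<in>L \<inter> N. g \<otimes> k \<in> W)"
      unfolding B.openin_coset_topology by (simp_all add: Bex_def[symmetric])
    from bchoice[OF this(2)] obtain N
      where N: "\<And>g. g \<in> W \<Longrightarrow> N g \<in> \<N>" "\<And>g k. g \<in> W \<Longrightarrow> k \<in> L \<inter> N g \<Longrightarrow> g \<otimes> k \<in> W"
      by blast
    \<comment> \<open>Thickening \<open>W\<close> by whole cosets in \<open>G\<close> adds no point
      of \<open>L\<close>: if \<open>g\<close> and \<open>g k\<close> lie in \<open>L\<close>, so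
      does \<open>k\<close>.\<close>
    let ?T = "\<Union>g\<in>W. (\<lambda>k. g \<otimes> k) ` N g"
    have "openin (coset_topology G \<N>) ?T"
      using N WL openin_left_coset by (intro openin_Union) auto
    moreover have "W = ?T \<inter> L"
    proof (intro equalityI subsetI)
      fix g assume g: "g \<in> W"
      then have "g = g \<otimes> \<one>" "\<one> \<in> N g"
        using WL N subgroups by (auto simp: subgroup.one_closed)
      then show "g \<in> ?T \<inter> L" using g WL by blast
    next
      fix h assume "h \<in> ?T \<inter> L"
      then obtain g k where g: "g \<in> W" "k \<in> N g" "h = g \<otimes> k" "h \<in> L" by auto
      have k: "k \<in> carrier G" using subgroup.mem_carrier[OF subgroups[OF N(1)]] g by blast
      have gL: "g \<in> L" using g WL by blast
      then have "k = inv g \<otimes> h"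
        using g k by (simp add: m_assoc[symmetric])
      also have "\<dots> \<in> L"
        using gL g(4) by (intro L.m_closed L.m_inv_closed)
      finally show "h \<in> W" using N(2) g by simp
    qed
    ultimately show "\<exists>T. openin (coset_topology G \<N>) T \<and> W = T \<inter> L" by blast
  qed
  then show ?thesis
    by (simp add: topology_eq openin_subtopology)
qed

text \<open>A group topology is determined by its neighbourhoods of the unit, and an inclusion that
  is continuous and open identifies these with the neighbourhoods of the unit in \<open>K\<close>.
  Left translation, continuous in any competing topology, carries the comparison to every point.
  This yields the uniqueness that the definite description asks for.\<close>

lemma extension_topology_coset_topology:
  assumes K: "subgroup K G" and NK: "\<And>N. N \<in> \<N> \<Longrightarrow> N \<subseteq> K"
    and conj: "\<And>g N. g \<in> carrier G \<Longrightarrow> N \<in> \<N> \<Longrightarrow> \<exists>M \<in> \<N>. \<forall>k \<in> M. g \<otimes> k \<otimes> inv g \<in> N"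
  shows "extension_topology G (coset_topology (G\<lparr>carrier := K\<rparr>) \<N>) = coset_topology G \<N>"
proof -
  interpret K: subgroup K G by fact
  have NK': "(\<inter>) K ` \<N> = \<N>"
    using NK by (force simp: Int_absorb1)
  interpret B: subgroup_base "G\<lparr>carrier := K\<rparr>" \<N>
    using subgroup_base_Int[OF K] NK' by simp
  let ?T = "coset_topology G \<N>" and ?S = "coset_topology (G\<lparr>carrier := K\<rparr>) \<N>"
  have S: "?S = subtopology ?T K"
    using subtopology_coset_topology[OF K] NK' by simp
  have "openin ?T K"
  proof (rule openin_coset_topologyI)
    fix g assume "g \<in> K"
    obtain N where "N \<in> \<N>" using nonempty by blast
    with NK \<open>g \<in> K\<close> show "\<exists>N \<in> \<N>. \<forall>k \<in> N. g \<otimes> k \<in> K"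
      by (intro bexI[of _ N] ballI K.m_closed) auto
  qed (rule K.subset)
  show ?thesis
    unfolding extension_topology_def
  proof (rule the_equality)
    show "topological_group (G, ?T) \<and> continuous_map ?S ?T (\<lambda>x. x) \<and> open_map ?S ?T (\<lambda>x. x)"
      using topological_group_coset_topology[OF conj] \<open>openin ?T K\<close>
      by (auto simp: S open_map_def openin_open_subtopology continuous_map_from_subtopology)
  next
    fix \<tau> assume "topological_group (G, \<tau>) \<and> continuous_map ?S \<tau> (\<lambda>x. x) \<and> open_map ?S \<tau> (\<lambda>x. x)"
    then have mult: "continuous_map (prod_topology \<tau> \<tau>) \<tau> (\<lambda>(x, y). x \<otimes> y)" and ts: "topspace \<tau> = carrier G"
      and cont: "continuous_map ?S \<tau> (\<lambda>x. x)" and op: "open_map ?S \<tau> (\<lambda>x. x)" by auto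
    have trans: "continuous_map \<tau> \<tau> (\<lambda>y. g \<otimes> y)" if "g \<in> carrier G" for g
    proof -
      have "continuous_map \<tau> (prod_topology \<tau> \<tau>) (\<lambda>y. (g, y))"
        using that ts by (auto intro!: continuous_map_pairedI)
      from continuous_map_compose[OF this mult] show ?thesis by (simp add: o_def)
    qed
    have "openin \<tau> W \<longleftrightarrow> openin ?T W" for W
    proof
      assume W: "openin \<tau> W"
      then have WG: "W \<subseteq> carrier G" using openin_subset ts by blast
      show "openin ?T W"
        unfolding openin_coset_topology
      proof (intro conjI ballI)
        fix g assume g: "g \<in> W"
        have "openin \<tau> {y \<in> topspace \<tau>. g \<otimes> y \<in> W}"
          using trans[of g] g WG W by (simp add: continuous_map_def subset_iff)
        then have "openin ?S {y \<in> topspace ?S. y \<in> {y \<in> topspace \<tau>. g \<otimes> y \<in> W}}"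
          using cont unfolding continuous_map_def by blast
        moreover have "\<one> \<in> {y \<in> topspace ?S. y \<in> {y \<in> topspace \<tau>. g \<otimes> y \<in> W}}"
          using ts g WG by auto
        ultimately obtain N where "N \<in> \<N>"
            "\<And>k. k \<in> N \<Longrightarrow> \<one> \<otimes> k \<in> {y \<in> topspace ?S. y \<in> {y \<in> topspace \<tau>. g \<otimes> y \<in> W}}"
          by (rule B.openin_coset_topologyE) auto
        moreover have "N \<subseteq> carrier G" using NK[OF \<open>N \<in> \<N>\<close>] K.subset by (rule subset_trans)
        ultimately show "\<exists>N\<in>\<N>. \<forall>k\<in>N. g \<otimes> k \<in> W"
          by (intro bexI[of _ N]) (simp_all add: subset_iff)
      qed fact
    next
      assume W: "openin ?T W"
      then have WG: "W \<subseteq> carrier G" using openin_subset by force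
      show "openin \<tau> W"
      proof (subst openin_subopen, intro ballI)
        fix g assume g: "g \<in> W"
        obtain N where N: "N \<in> \<N>" "\<forall>k\<in>N. g \<otimes> k \<in> W"
          using W g unfolding openin_coset_topology by auto
        interpret N: subgroup N G using N subgroups by auto
        have "(\<lambda>k. \<one> \<otimes> k) ` N = N"
          using N.subset by (auto simp: image_def subset_iff)
        then have "openin ?S N"
          using B.openin_left_coset[of \<one> N] N(1) by simp
        then have "openin \<tau> N"
          using op by (metis image_ident open_map_def)
        then have "openin \<tau> {y \<in> topspace \<tau>. inv g \<otimes> y \<in> N}"
          using trans[of "inv g"] g WG by (simp add: continuous_map_def subset_iff)
        moreover have "g \<in> {y \<in> topspace \<tau>. inv g \<otimes> y \<in> N}"
          using g WG ts by auto
        moreover have "{y \<in> topspace \<tau>. inv g \<otimes> y \<in> N} \<subseteq> W"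
        proof
          fix y assume "y \<in> {y \<in> topspace \<tau>. inv g \<otimes> y \<in> N}"
          then have "y \<in> carrier G" "g \<otimes> (inv g \<otimes> y) \<in> W" using N ts by auto
          then show "y \<in> W" using g WG by (auto simp: m_assoc[symmetric])
        qed
        ultimately show "\<exists>T. openin \<tau> T \<and> g \<in> T \<and> T \<subseteq> W" by blast
      qed
    qed
    then show "\<tau> = ?T" by (simp add: topology_eq)
  qed
qed

end

text \<open>Serves to replace the fixators taken in \<open>S\<close> by those taken in
  \<open>U(F(p))\<close> in the topology of the localization.\<close>

lemma coset_topology_cofinal:
  assumes "\<And>N. N \<in> \<N> \<Longrightarrow> \<exists>M \<in> \<M>. M \<subseteq> N" "\<And>M. M \<in> \<M> \<Longrightarrow> \<exists>N \<in> \<N>. N \<subseteq> M"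
  shows "coset_topology G \<N> = coset_topology G \<M>"
proof -
  have "(\<exists>N\<in>\<N>. \<forall>k\<in>N. g \<otimes>\<^bsub>G\<^esub> k \<in> W) \<longleftrightarrow> (\<exists>M\<in>\<M>. \<forall>k\<in>M. g \<otimes>\<^bsub>G\<^esub> k \<in> W)" for g W
    using assms by (meson subset_iff)
  then show ?thesis
    unfolding coset_topology_def by simp
qed

section \<open>Finite p-groups\<close>

text \<open>If a prime \<open>q\<close> other than \<open>p\<close> divided the order, a Sylow
  \<open>q\<close>-subgroup would contain a nontrivial element whose order divides both a power of
  \<open>q\<close> and a power of \<open>p\<close>.\<close>

lemma (in group) order_prime_power:
  assumes fin: "finite (carrier G)" and p: "prime p"
    and pow: "\<And>x. x \<in> carrier G \<Longrightarrow> \<exists>k. x [^] (p ^ k :: nat) = \<one>"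
  shows "\<exists>n. order G = p ^ n"
proof -
  have "q = p" if q: "prime q" "q dvd order G" for q
  proof (rule ccontr)
    assume qp: "q \<noteq> p"
    define a where "a = multiplicity q (order G)"
    have o0: "order G \<noteq> 0" using fin order_gt_0_iff_finite by auto
    have a: "a > 0" unfolding a_def using q o0
      by (simp add: prime_multiplicity_gt_zero_iff)
    obtain H where H: "subgroup H G" "card H = q ^ a"
      using sylow_thm[OF q(1) is_group, of a "order G div q ^ a"] fin multiplicity_dvd[of q "order G"]
      unfolding a_def by auto
    interpret H: subgroup H G by fact
    have "card H > 1" using H a q by (metis one_less_power prime_gt_1_nat)
    then obtain h where h: "h \<in> H" "h \<noteq> \<one>"
      by (metis One_nat_def card.empty card_1_singleton_iff is_singletonI' is_singleton_altdef less_not_refl H.one_closed not_less_zero)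
    interpret HG: group "G\<lparr>carrier := H\<rparr>"
      using H subgroup.subgroup_is_group is_group by blast
    have "h [^] (q ^ a) = \<one>"
      using HG.pow_order_eq_1[of h] h H(2) nat_pow_consistent[of h "q ^ a" H]
      by (simp add: order_def)
    moreover obtain k where "h [^] (p ^ k) = \<one>"
      using pow[of h] h by auto
    ultimately have "ord h dvd q ^ a" "ord h dvd p ^ k"
      using h by (auto simp: pow_eq_id)
    moreover have "coprime (q ^ a) (p ^ k)"
      using q p qp by (simp add: primes_coprime)
    ultimately have "ord h = 1"
      by (metis coprime_common_divisor_nat)
    then show False using h ord_eq_1 by auto
  qed
  then have "prime_factors (order G) \<subseteq> {p}" by (auto simp: prime_factors_dvd)
  then have "prime_factors (order G) = {} \<or> prime_factors (order G) = {p}" by blast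
  moreover have "order G = (\<Prod>q\<in>prime_factors (order G). q ^ multiplicity q (order G))"
    using prime_factorization_nat[of "order G"] fin order_gt_0_iff_finite by auto
  ultimately have "order G = p ^ 0 \<or> order G = p ^ multiplicity p (order G)" by auto
  then show ?thesis by blast
qed

text \<open>\<open>Q\<close> is a p-group, so its order is a power of p dividing
  \<open>order G\<close> and cannot exceed \<open>card P\<close>. The assumption is on exponents of
  elements because this is the form in which pro-p information passes to local actions.\<close>

lemma sylow_subgroup_maximal:
  fixes G :: "'a monoid" (structure)
  assumes G: "group G" and fin: "finite (carrier G)" and p: "prime p"
    and P: "sylow_subgroup p P G" and Q: "subgroup Q G" and PQ: "P \<subseteq> Q"
    and pow: "\<And>x. x \<in> Q \<Longrightarrow> \<exists>k. x [^] (p ^ k :: nat) = \<one>"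
  shows "Q = P"
proof -
  interpret group G by fact
  interpret Q: subgroup Q G by fact
  interpret QG: group "G\<lparr>carrier := Q\<rparr>"
    using Q subgroup.subgroup_is_group is_group by blast
  have fQ: "finite Q" using fin Q.subset finite_subset by blast
  have "\<exists>n. order (G\<lparr>carrier := Q\<rparr>) = p ^ n"
    using pow fQ by (intro QG.order_prime_power p) (auto simp: nat_pow_consistent[symmetric])
  then obtain n where n: "card Q = p ^ n" by (auto simp: order_def)
  have "card Q dvd order G"
    using lagrange[OF Q] by (metis dvd_triv_right)
  then have "n \<le> multiplicity p (order G)"
    using n fin order_gt_0_iff_finite p
    by (metis dvd_0_right multiplicity_geI not_prime_unit less_numeral_extra(3))
  then have "card Q \<le> card P"
    using P n power_increasing[OF _ prime_ge_1_nat[OF p]] by (simp add: sylow_subgroup_def)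
  then show ?thesis using PQ fQ by (metis card_seteq)
qed

section \<open>Reduced words in a legally coloured tree\<close>

locale colored_tree =
  fixes T :: "('v, 'e) pre_digraph" and arev :: "'e \<Rightarrow> 'e" and \<Omega> :: "'c set" and l :: "'e \<Rightarrow> 'c"
  assumes tree: "serre_tree T arev" and coloring: "legal_coloring T arev \<Omega> l"
begin

definition edge :: "'v \<Rightarrow> 'c \<Rightarrow> 'e" where
  "edge x \<omega> = inv_into (out_arcs T x) l \<omega>"

text \<open>For a fixed colour this is an involution of the vertex set (\<open>nb_nb\<close>). The
  colours thus generate an action of a free product of groups of order two, and
  \<open>foldl nb x w\<close> is the end of the walk from \<open>x\<close> that reads
  \<open>w\<close>; the reduced words are those with \<open>distinct_adj\<close>.\<close>

definition nb :: "'v \<Rightarrow> 'c \<Rightarrow> 'v" where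
  "nb x \<omega> = head T (edge x \<omega>)"

lemma bidirected: "bidirected_digraph T arev"
  using tree by (simp add: serre_tree_def)

lemma wf: "wf_digraph T"
  using bidirected by (simp add: bidirected_digraph_def)

lemma l_in: "e \<in> arcs T \<Longrightarrow> l e \<in> \<Omega>" and l_arev: "e \<in> arcs T \<Longrightarrow> l (arev e) = l e"
  using coloring by (auto simp: legal_coloring_def)

lemma tail_in: "e \<in> arcs T \<Longrightarrow> tail T e \<in> verts T" and head_in: "e \<in> arcs T \<Longrightarrow> head T e \<in> verts T"
  using wf by (auto simp: wf_digraph_def)

lemma arev_in: "e \<in> arcs T \<Longrightarrow> arev e \<in> arcs T"
  and tail_arev: "e \<in> arcs T \<Longrightarrow> tail T (arev e) = head T e"
  and head_arev: "e \<in> arcs T \<Longrightarrow> head T (arev e) = tail T e"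
  using bidirected by (auto simp: bidirected_digraph.arev_in_arcs bidirected_digraph.tail_arev bidirected_digraph.head_arev)

lemma
  assumes "x \<in> verts T" "\<omega> \<in> \<Omega>"
  shows edge_in: "edge x \<omega> \<in> arcs T" and tail_edge: "tail T (edge x \<omega>) = x" and l_edge: "l (edge x \<omega>) = \<omega>"
proof -
  have b: "bij_betw l (out_arcs T x) \<Omega>"
    using assms coloring by (simp add: legal_coloring_def)
  then have "edge x \<omega> \<in> out_arcs T x"
    unfolding edge_def using assms by (metis bij_betw_imp_surj_on inv_into_into)
  then show "edge x \<omega> \<in> arcs T" "tail T (edge x \<omega>) = x" by auto
  show "l (edge x \<omega>) = \<omega>"
    unfolding edge_def using assms b by (metis bij_betw_imp_surj_on f_inv_into_f)
qed

lemma edge_eq: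
  assumes "e \<in> arcs T" shows "edge (tail T e) (l e) = e"
proof -
  have "inj_on l (out_arcs T (tail T e))"
    using assms coloring tail_in by (simp add: legal_coloring_def bij_betw_def)
  then show ?thesis
    unfolding edge_def using assms by (intro inv_into_f_f) auto
qed

lemma nb_in: "x \<in> verts T \<Longrightarrow> \<omega> \<in> \<Omega> \<Longrightarrow> nb x \<omega> \<in> verts T"
  unfolding nb_def by (simp add: edge_in head_in)

lemma arev_edge: "x \<in> verts T \<Longrightarrow> \<omega> \<in> \<Omega> \<Longrightarrow> arev (edge x \<omega>) = edge (nb x \<omega>) \<omega>"
  using edge_eq[of "arev (edge x \<omega>)"] by (simp add: edge_in arev_in tail_arev l_arev l_edge nb_def)

lemma nb_nb: "x \<in> verts T \<Longrightarrow> \<omega> \<in> \<Omega> \<Longrightarrow> nb (nb x \<omega>) \<omega> = x"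
  using arev_edge head_arev[of "edge x \<omega>"] by (simp add: nb_def edge_in tail_edge)

lemma foldl_nb_in: "x \<in> verts T \<Longrightarrow> set w \<subseteq> \<Omega> \<Longrightarrow> foldl nb x w \<in> verts T"
  by (induction w arbitrary: x) (auto simp: nb_in)

lemma foldl_nb_rev: "x \<in> verts T \<Longrightarrow> set w \<subseteq> \<Omega> \<Longrightarrow> foldl nb (foldl nb x w) (rev w) = x"
  by (induction w arbitrary: x) (auto simp: nb_in nb_nb)

primrec edges :: "'v \<Rightarrow> 'c list \<Rightarrow> 'e list" where
  "edges x [] = []"
| "edges x (\<omega> # w) = edge x \<omega> # edges (nb x \<omega>) w"

lemma length_edges [simp]: "length (edges x w) = length w"
  by (induction w arbitrary: x) auto

lemma awalk_edges:
  "x \<in> verts T \<Longrightarrow> set w \<subseteq> \<Omega> \<Longrightarrow> pre_digraph.awalk T x (edges x w) (foldl nb x w)"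
  by (induction w arbitrary: x)
    (auto simp: pre_digraph.awalk_def pre_digraph.cas.simps nb_in edge_in tail_edge nb_def[symmetric])

lemma awalk_verts_edges:
  "x \<in> verts T \<Longrightarrow> set w \<subseteq> \<Omega> \<Longrightarrow> i \<le> length w \<Longrightarrow>
     pre_digraph.awalk_verts T x (edges x w) ! i = foldl nb x (take i w)"
proof (induction w arbitrary: x i)
  case Nil
  then show ?case by (simp add: pre_digraph.awalk_verts.simps)
next
  case (Cons \<omega> w)
  then show ?case
    by (cases i) (auto simp: pre_digraph.awalk_verts.simps nb_in tail_edge nb_def[symmetric])
qed

text \<open>A shortest nonempty closed reduced walk would be a cycle of length other than two.\<close>

lemma reduced_closed_walk:
  assumes "x \<in> verts T" "set w \<subseteq> \<Omega>" "distinct_adj w" "foldl nb x w = x"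
  shows "w = []"
  using assms
proof (induction "length w" arbitrary: x w rule: less_induct)
  case less
  show ?case
  proof (rule ccontr)
    assume w: "w \<noteq> []"
    let ?vs = "pre_digraph.awalk_verts T x (edges x w)"
    have len: "length ?vs = Suc (length w)"
      by (simp add: pre_digraph.length_awalk_verts)
    \<comment> \<open>A cycle has distinct vertices apart from its first one, hence
      \<open>tl\<close>. A repetition would cut out the shorter closed reduced word
      \<open>u\<close>, empty by induction although it has \<open>j - i\<close> letters.\<close>
    have "tl ?vs ! i \<noteq> tl ?vs ! j" if ij: "i < j" "j < length w" for i j
    proof
      assume eq: "tl ?vs ! i = tl ?vs ! j"
      define y where "y = foldl nb x (take (Suc i) w)"
      define u where "u = drop (Suc i) (take (Suc j) w)"
      have tu: "take (Suc j) w = take (Suc i) w @ u"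
        using append_take_drop_id[of "Suc i" "take (Suc j) w"] ij by (simp add: u_def min_def)
      have "tl ?vs ! i = ?vs ! Suc i" "tl ?vs ! j = ?vs ! Suc j"
        using len ij by (auto simp: nth_tl)
      with eq have "foldl nb x (take (Suc i) w) = foldl nb x (take (Suc j) w)"
        using awalk_verts_edges[OF less.prems(1,2)] ij by simp
      then have closed: "foldl nb y u = y"
        by (simp add: tu y_def)
      have w_eq: "w = take (Suc i) w @ u @ drop (Suc j) w"
        using tu by (metis append.assoc append_take_drop_id)
      have "set (take (Suc i) w) \<subseteq> \<Omega>" "set u \<subseteq> \<Omega>"
        using less.prems(2) by (subst (asm) w_eq, simp)+
      moreover have "distinct_adj u"
        using less.prems(3) by (subst (asm) w_eq, simp add: distinct_adj_append_iff)
      moreover have "length u = j - i" unfolding u_def using ij by simp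
      moreover have "y \<in> verts T" unfolding y_def using less.prems(1) calculation foldl_nb_in by blast
      ultimately have "u = []" using less.hyps[OF _ _ _ _ closed] ij by simp
      with \<open>length u = j - i\<close> ij show False by simp
    qed
    then have "distinct (tl ?vs)"
      unfolding distinct_conv_nth using len by (metis diff_Suc_1 length_tl linorder_neqE_nat)
    then have "pre_digraph.cycle T (edges x w)"
      unfolding pre_digraph.cycle_def
      using awalk_edges[OF less.prems(1,2)] less.prems(4) w by (metis length_edges length_0_conv)
    then obtain e where e: "e \<in> arcs T" "edges x w = [e, arev e]"
      using tree by (auto simp: serre_tree_def)
    then obtain \<alpha> \<beta> where \<alpha>\<beta>: "w = [\<alpha>, \<beta>]"
      by (metis length_edges length_0_conv length_Suc_conv)
    \<comment> \<open>The only cycles of the tree run along one edge and back, so they read the same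
      colour twice and their word is not reduced.\<close>
    then have "edge x \<alpha> = e" "edge (nb x \<alpha>) \<beta> = arev e" using e by auto
    then have "\<alpha> = l e" "\<beta> = l (arev e)"
      using less.prems(1,2) \<alpha>\<beta> l_edge[of x \<alpha>] l_edge[of "nb x \<alpha>" \<beta>] by (simp_all add: nb_in)
    then show False using less.prems(3) \<alpha>\<beta> e l_arev by auto
  qed
qed

lemma connected_words:
  assumes "x \<in> verts T" "y \<in> verts T"
  obtains w where "set w \<subseteq> \<Omega>" "foldl nb x w = y"
proof -
  interpret bidirected_digraph T arev by (rule bidirected)
  have "symmetric T" by (rule sym_arcs)
  then have "strongly_connected T"
    using tree wf wf_digraph.symmetric_connected_imp_strongly_connected by (auto simp: serre_tree_def)
  then have "x \<rightarrow>\<^sup>*\<^bsub>T\<^esub> y" using assms by (simp add: strongly_connected_def)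
  then obtain p where "pre_digraph.awalk T x p y"
    using wf wf_digraph.reachable_awalk by metis
  then have "set p \<subseteq> arcs T" "pre_digraph.cas T x p y"
    by (auto simp: pre_digraph.awalk_def)
  then have "set (map l p) \<subseteq> \<Omega> \<and> foldl nb x (map l p) = y"
  proof (induction p arbitrary: x)
    case (Cons e p)
    then show ?case
      using edge_eq[of e] by (auto simp: pre_digraph.cas.simps nb_def l_in)
  qed (simp add: pre_digraph.cas.simps)
  then show thesis using that by blast
qed

lemma reduced_walk:
  assumes "x \<in> verts T" "y \<in> verts T"
  obtains w where "set w \<subseteq> \<Omega>" "distinct_adj w" "foldl nb x w = y"
proof -
  have "\<exists>w'. set w' \<subseteq> \<Omega> \<and> distinct_adj w' \<and> foldl nb x w' = foldl nb x w" if "set w \<subseteq> \<Omega>" for w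
    using that
  proof (induction w rule: rev_induct)
    case (snoc \<omega> w)
    then obtain w' where w': "set w' \<subseteq> \<Omega>" "distinct_adj w'" "foldl nb x w' = foldl nb x w" by auto
    show ?case
    proof (cases "w' \<noteq> [] \<and> last w' = \<omega>")
      case True
      then obtain u where u: "w' = u @ [\<omega>]" by (metis append_butlast_last_id)
      then have "foldl nb x w = nb (foldl nb x u) \<omega>" "set u \<subseteq> \<Omega>" "\<omega> \<in> \<Omega>"
        using w' snoc.prems by auto
      then have "nb (foldl nb x w) \<omega> = foldl nb x u"
        using nb_nb[OF foldl_nb_in] assms(1) by simp
      then show ?thesis using u w' by (intro exI[of _ u]) auto
    next
      case False
      then show ?thesis using w' snoc
        by (intro exI[of _ "w' @ [\<omega>]"]) (auto simp: distinct_adj_append_iff)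
    qed
  qed (auto intro!: exI[of _ "[]"])
  with connected_words[OF assms] that show thesis by metis
qed

text \<open>Equal last letters can be cancelled; with different last letters \<open>w\<close>
  followed by the reverse of \<open>w'\<close> would be a nonempty closed reduced word. Together
  with \<open>reduced_walk\<close> this identifies the vertices, seen from \<open>x\<close>, with
  the reduced words.\<close>

lemma reduced_walk_unique:
  assumes "x \<in> verts T"
    and "set w \<subseteq> \<Omega>" "distinct_adj w" "set w' \<subseteq> \<Omega>" "distinct_adj w'" "foldl nb x w = foldl nb x w'"
  shows "w = w'"
  using assms(2-)
proof (induction w arbitrary: w' rule: rev_induct)
  case Nil
  then show ?case using reduced_closed_walk[OF assms(1), of w'] by simp
next
  case (snoc \<omega> w)
  show ?case
  proof (cases w' rule: rev_cases)
    case Nil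
    then show ?thesis using reduced_closed_walk[OF assms(1) snoc.prems(1,2)] snoc.prems by simp
  next
    case (snoc u \<omega>')
    note u = this
    show ?thesis
    proof (cases "\<omega> = \<omega>'")
      case True
      have "foldl nb x w = foldl nb x u"
        using snoc.prems u True assms(1) nb_nb[OF foldl_nb_in, of x w \<omega>] nb_nb[OF foldl_nb_in, of x u \<omega>] by simp
      then show ?thesis using snoc.IH[of u] snoc.prems u True by auto
    next
      case False
      let ?c = "(w @ [\<omega>]) @ rev (u @ [\<omega>'])"
      have "distinct_adj (rev (u @ [\<omega>']))"
        using snoc.prems u by (simp only: distinct_adj_rev)
      then have "distinct_adj ?c"
        using snoc.prems u False by (subst distinct_adj_append_iff) simp
      moreover have "foldl nb x ?c = x"
        using snoc.prems(5) u foldl_nb_rev[OF assms(1) snoc.prems(3)]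
        by (metis foldl_append)
      moreover have "set ?c \<subseteq> \<Omega>" using snoc.prems u by auto
      ultimately show ?thesis using reduced_closed_walk[OF assms(1)] by blast
    qed
  qed
qed

lemma nb_inj: "x \<in> verts T \<Longrightarrow> \<alpha> \<in> \<Omega> \<Longrightarrow> \<beta> \<in> \<Omega> \<Longrightarrow> nb x \<alpha> = nb x \<beta> \<Longrightarrow> \<alpha> = \<beta>"
  using reduced_walk_unique[of x "[\<alpha>]" "[\<beta>]"] by simp

section \<open>Automorphisms and local actions\<close>

abbreviation Aut :: "(('v \<Rightarrow> 'v) \<times> ('e \<Rightarrow> 'e)) monoid" where
  "Aut \<equiv> aut_group T arev"

abbreviation \<sigma> :: "('v \<Rightarrow> 'v) \<times> ('e \<Rightarrow> 'e) \<Rightarrow> 'v \<Rightarrow> 'c \<Rightarrow> 'c" where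
  "\<sigma> \<equiv> local_action T \<Omega> l"

lemma mult_Aut: "g \<otimes>\<^bsub>Aut\<^esub> h = (fst g \<circ> fst h, snd g \<circ> snd h)"
  by (simp add: aut_group_def DirProd_def Sym_def split: prod.split)

lemma one_Aut: "\<one>\<^bsub>Aut\<^esub> = (id, id)"
  by (simp add: aut_group_def DirProd_def Sym_def)

lemma Aut_iff:
  "g \<in> carrier Aut \<longleftrightarrow> fst g permutes verts T \<and> snd g permutes arcs T \<and>
     (\<forall>e \<in> arcs T. tail T (snd g e) = fst g (tail T e) \<and> head T (snd g e) = fst g (head T e) \<and>
        snd g (arev e) = arev (snd g e))"
  by (cases g) (simp add: aut_group_def)

sublocale Aut: group Aut
proof (rule groupI)
  fix g h assume "g \<in> carrier Aut" "h \<in> carrier Aut"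
  then show "g \<otimes>\<^bsub>Aut\<^esub> h \<in> carrier Aut"
    by (simp add: Aut_iff mult_Aut permutes_compose permutes_in_image arev_in)
next
  fix g assume g: "g \<in> carrier Aut"
  let ?i = "(inv_into UNIV (fst g), inv_into UNIV (snd g))"
  have f: "fst g permutes verts T" and h: "snd g permutes arcs T"
    using g by (auto simp: Aut_iff)
  have "tail T (inv_into UNIV (snd g) e) = inv_into UNIV (fst g) (tail T e) \<and> head T (inv_into UNIV (snd g) e) = inv_into UNIV (fst g) (head T e) \<and>
      inv_into UNIV (snd g) (arev e) = arev (inv_into UNIV (snd g) e)" if "e \<in> arcs T" for e
  proof -
    define e' where "e' = inv_into UNIV (snd g) e"
    have e': "e' \<in> arcs T" "e = snd g e'"
      using that h by (auto simp: e'_def permutes_inverses permutes_in_image[OF permutes_inv])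
    then show ?thesis
      using g f h e'_def[symmetric] by (auto simp: Aut_iff permutes_inverses) (metis permutes_inverses(2))
  qed
  then have "?i \<in> carrier Aut"
    using f h by (simp add: Aut_iff permutes_inv)
  moreover have "?i \<otimes>\<^bsub>Aut\<^esub> g = \<one>\<^bsub>Aut\<^esub>"
    using f h by (simp add: mult_Aut one_Aut permutes_inv_o)
  ultimately show "\<exists>h \<in> carrier Aut. h \<otimes>\<^bsub>Aut\<^esub> g = \<one>\<^bsub>Aut\<^esub>" by blast
qed (simp_all add: mult_Aut one_Aut Aut_iff o_assoc permutes_id)

lemma fst_mult: "fst (g \<otimes>\<^bsub>Aut\<^esub> h) x = fst g (fst h x)"
  by (simp add: mult_Aut)

lemma fst_one: "fst \<one>\<^bsub>Aut\<^esub> x = x"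
  by (simp add: one_Aut)

lemma fst_inv: "g \<in> carrier Aut \<Longrightarrow> fst (inv\<^bsub>Aut\<^esub> g) (fst g x) = x"
  and fst_inv': "g \<in> carrier Aut \<Longrightarrow> fst g (fst (inv\<^bsub>Aut\<^esub> g) x) = x"
  by (metis fst_mult fst_one Aut.l_inv, metis fst_mult fst_one Aut.r_inv)

lemma fst_in_iff: "g \<in> carrier Aut \<Longrightarrow> fst g x \<in> verts T \<longleftrightarrow> x \<in> verts T"
  by (simp add: Aut_iff permutes_in_image)

lemma fst_in: "g \<in> carrier Aut \<Longrightarrow> x \<in> verts T \<Longrightarrow> fst g x \<in> verts T"
  by (simp add: fst_in_iff)

lemma local_action_eq: "\<omega> \<in> \<Omega> \<Longrightarrow> \<sigma> g x \<omega> = l (snd g (edge x \<omega>))"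
  by (simp add: local_action_def restrict_id_def edge_def)

lemma local_action_outside: "\<omega> \<notin> \<Omega> \<Longrightarrow> \<sigma> g x \<omega> = \<omega>"
  by (simp add: local_action_def restrict_id_def)

lemma local_action_in: "g \<in> carrier Aut \<Longrightarrow> x \<in> verts T \<Longrightarrow> \<omega> \<in> \<Omega> \<Longrightarrow> \<sigma> g x \<omega> \<in> \<Omega>"
  by (simp add: local_action_eq Aut_iff permutes_in_image edge_in l_in)

lemma snd_edge:
  assumes "g \<in> carrier Aut" "x \<in> verts T" "\<omega> \<in> \<Omega>"
  shows "snd g (edge x \<omega>) = edge (fst g x) (\<sigma> g x \<omega>)"
  using assms edge_eq[of "snd g (edge x \<omega>)"]
  by (simp add: local_action_eq Aut_iff permutes_in_image edge_in tail_edge)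

lemma fst_nb:
  assumes "g \<in> carrier Aut" "x \<in> verts T" "\<omega> \<in> \<Omega>"
  shows "fst g (nb x \<omega>) = nb (fst g x) (\<sigma> g x \<omega>)"
  using assms snd_edge[OF assms] edge_in[OF assms(2,3)] by (metis Aut_iff nb_def)

text \<open>The two orientations of an edge have the same colour, hence so do their images. This is
  the only relation between the local actions at different vertices (see
  \<open>ex_automorphism\<close>).\<close>

lemma local_action_nb:
  assumes "g \<in> carrier Aut" "x \<in> verts T" "\<omega> \<in> \<Omega>"
  shows "\<sigma> g (nb x \<omega>) \<omega> = \<sigma> g x \<omega>"
proof -
  have "\<sigma> g (nb x \<omega>) \<omega> = l (snd g (arev (edge x \<omega>)))"
    using assms by (simp add: local_action_eq arev_edge)
  also have "\<dots> = l (snd g (edge x \<omega>))"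
    using assms by (simp add: Aut_iff edge_in permutes_in_image l_arev)
  finally show ?thesis using assms by (simp add: local_action_eq)
qed

lemma local_action_mult:
  assumes "g \<in> carrier Aut" "h \<in> carrier Aut" "x \<in> verts T"
  shows "\<sigma> (g \<otimes>\<^bsub>Aut\<^esub> h) x = \<sigma> g (fst h x) \<circ> \<sigma> h x"
proof
  fix \<omega>
  show "\<sigma> (g \<otimes>\<^bsub>Aut\<^esub> h) x \<omega> = (\<sigma> g (fst h x) \<circ> \<sigma> h x) \<omega>"
  proof (cases "\<omega> \<in> \<Omega>")
    case True
    then have "\<sigma> (g \<otimes>\<^bsub>Aut\<^esub> h) x \<omega> = l (snd g (snd h (edge x \<omega>)))"
      by (simp add: local_action_eq mult_Aut)
    also have "\<dots> = \<sigma> g (fst h x) (\<sigma> h x \<omega>)"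
      using assms True by (simp add: snd_edge local_action_eq[of "\<sigma> h x \<omega>"] local_action_in)
    finally show ?thesis by simp
  qed (simp add: local_action_outside)
qed

lemma local_action_one: "x \<in> verts T \<Longrightarrow> \<sigma> \<one>\<^bsub>Aut\<^esub> x = id"
  by (auto simp: fun_eq_iff local_action_def restrict_id_def one_Aut edge_def[symmetric] l_edge)

lemma local_action_inv:
  assumes "g \<in> carrier Aut" "x \<in> verts T"
  shows "\<sigma> (inv\<^bsub>Aut\<^esub> g) (fst g x) \<circ> \<sigma> g x = id" and "\<sigma> g x \<circ> \<sigma> (inv\<^bsub>Aut\<^esub> g) (fst g x) = id"
proof -
  show "\<sigma> (inv\<^bsub>Aut\<^esub> g) (fst g x) \<circ> \<sigma> g x = id"
    using local_action_mult[of "inv\<^bsub>Aut\<^esub> g" g x] assms by (simp add: local_action_one)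
  show "\<sigma> g x \<circ> \<sigma> (inv\<^bsub>Aut\<^esub> g) (fst g x) = id"
    using local_action_mult[of g "inv\<^bsub>Aut\<^esub> g" "fst g x"] assms by (simp add: local_action_one fst_inv fst_in)
qed

lemma local_action_permutes:
  assumes "g \<in> carrier Aut" "x \<in> verts T"
  shows "\<sigma> g x permutes \<Omega>"
proof -
  have "bij (\<sigma> g x)"
    using local_action_inv[OF assms] by (rule o_bij)
  then show ?thesis
    by (simp add: permutes_def bij_iff local_action_outside)
qed

lemma local_action_inv_eq:
  assumes "g \<in> carrier Aut" "x \<in> verts T"
  shows "\<sigma> (inv\<^bsub>Aut\<^esub> g) (fst g x) = inv_into UNIV (\<sigma> g x)"
  using local_action_inv[OF assms] by (metis inv_unique_comp)

lemma local_action_determined: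
  assumes "g \<in> carrier Aut" "h \<in> carrier Aut" "x \<in> verts T" "fst g x = fst h x"
    and "\<And>\<omega>. \<omega> \<in> \<Omega> \<Longrightarrow> fst g (nb x \<omega>) = fst h (nb x \<omega>)"
  shows "\<sigma> g x = \<sigma> h x"
proof
  fix \<omega>
  show "\<sigma> g x \<omega> = \<sigma> h x \<omega>"
  proof (cases "\<omega> \<in> \<Omega>")
    case True
    then have "nb (fst g x) (\<sigma> g x \<omega>) = nb (fst g x) (\<sigma> h x \<omega>)"
      using assms fst_nb by metis
    then show ?thesis using assms True nb_inj local_action_in fst_in by metis
  qed (simp add: local_action_outside)
qed

text \<open>There are no parallel edges: neighbours across different colours are different
  (\<open>nb_inj\<close>), so the action on vertices determines the action on edges. This is why the
  permutation topology for the vertices separates automorphisms.\<close>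

lemma Aut_eqI:
  assumes g: "g \<in> carrier Aut" and h: "h \<in> carrier Aut" and eq: "\<And>x. x \<in> verts T \<Longrightarrow> fst g x = fst h x"
  shows "g = h"
proof -
  have "fst g = fst h"
    using g h eq unfolding Aut_iff permutes_def by (metis ext)
  moreover have "snd g e = snd h e" for e
  proof (cases "e \<in> arcs T")
    case True
    have "\<sigma> g (tail T e) = \<sigma> h (tail T e)"
      using True by (intro local_action_determined g h) (auto simp: tail_in nb_in eq)
    then show ?thesis
      using snd_edge[OF g tail_in[OF True] l_in[OF True]] snd_edge[OF h tail_in[OF True] l_in[OF True]]
        edge_eq[OF True] eq[OF tail_in[OF True]] by simp
  next
    case False
    then show ?thesis using g h unfolding Aut_iff permutes_def by metis
  qed
  ultimately show ?thesis by (simp add: prod_eq_iff fun_eq_iff)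
qed

text \<open>The colours read along the image of a walk: an automorphism with local actions
  \<open>\<tau>\<close> sends the walk \<open>w\<close> from \<open>x\<close> to the walk
  \<open>img \<tau> x w\<close> from the image of \<open>x\<close> (\<open>fst_foldl_nb\<close>).
  The recursion follows the original walk, not its image.\<close>

primrec img :: "('v \<Rightarrow> 'c \<Rightarrow> 'c) \<Rightarrow> 'v \<Rightarrow> 'c list \<Rightarrow> 'c list" where
  "img \<tau> x [] = []"
| "img \<tau> x (\<omega> # w) = \<tau> x \<omega> # img \<tau> (nb x \<omega>) w"

lemma img_append: "img \<tau> x (w @ w') = img \<tau> x w @ img \<tau> (foldl nb x w) w'"
  by (induction w arbitrary: x) auto

lemma length_img [simp]: "length (img \<tau> x w) = length w"
  by (induction w arbitrary: x) auto

text \<open>On the vertices these are exactly the families of local actions of automorphisms: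
  necessity is \<open>consistent_local_action\<close>, sufficiency
  \<open>ex_automorphism\<close>.\<close>

definition consistent :: "('v \<Rightarrow> 'c \<Rightarrow> 'c) \<Rightarrow> bool" where
  "consistent \<tau> \<longleftrightarrow> (\<forall>x \<in> verts T. \<tau> x permutes \<Omega>) \<and>
     (\<forall>x \<in> verts T. \<forall>\<omega> \<in> \<Omega>. \<tau> (nb x \<omega>) \<omega> = \<tau> x \<omega>)"

lemma consistent_local_action: "g \<in> carrier Aut \<Longrightarrow> consistent (\<sigma> g)"
  by (simp add: consistent_def local_action_permutes local_action_nb)

lemma set_img: "consistent \<tau> \<Longrightarrow> x \<in> verts T \<Longrightarrow> set w \<subseteq> \<Omega> \<Longrightarrow> set (img \<tau> x w) \<subseteq> \<Omega>"
  by (induction w arbitrary: x) (auto simp: nb_in consistent_def permutes_in_image)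

text \<open>By consistency the image of a letter may also be read at the next vertex, where it and
  the following letter are transformed by the same injective map.\<close>

lemma distinct_adj_img:
  "consistent \<tau> \<Longrightarrow> x \<in> verts T \<Longrightarrow> set w \<subseteq> \<Omega> \<Longrightarrow> distinct_adj w \<Longrightarrow> distinct_adj (img \<tau> x w)"
proof (induction w arbitrary: x)
  case (Cons \<omega> w)
  have IH: "distinct_adj (img \<tau> (nb x \<omega>) w)"
    using Cons.IH[of "nb x \<omega>"] Cons.prems distinct_adj_ConsD[of \<omega> w] by (simp add: nb_in)
  show ?case
  proof (cases w)
    case (Cons \<omega>' w')
    have "\<omega> \<noteq> \<omega>'" "\<omega> \<in> \<Omega>" "nb x \<omega> \<in> verts T" using Cons.prems Cons by (auto simp: nb_in)
    then have "\<tau> x \<omega> \<noteq> \<tau> (nb x \<omega>) \<omega>'"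
      using Cons.prems unfolding consistent_def by (metis permutes_def)
    then show ?thesis using IH Cons by simp
  qed simp
qed simp

lemma fst_foldl_nb:
  assumes "g \<in> carrier Aut" "x \<in> verts T" "set w \<subseteq> \<Omega>"
  shows "fst g (foldl nb x w) = foldl nb (fst g x) (img (\<sigma> g) x w)"
  using assms(2,3) by (induction w arbitrary: x) (auto simp: nb_in fst_nb[OF assms(1)])

end

section \<open>Words from a root and the construction of automorphisms from local data\<close>

locale rooted_colored_tree = colored_tree T arev \<Omega> l for T :: "('v, 'e) pre_digraph" and arev and \<Omega> :: "'c set" and l +
  fixes b :: 'v
  assumes b_in: "b \<in> verts T"
begin

definition word :: "'v \<Rightarrow> 'c list" where
  "word x = (SOME w. set w \<subseteq> \<Omega> \<and> distinct_adj w \<and> foldl nb b w = x)"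

abbreviation depth :: "'v \<Rightarrow> nat" where
  "depth x \<equiv> length (word x)"

lemma
  assumes "x \<in> verts T"
  shows word_in: "set (word x) \<subseteq> \<Omega>" and word_reduced: "distinct_adj (word x)"
    and foldl_word: "foldl nb b (word x) = x"
proof -
  have "\<exists>w. set w \<subseteq> \<Omega> \<and> distinct_adj w \<and> foldl nb b w = x"
    using reduced_walk[OF b_in assms] by metis
  from someI_ex[OF this] show "set (word x) \<subseteq> \<Omega>" "distinct_adj (word x)" "foldl nb b (word x) = x"
    unfolding word_def by auto
qed

lemma word_foldl: "set w \<subseteq> \<Omega> \<Longrightarrow> distinct_adj w \<Longrightarrow> word (foldl nb b w) = w"
  using foldl_nb_in[OF b_in, of w] word_in word_reduced foldl_word
  by (intro reduced_walk_unique[OF b_in]) auto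

lemma word_b [simp]: "word b = []"
  using word_foldl[of "[]"] by simp

lemma depth_0_iff: "x \<in> verts T \<Longrightarrow> word x = [] \<longleftrightarrow> x = b"
  using foldl_word[of x] by (auto simp del: foldl_word)

lemma word_nb:
  assumes "x \<in> verts T" "\<omega> \<in> \<Omega>"
  shows "word (nb x \<omega>) = word x @ [\<omega>] \<or> word x = word (nb x \<omega>) @ [\<omega>]"
proof (cases "word x \<noteq> [] \<and> last (word x) = \<omega>")
  case True
  then obtain u where u: "word x = u @ [\<omega>]" by (metis append_butlast_last_id)
  have r: "set u \<subseteq> \<Omega>" "distinct_adj u" 
    using word_in[OF assms(1)] word_reduced[OF assms(1)] by (auto simp: u)
  have "x = nb (foldl nb b u) \<omega>"
    using foldl_word[OF assms(1)] u by simp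
  then have "nb x \<omega> = foldl nb b u"
    using nb_nb[OF foldl_nb_in[OF b_in r(1)] assms(2)] by simp
  then show ?thesis using u word_foldl[OF r] by simp
next
  case False
  then have "distinct_adj (word x @ [\<omega>])" "set (word x @ [\<omega>]) \<subseteq> \<Omega>"
    using word_in[OF assms(1)] word_reduced[OF assms(1)] assms(2) by (auto simp: distinct_adj_append_iff)
  from word_foldl[OF this(2,1)] show ?thesis
    using foldl_word[OF assms(1)] by simp
qed

lemma depth_nb: "x \<in> verts T \<Longrightarrow> \<omega> \<in> \<Omega> \<Longrightarrow> depth (nb x \<omega>) \<le> Suc (depth x)"
  using word_nb[of x \<omega>] by (metis le_SucI length_append_singleton order_refl le_Suc_eq)

lemma word_parent:
  assumes "x \<in> verts T" "word x = u @ [\<omega>]"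
  shows "foldl nb b u \<in> verts T" "word (foldl nb b u) = u" "nb (foldl nb b u) \<omega> = x" "\<omega> \<in> \<Omega>"
proof -
  have r: "set u \<subseteq> \<Omega>" "distinct_adj u" "\<omega> \<in> \<Omega>"
    using word_in[OF assms(1)] word_reduced[OF assms(1)] by (auto simp: assms(2))
  then show "foldl nb b u \<in> verts T" "word (foldl nb b u) = u" "\<omega> \<in> \<Omega>"
    using foldl_nb_in[OF b_in] word_foldl by auto
  show "nb (foldl nb b u) \<omega> = x" using foldl_word[OF assms(1)] assms(2) by simp
qed

lemma finite_ball: "finite \<Omega> \<Longrightarrow> finite {x \<in> verts T. depth x \<le> n}"
proof (rule finite_subset)
  show "{x \<in> verts T. depth x \<le> n} \<subseteq> foldl nb b ` {w. set w \<subseteq> \<Omega> \<and> length w \<le> n}"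
    using foldl_word word_in by (force intro: image_eqI[where x = "word x" for x])
qed (simp add: finite_lists_length_le)

lemma depth_fst:
  assumes "g \<in> carrier Aut" "fst g b = b" "x \<in> verts T"
  shows "depth (fst g x) = depth x"
proof -
  have "fst g x = foldl nb b (img (\<sigma> g) b (word x))"
    using fst_foldl_nb[OF assms(1) b_in word_in[OF assms(3)]] assms by (simp add: foldl_word)
  moreover have "word (foldl nb b (img (\<sigma> g) b (word x))) = img (\<sigma> g) b (word x)"
    using assms by (intro word_foldl set_img distinct_adj_img consistent_local_action b_in word_in word_reduced)
  ultimately show ?thesis by simp
qed

text \<open>The image of a vertex depends on the local actions at the vertices preceding it on the
  path from the root, its own excluded; hence the strict inequality in the hypothesis and
  \<open>\<le>\<close> for \<open>x\<close> itself.\<close>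

lemma fst_agree:
  assumes "g \<in> carrier Aut" "h \<in> carrier Aut" "fst g b = fst h b"
    and "\<And>x. x \<in> verts T \<Longrightarrow> depth x < n \<Longrightarrow> \<sigma> g x = \<sigma> h x"
    and "x \<in> verts T" "depth x \<le> n"
  shows "fst g x = fst h x"
  using assms(5,6)
proof (induction "word x" arbitrary: x rule: rev_induct)
  case Nil
  then have "x = b" using depth_0_iff[of x] by simp
  then show ?case using assms(3) by simp
next
  case (snoc \<omega> u)
  note p = word_parent[OF snoc.prems(1) snoc.hyps(2)[symmetric]]
  have d: "depth (foldl nb b u) < n" using p(2) snoc.hyps(2)[symmetric] snoc.prems(2) by simp
  have "fst g (foldl nb b u) = fst h (foldl nb b u)"
    using snoc.hyps(1)[of "foldl nb b u"] p d by simp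
  then show ?case
    using fst_nb[OF assms(1) p(1,4)] fst_nb[OF assms(2) p(1,4)] assms(4)[OF p(1) d] p(3) by simp
qed

text \<open>The image of \<open>x\<close> has to be the end of the transformed word from
  \<open>b'\<close>. Consistency gives the same rule for walks that start anywhere
  (\<open>f_foldl\<close>). Injectivity holds because a nonempty reduced walk from \<open>x\<close>
  to \<open>y\<close> with equal images would become a nonempty closed reduced walk, and
  surjectivity because any walk from \<open>b'\<close> can be pulled back letter by letter.\<close>

lemma ex_automorphism:
  assumes \<tau>: "consistent \<tau>" and b': "b' \<in> verts T"
  obtains g where "g \<in> carrier Aut" "fst g b = b'" "\<And>x. x \<in> verts T \<Longrightarrow> \<sigma> g x = \<tau> x"
proof -
  have perm: "\<tau> x permutes \<Omega>" if "x \<in> verts T" for x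
    using \<tau> that by (simp add: consistent_def)
  have \<tau>_nb: "\<tau> (nb x \<omega>) \<omega> = \<tau> x \<omega>" if "x \<in> verts T" "\<omega> \<in> \<Omega>" for x \<omega>
    using \<tau> that by (simp add: consistent_def)
  have \<tau>_in: "\<tau> x \<omega> \<in> \<Omega>" if "x \<in> verts T" "\<omega> \<in> \<Omega>" for x \<omega>
    using perm that by (simp add: permutes_in_image)
  define f where "f x = (if x \<in> verts T then foldl nb b' (img \<tau> b (word x)) else x)" for x
  have f_in: "f x \<in> verts T" if "x \<in> verts T" for x
    using that by (simp add: f_def foldl_nb_in b' set_img \<tau> b_in word_in)
  have f_snoc: "f x = nb (f (nb x \<omega>)) (\<tau> x \<omega>)"
    if x: "x \<in> verts T" "\<omega> \<in> \<Omega>" "word x = word (nb x \<omega>) @ [\<omega>]" for x \<omega>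
  proof -
    have "f x = nb (f (nb x \<omega>)) (\<tau> (foldl nb b (word (nb x \<omega>))) \<omega>)"
      using x by (simp add: f_def nb_in img_append)
    then show ?thesis using x by (simp add: foldl_word nb_in \<tau>_nb)
  qed
  have f_nb: "f (nb x \<omega>) = nb (f x) (\<tau> x \<omega>)" if x: "x \<in> verts T" "\<omega> \<in> \<Omega>" for x \<omega>
    using word_nb[OF x]
  proof
    assume "word (nb x \<omega>) = word x @ [\<omega>]"
    then show ?thesis
      using f_snoc[of "nb x \<omega>" \<omega>] x by (simp add: nb_in nb_nb \<tau>_nb)
  next
    assume "word x = word (nb x \<omega>) @ [\<omega>]"
    then show ?thesis
      using f_snoc[of x \<omega>] x by (simp add: nb_nb f_in nb_in \<tau>_in)
  qed
  have f_foldl: "f (foldl nb x w) = foldl nb (f x) (img \<tau> x w)" if "x \<in> verts T" "set w \<subseteq> \<Omega>" for x w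
    using that by (induction w arbitrary: x) (auto simp: nb_in f_nb)
  have f_b: "f b = b'" by (simp add: f_def b_in)
  have inj: "x = y" if xy: "x \<in> verts T" "y \<in> verts T" "f x = f y" for x y
  proof -
    obtain w where w: "set w \<subseteq> \<Omega>" "distinct_adj w" "foldl nb x w = y"
      using reduced_walk[OF xy(1,2)] .
    then have "foldl nb (f x) (img \<tau> x w) = f x"
      using f_foldl[OF xy(1) w(1)] xy(3) by simp
    then have "img \<tau> x w = []"
      using w xy \<tau> by (intro reduced_closed_walk[of "f x"]) (auto simp: f_in distinct_adj_img dest: set_img[OF \<tau> xy(1) w(1), THEN subsetD])
    then have "w = []" by (metis length_0_conv length_img)
    then show ?thesis using w by simp
  qed
  have surj: "\<exists>x \<in> verts T. f x = y" if y: "y \<in> verts T" for y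
  proof -
    obtain w where w: "set w \<subseteq> \<Omega>" "foldl nb b' w = y"
      using connected_words[OF b' y] .
    have "\<exists>x \<in> verts T. f x = foldl nb b' w" using w(1)
    proof (induction w rule: rev_induct)
      case Nil
      then show ?case using f_b b_in by auto
    next
      case (snoc \<omega> w)
      then obtain x where x: "x \<in> verts T" "f x = foldl nb b' w" by auto
      obtain \<alpha> where "\<alpha> \<in> \<Omega>" "\<tau> x \<alpha> = \<omega>"
        using perm[OF x(1)] snoc.prems by (metis permutes_image image_iff in_set_conv_decomp subsetD)
      then show ?case using f_nb[OF x(1)] x nb_in by (intro bexI[of _ "nb x \<alpha>"]) auto
    qed
    then show ?thesis using w by simp
  qed
  have f_perm: "f permutes verts T"
  proof (rule bij_imp_permutes)
    show "bij_betw f (verts T) (verts T)"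
      unfolding bij_betw_def inj_on_def using inj surj f_in by blast
  qed (simp add: f_def)
  \<comment> \<open>Forced, since an edge is determined by its origin and its colour.\<close>
  define h where "h e = (if e \<in> arcs T then edge (f (tail T e)) (\<tau> (tail T e) (l e)) else e)" for e
  have h_edge: "h (edge x \<omega>) = edge (f x) (\<tau> x \<omega>)" if "x \<in> verts T" "\<omega> \<in> \<Omega>" for x \<omega>
    using that by (simp add: h_def edge_in tail_edge l_edge)
  have arcs_edge: "\<exists>x \<in> verts T. \<exists>\<omega> \<in> \<Omega>. e = edge x \<omega>" if "e \<in> arcs T" for e
    using that edge_eq tail_in l_in by metis
  have h_perm: "h permutes arcs T"
  proof (rule bij_imp_permutes)
    have "e = e'" if e: "e \<in> arcs T" "e' \<in> arcs T" "h e = h e'" for e e'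
    proof -
      have *: "edge (f (tail T e)) (\<tau> (tail T e) (l e)) = edge (f (tail T e')) (\<tau> (tail T e') (l e'))"
        using e by (simp add: h_def)
      have t: "f (tail T e) = f (tail T e')"
        using arg_cong[OF *, of "tail T"] e by (simp add: tail_edge f_in tail_in \<tau>_in l_in)
      have c: "\<tau> (tail T e) (l e) = \<tau> (tail T e') (l e')"
        using arg_cong[OF *, of l] e by (simp add: l_edge f_in tail_in \<tau>_in l_in)
      have "tail T e = tail T e'" using inj t e tail_in by blast
      moreover have "l e = l e'"
        using c perm[OF tail_in[OF e(2)]] calculation by (metis permutes_def)
      ultimately show ?thesis using edge_eq e by metis
    qed
    moreover have "\<exists>e' \<in> arcs T. h e' = e" if e: "e \<in> arcs T" for e
    proof -
      obtain x where x: "x \<in> verts T" "f x = tail T e" using surj tail_in[OF e] by blast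
      obtain \<alpha> where "\<alpha> \<in> \<Omega>" "\<tau> x \<alpha> = l e"
        using perm[OF x(1)] l_in[OF e] by (metis permutes_image image_iff)
      then show ?thesis
        using x edge_eq[OF e] by (intro bexI[of _ "edge x \<alpha>"]) (auto simp: h_edge edge_in)
    qed
    moreover have "h e \<in> arcs T" if "e \<in> arcs T" for e
      using that by (simp add: h_def edge_in f_in tail_in \<tau>_in l_in)
    ultimately show "bij_betw h (arcs T) (arcs T)"
      unfolding bij_betw_def inj_on_def by blast
  qed (simp add: h_def)
  have inc: "tail T (h e) = f (tail T e) \<and> head T (h e) = f (head T e) \<and> h (arev e) = arev (h e)"
    if e: "e \<in> arcs T" for e
  proof -
    obtain x \<omega> where x: "x \<in> verts T" "\<omega> \<in> \<Omega>" "e = edge x \<omega>" using arcs_edge[OF e] by blast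
    then show ?thesis
      using f_nb[OF x(1,2)]
      by (simp add: h_edge tail_edge nb_def[symmetric] f_in \<tau>_in arev_edge nb_in \<tau>_nb)
  qed
  have g: "(f, h) \<in> carrier Aut"
    using f_perm h_perm inc by (simp add: Aut_iff)
  moreover have "\<sigma> (f, h) x = \<tau> x" if x: "x \<in> verts T" for x
  proof
    fix \<omega> show "\<sigma> (f, h) x \<omega> = \<tau> x \<omega>"
    proof (cases "\<omega> \<in> \<Omega>")
      case True
      then show ?thesis using x by (simp add: local_action_eq h_edge l_edge f_in \<tau>_in)
    next
      case False
      then show ?thesis using perm[OF x] by (simp add: local_action_outside permutes_not_in)
    qed
  qed
  ultimately show thesis using that f_b by (metis fst_conv)
qed

text \<open>Going outwards, a vertex outside \<open>D\<close> is constrained only at the colour of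
  its edge towards the root. Some element of \<open>H\<close> has the required value there, because
  by induction all permutations chosen so far move colours inside \<open>H\<close>-orbits. The
  hypothesis \<open>t0_nb\<close> makes \<open>D\<close> closed under passing to the parent, so no
  prescribed vertex lies beyond a free one.\<close>

lemma extend_local_data:
  assumes b': "b' \<in> verts T"
    and H_perm: "\<And>\<pi>. \<pi> \<in> H \<Longrightarrow> \<pi> permutes \<Omega>" and H_id: "id \<in> H"
    and t0_perm: "\<And>x. x \<in> D \<Longrightarrow> t0 x permutes \<Omega>"
    and t0_orb: "\<And>x \<omega>. x \<in> D \<Longrightarrow> \<omega> \<in> \<Omega> \<Longrightarrow> \<exists>\<pi> \<in> H. t0 x \<omega> = \<pi> \<omega>"
    and t0_nb: "\<And>x \<omega>. x \<in> verts T \<Longrightarrow> \<omega> \<in> \<Omega> \<Longrightarrow> depth (nb x \<omega>) = Suc (depth x) \<Longrightarrow>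
       nb x \<omega> \<in> D \<Longrightarrow> x \<in> D \<and> t0 (nb x \<omega>) \<omega> = t0 x \<omega>"
  obtains g where "g \<in> carrier Aut" "fst g b = b'"
    "\<And>x. x \<in> D \<Longrightarrow> x \<in> verts T \<Longrightarrow> \<sigma> g x = t0 x" "\<And>x. x \<in> verts T \<Longrightarrow> x \<notin> D \<Longrightarrow> \<sigma> g x \<in> H"
proof -
  \<comment> \<open>Recursion on the reversed word: its head is the colour of the edge to the
    parent, its tail the reversed word of the parent, and \<open>\<rho>\<close> the permutation
    already chosen there.\<close>
  define t where "t = rec_list (if b \<in> D then t0 b else id)
     (\<lambda>\<omega> r \<rho>. if foldl nb b (rev (\<omega> # r)) \<in> D then t0 (foldl nb b (rev (\<omega> # r)))
        else (SOME \<pi>. \<pi> \<in> H \<and> \<pi> \<omega> = \<rho> \<omega>))"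
  have t_Nil: "t [] = (if b \<in> D then t0 b else id)" by (simp add: t_def)
  have t_Cons: "t (\<omega> # r) = (if foldl nb b (rev (\<omega> # r)) \<in> D then t0 (foldl nb b (rev (\<omega> # r)))
        else (SOME \<pi>. \<pi> \<in> H \<and> \<pi> \<omega> = t r \<omega>))" for \<omega> r
    by (simp add: t_def)
  define \<tau> where "\<tau> x = t (rev (word x))" for x
  have \<tau>_D: "\<tau> x = t0 x" if "x \<in> verts T" "x \<in> D" for x
  proof (cases "rev (word x)")
    case Nil
    then show ?thesis using that depth_0_iff[of x] by (simp add: \<tau>_def t_Nil)
  next
    case (Cons \<omega> r)
    then have "foldl nb b (rev (\<omega> # r)) = x" using foldl_word[OF that(1)] by (metis rev_rev_ident)
    then show ?thesis using that Cons by (simp only: \<tau>_def t_Cons if_True)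
  qed
  have \<tau>_snoc: "\<tau> x \<in> H \<and> \<tau> x \<omega> = \<tau> (foldl nb b u) \<omega>"
    if x: "x \<in> verts T" "x \<notin> D" "word x = u @ [\<omega>]" and orb: "\<exists>\<pi> \<in> H. \<tau> (foldl nb b u) \<omega> = \<pi> \<omega>" for x u \<omega>
  proof -
    have *: "\<tau> x = (SOME \<pi>. \<pi> \<in> H \<and> \<pi> \<omega> = \<tau> (foldl nb b u) \<omega>)"
      using x foldl_word[OF x(1)] word_parent(2)[OF x(1,3)] by (simp add: \<tau>_def t_Cons)
    have "\<exists>\<pi>. \<pi> \<in> H \<and> \<pi> \<omega> = \<tau> (foldl nb b u) \<omega>" using orb by metis
    from someI_ex[OF this] show ?thesis unfolding * by simp
  qed
  have \<tau>_orb: "\<forall>\<omega> \<in> \<Omega>. \<exists>\<pi> \<in> H. \<tau> x \<omega> = \<pi> \<omega>" if "x \<in> verts T" for x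
    using that
  proof (induction "word x" arbitrary: x rule: rev_induct)
    case Nil
    then have "x = b" using depth_0_iff[of x] by simp
    then show ?case using Nil t0_orb H_id \<tau>_D[of x] by (cases "x \<in> D") (auto simp: \<tau>_def t_Nil intro!: bexI[of _ id])
  next
    case (snoc \<omega> u)
    note p = word_parent[OF snoc.prems snoc.hyps(2)[symmetric]]
    show ?case
    proof (cases "x \<in> D")
      case True
      then show ?thesis using t0_orb \<tau>_D snoc.prems by simp
    next
      case False
      then have "\<tau> x \<in> H"
        using \<tau>_snoc[OF snoc.prems False snoc.hyps(2)[symmetric]] snoc.hyps(1)[of "foldl nb b u"] p by simp
      then show ?thesis by blast
    qed
  qed
  have \<tau>_H: "\<tau> x \<in> H" if x: "x \<in> verts T" "x \<notin> D" for x
  proof (cases "word x" rule: rev_cases)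
    case Nil
    then have "x = b" using x depth_0_iff by simp
    then show ?thesis using x H_id by (simp add: \<tau>_def t_Nil)
  next
    case (snoc u \<omega>)
    then show ?thesis using \<tau>_snoc[OF x snoc] \<tau>_orb word_parent[OF x(1) snoc] by blast
  qed
  have snoc: "\<tau> (nb x \<omega>) \<omega> = \<tau> x \<omega>" if x: "x \<in> verts T" "\<omega> \<in> \<Omega>" "word (nb x \<omega>) = word x @ [\<omega>]" for x \<omega>
  proof (cases "nb x \<omega> \<in> D")
    case True
    then show ?thesis using t0_nb[OF x(1,2)] x(3) \<tau>_D nb_in x by simp
  next
    case False
    then show ?thesis using \<tau>_snoc[OF nb_in[OF x(1,2)] False x(3)] \<tau>_orb x foldl_word by simp
  qed
  have "consistent \<tau>"
    unfolding consistent_def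
  proof (intro conjI ballI)
    fix x assume "x \<in> verts T"
    then show "\<tau> x permutes \<Omega>" using \<tau>_D t0_perm \<tau>_H H_perm by (cases "x \<in> D") auto
  next
    fix x \<omega> assume x: "x \<in> verts T" "\<omega> \<in> \<Omega>"
    from word_nb[OF x] show "\<tau> (nb x \<omega>) \<omega> = \<tau> x \<omega>"
    proof
      assume "word x = word (nb x \<omega>) @ [\<omega>]"
      then show ?thesis using snoc[of "nb x \<omega>" \<omega>] x by (simp add: nb_in nb_nb)
    qed (use snoc x in blast)
  qed
  from ex_automorphism[OF this b'] obtain g
    where "g \<in> carrier Aut" "fst g b = b'" "\<And>x. x \<in> verts T \<Longrightarrow> \<sigma> g x = \<tau> x" by blast
  then show thesis using that \<tau>_D \<tau>_H by simp
qed

end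

section \<open>Symmetric groups\<close>

lemma carrier_Sym: "carrier (Sym A) = {\<pi>. \<pi> permutes A}"
  and mult_Sym: "\<pi> \<otimes>\<^bsub>Sym A\<^esub> \<rho> = \<pi> \<circ> \<rho>"
  and one_Sym: "\<one>\<^bsub>Sym A\<^esub> = id"
  by (simp_all add: Sym_def)

lemma group_Sym: "group (Sym A)"
proof (rule groupI)
  fix \<pi> assume "\<pi> \<in> carrier (Sym A)"
  then show "\<exists>\<rho> \<in> carrier (Sym A). \<rho> \<otimes>\<^bsub>Sym A\<^esub> \<pi> = \<one>\<^bsub>Sym A\<^esub>"
    by (intro bexI[of _ "inv_into UNIV \<pi>"])
      (simp_all add: carrier_Sym mult_Sym one_Sym permutes_inv permutes_inv_o)
qed (simp_all add: carrier_Sym mult_Sym one_Sym permutes_compose permutes_id o_assoc)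

lemma inv_Sym: "\<pi> permutes A \<Longrightarrow> inv\<^bsub>Sym A\<^esub> \<pi> = inv_into UNIV \<pi>"
  by (intro group.inv_equality[OF group_Sym])
    (simp_all add: carrier_Sym mult_Sym one_Sym permutes_inv permutes_inv_o)

lemma subgroup_SymD:
  assumes "subgroup H (Sym A)"
  shows "\<And>\<pi>. \<pi> \<in> H \<Longrightarrow> \<pi> permutes A" "id \<in> H" "\<And>\<pi> \<rho>. \<pi> \<in> H \<Longrightarrow> \<rho> \<in> H \<Longrightarrow> \<pi> \<circ> \<rho> \<in> H"
    "\<And>\<pi>. \<pi> \<in> H \<Longrightarrow> inv_into UNIV \<pi> \<in> H"
proof -
  show p: "\<pi> permutes A" if "\<pi> \<in> H" for \<pi>
    using subgroup.mem_carrier[OF assms that] by (simp add: carrier_Sym)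
  show "id \<in> H" using subgroup.one_closed[OF assms] by (simp add: one_Sym)
  show "\<pi> \<circ> \<rho> \<in> H" if "\<pi> \<in> H" "\<rho> \<in> H" for \<pi> \<rho>
    using subgroup.m_closed[OF assms that] by (simp add: mult_Sym)
  show "inv_into UNIV \<pi> \<in> H" if "\<pi> \<in> H" for \<pi>
    using subgroup.m_inv_closed[OF assms that] by (simp add: inv_Sym p that)
qed

section \<open>The permutation topology\<close>

context rooted_colored_tree
begin

abbreviation U :: "('c \<Rightarrow> 'c) set \<Rightarrow> (('v \<Rightarrow> 'v) \<times> ('e \<Rightarrow> 'e)) set" where
  "U \<equiv> U_set T arev \<Omega> l"

abbreviation Gs :: "('c \<Rightarrow> 'c) set \<Rightarrow> (('v \<Rightarrow> 'v) \<times> ('e \<Rightarrow> 'e)) set" where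
  "Gs \<equiv> G_set T arev \<Omega> l"

abbreviation sub :: "(('v \<Rightarrow> 'v) \<times> ('e \<Rightarrow> 'e)) set \<Rightarrow> (('v \<Rightarrow> 'v) \<times> ('e \<Rightarrow> 'e)) monoid" where
  "sub K \<equiv> Aut\<lparr>carrier := K\<rparr>"

definition fixing :: "'v set \<Rightarrow> (('v \<Rightarrow> 'v) \<times> ('e \<Rightarrow> 'e)) set \<Rightarrow> (('v \<Rightarrow> 'v) \<times> ('e \<Rightarrow> 'e)) set" where
  "fixing B K = {g \<in> K. \<forall>x \<in> B. fst g x = x}"

text \<open>Cut down to \<open>K\<close>, so that \<open>base (U H)\<close> can also serve as a base
  at the unit of the larger group \<open>Gs H\<close>, whose topology is extended from
  \<open>U H\<close>.\<close>

definition base :: "(('v \<Rightarrow> 'v) \<times> ('e \<Rightarrow> 'e)) set \<Rightarrow> (('v \<Rightarrow> 'v) \<times> ('e \<Rightarrow> 'e)) set set" where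
  "base K = {fixing B K | B. finite B \<and> B \<subseteq> verts T}"

lemma local_action_inv_in:
  assumes "subgroup H (Sym \<Omega>)" "g \<in> carrier Aut" "x \<in> verts T" "\<sigma> g x \<in> H"
  shows "\<sigma> (inv\<^bsub>Aut\<^esub> g) (fst g x) \<in> H"
  using assms subgroup_SymD(4)[OF assms(1)] by (simp add: local_action_inv_eq)

lemma subgroup_U:
  assumes H: "subgroup H (Sym \<Omega>)"
  shows "subgroup (U H) Aut"
proof (rule Aut.subgroupI)
  show "U H \<subseteq> carrier Aut" by (auto simp: U_set_def)
  have "\<one>\<^bsub>Aut\<^esub> \<in> U H" by (simp add: U_set_def local_action_one subgroup_SymD(2)[OF H])
  then show "U H \<noteq> {}" by blast
next
  fix g assume g: "g \<in> U H"
  have "\<sigma> (inv\<^bsub>Aut\<^esub> g) x \<in> H" if "x \<in> verts T" for x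
    using g that local_action_inv_in[OF H, of g "fst (inv\<^bsub>Aut\<^esub> g) x"]
    by (simp add: U_set_def fst_inv' fst_in)
  then show "inv\<^bsub>Aut\<^esub> g \<in> U H" using g by (simp add: U_set_def)
next
  fix g h assume "g \<in> U H" "h \<in> U H"
  then show "g \<otimes>\<^bsub>Aut\<^esub> h \<in> U H"
    using subgroup_SymD(3)[OF H] by (simp add: U_set_def local_action_mult fst_in)
qed

lemma subgroup_G:
  assumes H: "subgroup H (Sym \<Omega>)"
  shows "subgroup (Gs H) Aut"
proof (rule Aut.subgroupI)
  show "Gs H \<subseteq> carrier Aut" by (auto simp: G_set_def)
  have "{x \<in> verts T. \<sigma> \<one>\<^bsub>Aut\<^esub> x \<notin> H} = {}" by (auto simp: local_action_one subgroup_SymD(2)[OF H])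
  then have "finite {x \<in> verts T. \<sigma> \<one>\<^bsub>Aut\<^esub> x \<notin> H}" by (rule ssubst) simp
  then have "\<one>\<^bsub>Aut\<^esub> \<in> Gs H" by (simp add: G_set_def)
  then show "Gs H \<noteq> {}" by blast
next
  fix g assume g: "g \<in> Gs H"
  then have gA: "g \<in> carrier Aut" and fin: "finite {x \<in> verts T. \<sigma> g x \<notin> H}" by (auto simp: G_set_def)
  have "{x \<in> verts T. \<sigma> (inv\<^bsub>Aut\<^esub> g) x \<notin> H} \<subseteq> fst g ` {x \<in> verts T. \<sigma> g x \<notin> H}"
  proof
    fix x assume x: "x \<in> {x \<in> verts T. \<sigma> (inv\<^bsub>Aut\<^esub> g) x \<notin> H}"
    then have "fst (inv\<^bsub>Aut\<^esub> g) x \<in> {x \<in> verts T. \<sigma> g x \<notin> H}"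
      using local_action_inv_in[OF H gA, of "fst (inv\<^bsub>Aut\<^esub> g) x"] gA by (auto simp: fst_inv' fst_in)
    then show "x \<in> fst g ` {x \<in> verts T. \<sigma> g x \<notin> H}"
      by (rule image_eqI[where f = "fst g", OF fst_inv'[OF gA, of x, symmetric]])
  qed
  then have "finite {x \<in> verts T. \<sigma> (inv\<^bsub>Aut\<^esub> g) x \<notin> H}"
    by (rule finite_surj[OF fin])
  then show "inv\<^bsub>Aut\<^esub> g \<in> Gs H"
    using gA by (simp add: G_set_def)
next
  fix g h assume "g \<in> Gs H" "h \<in> Gs H"
  then have gh: "g \<in> carrier Aut" "h \<in> carrier Aut"
    and fin: "finite {x \<in> verts T. \<sigma> g x \<notin> H}" "finite {x \<in> verts T. \<sigma> h x \<notin> H}"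
    by (auto simp: G_set_def)
  have "{x \<in> verts T. \<sigma> (g \<otimes>\<^bsub>Aut\<^esub> h) x \<notin> H} \<subseteq>
      {x \<in> verts T. \<sigma> h x \<notin> H} \<union> fst (inv\<^bsub>Aut\<^esub> h) ` {x \<in> verts T. \<sigma> g x \<notin> H}"
  proof
    fix x assume "x \<in> {x \<in> verts T. \<sigma> (g \<otimes>\<^bsub>Aut\<^esub> h) x \<notin> H}"
    then have x: "x \<in> verts T" "\<sigma> g (fst h x) \<circ> \<sigma> h x \<notin> H"
      using gh by (auto simp: local_action_mult)
    then consider "\<sigma> h x \<notin> H" | "\<sigma> g (fst h x) \<notin> H" using subgroup_SymD(3)[OF H] by blast
    then show "x \<in> {x \<in> verts T. \<sigma> h x \<notin> H} \<union> fst (inv\<^bsub>Aut\<^esub> h) ` {x \<in> verts T. \<sigma> g x \<notin> H}"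
    proof cases
      case 2
      then have "x \<in> fst (inv\<^bsub>Aut\<^esub> h) ` {x \<in> verts T. \<sigma> g x \<notin> H}"
        using x gh by (intro image_eqI[of _ _ "fst h x"]) (auto simp: fst_inv fst_in)
      then show ?thesis by blast
    qed (use x in blast)
  qed
  then show "g \<otimes>\<^bsub>Aut\<^esub> h \<in> Gs H"
    using fin gh by (simp add: G_set_def finite_subset)
qed

lemma U_subset_G: "U H \<subseteq> Gs H"
proof
  fix g assume g: "g \<in> U H"
  then have "{x \<in> verts T. \<sigma> g x \<notin> H} = {}" by (auto simp: U_set_def)
  then show "g \<in> Gs H" using g unfolding G_set_def U_set_def by (metis (no_types, lifting) finite.emptyI mem_Collect_eq)
qed

lemma U_mono: "H \<subseteq> H' \<Longrightarrow> U H \<subseteq> U H'"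
  by (auto simp: U_set_def)

lemma G_mono: "H \<subseteq> H' \<Longrightarrow> Gs H \<subseteq> Gs H'"
  unfolding G_set_def by (auto elim!: rev_finite_subset)

lemma fixing_subset: "fixing B K \<subseteq> K"
  by (auto simp: fixing_def)

lemma fixing_fixing: "fixing B (fixing C K) = fixing (B \<union> C) K"
  by (auto simp: fixing_def)

lemma subgroup_fixing:
  assumes "subgroup K Aut" shows "subgroup (fixing B K) Aut"
proof (rule Aut.subgroupI)
  show "fixing B K \<subseteq> carrier Aut" using subgroup.subset[OF assms] by (auto simp: fixing_def)
  have "\<one>\<^bsub>Aut\<^esub> \<in> fixing B K" using subgroup.one_closed[OF assms] by (simp add: fixing_def fst_one)
  then show "fixing B K \<noteq> {}" by blast
next
  fix g assume g: "g \<in> fixing B K"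
  then have gK: "g \<in> K" by (simp add: fixing_def)
  have "fst (inv\<^bsub>Aut\<^esub> g) x = x" if "x \<in> B" for x
    using fst_inv[OF subgroup.mem_carrier[OF assms gK], of x] g that by (simp add: fixing_def)
  then show "inv\<^bsub>Aut\<^esub> g \<in> fixing B K"
    using subgroup.m_inv_closed[OF assms gK] by (simp add: fixing_def)
next
  fix g h assume "g \<in> fixing B K" "h \<in> fixing B K"
  then show "g \<otimes>\<^bsub>Aut\<^esub> h \<in> fixing B K"
    using subgroup.m_closed[OF assms] by (simp add: fixing_def fst_mult)
qed

lemma group_sub: "subgroup K Aut \<Longrightarrow> group (sub K)"
  using Aut.subgroup_imp_group .

lemma subgroup_sub: "subgroup K Aut \<Longrightarrow> subgroup L Aut \<Longrightarrow> K \<subseteq> L \<Longrightarrow> subgroup K (sub L)"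
  by (simp add: Aut.subgroup_incl)

lemma baseI: "finite B \<Longrightarrow> B \<subseteq> verts T \<Longrightarrow> fixing B K \<in> base K"
  by (auto simp: base_def)

lemma baseE:
  assumes "N \<in> base K" obtains B where "finite B" "B \<subseteq> verts T" "N = fixing B K"
  using assms by (auto simp: base_def)

lemma subgroup_base_base:
  assumes K: "subgroup K Aut" and L: "subgroup L Aut" and KL: "K \<subseteq> L"
  shows "subgroup_base (sub L) (base K)"
proof (intro subgroup_base.intro subgroup_base_axioms.intro group_sub[OF L])
  show "base K \<noteq> {}" using baseI[of "{}" K] by blast
next
  fix N assume "N \<in> base K"
  then show "subgroup N (sub L)"
    using subgroup_sub[OF subgroup_fixing[OF K] L] fixing_subset KL by (elim baseE) blast
next
  fix M N assume "M \<in> base K" "N \<in> base K"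
  then obtain B C where "finite B" "B \<subseteq> verts T" "M = fixing B K" "finite C" "C \<subseteq> verts T" "N = fixing C K"
    by (elim baseE) blast
  then show "\<exists>L \<in> base K. L \<subseteq> M \<inter> N"
    by (intro bexI[of _ "fixing (B \<union> C) K"] baseI) (auto simp: fixing_def)
qed

lemma base_Int: "L \<subseteq> K \<Longrightarrow> (\<inter>) L ` base K = base L"
proof -
  assume L: "L \<subseteq> K"
  have "L \<inter> fixing B K = fixing B L" for B using L by (auto simp: fixing_def)
  then show ?thesis unfolding base_def setcompr_eq_image image_image by simp
qed

lemma base_Int_supset: "K \<subseteq> L \<Longrightarrow> (\<inter>) L ` base K = base K"
proof -
  assume L: "K \<subseteq> L"
  have "L \<inter> fixing B K = fixing B K" for B using L by (auto simp: fixing_def)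
  then show ?thesis unfolding base_def setcompr_eq_image image_image by simp
qed

lemma fst_conj_fixes:
  assumes "g \<in> carrier Aut" "fst k (fst (inv\<^bsub>Aut\<^esub> g) x) = fst (inv\<^bsub>Aut\<^esub> g) x"
  shows "fst (g \<otimes>\<^bsub>Aut\<^esub> k \<otimes>\<^bsub>Aut\<^esub> inv\<^bsub>Aut\<^esub> g) x = x"
  using assms by (simp add: fst_mult fst_inv')

lemma base_conj_self:
  assumes K: "subgroup K Aut" and g: "g \<in> K" and N: "N \<in> base K"
  shows "\<exists>M \<in> base K. \<forall>k \<in> M. g \<otimes>\<^bsub>Aut\<^esub> k \<otimes>\<^bsub>Aut\<^esub> inv\<^bsub>Aut\<^esub> g \<in> N"
proof -
  obtain B where B: "finite B" "B \<subseteq> verts T" "N = fixing B K" using N by (rule baseE)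
  let ?C = "fst (inv\<^bsub>Aut\<^esub> g) ` B"
  have gA: "g \<in> carrier Aut" using subgroup.mem_carrier[OF K g] .
  have "g \<otimes>\<^bsub>Aut\<^esub> k \<otimes>\<^bsub>Aut\<^esub> inv\<^bsub>Aut\<^esub> g \<in> N" if k: "k \<in> fixing ?C K" for k
  proof -
    have "g \<otimes>\<^bsub>Aut\<^esub> k \<otimes>\<^bsub>Aut\<^esub> inv\<^bsub>Aut\<^esub> g \<in> K"
      using k g subgroup.m_closed[OF K] subgroup.m_inv_closed[OF K] by (simp add: fixing_def)
    then show ?thesis using k gA B by (simp add: fixing_def fst_conj_fixes)
  qed
  moreover have "fixing ?C K \<in> base K"
    using B gA fst_in[of "inv\<^bsub>Aut\<^esub> g"] by (intro baseI) auto
  ultimately show ?thesis by blast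
qed

lemma openin_generator:
  assumes "x \<in> verts T"
  shows "openin (aut_topology T arev) {g \<in> carrier Aut. fst g x = y}"
proof (cases "y \<in> verts T")
  case True
  then show ?thesis
    using assms unfolding aut_topology_def by (intro topology_generated_by_Basis) auto
next
  case False
  then have "{g \<in> carrier Aut. fst g x = y} = {}" using assms fst_in by auto
  then show ?thesis by (metis openin_empty)
qed

lemma topspace_aut_topology: "topspace (aut_topology T arev) = carrier Aut"
  unfolding aut_topology_def topology_generated_by_topspace using b_in fst_in by blast

lemma subgroup_base_Aut: "subgroup_base Aut (base (carrier Aut))"
  using subgroup_base_base[OF Aut.subgroup_self Aut.subgroup_self order_refl] by simp

lemma aut_topology_eq: "aut_topology T arev = coset_topology Aut (base (carrier Aut))"
proof -
  interpret B: subgroup_base Aut "base (carrier Aut)" by (rule subgroup_base_Aut)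
  have "openin (coset_topology Aut (base (carrier Aut))) W" if "openin (aut_topology T arev) W" for W
  proof -
    have "generate_topology_on {{g \<in> carrier Aut. fst g x = y} | x y. x \<in> verts T \<and> y \<in> verts T} W"
      using that unfolding aut_topology_def by (rule openin_topology_generated_by)
    then show ?thesis
    proof induction
      case (Basis S)
      then obtain x y where S: "S = {g \<in> carrier Aut. fst g x = y}" "x \<in> verts T" by auto
      have "\<forall>k \<in> fixing {x} (carrier Aut). g \<otimes>\<^bsub>Aut\<^esub> k \<in> S" if "g \<in> S" for g
        using that S(1) by (simp add: fixing_def fst_mult)
      moreover have "fixing {x} (carrier Aut) \<in> base (carrier Aut)" using S by (intro baseI) auto
      ultimately show ?case using S(1) by (intro B.openin_coset_topologyI) auto
    qed auto
  qed
  moreover have "openin (aut_topology T arev) W" if W: "openin (coset_topology Aut (base (carrier Aut))) W" for W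
  proof (subst openin_subopen, intro ballI)
    fix g assume g: "g \<in> W"
    have WA: "W \<subseteq> carrier Aut" using openin_subset[OF W] by simp
    obtain N where N: "N \<in> base (carrier Aut)" "\<And>k. k \<in> N \<Longrightarrow> g \<otimes>\<^bsub>Aut\<^esub> k \<in> W"
      using B.openin_coset_topologyE[OF W g] by metis
    obtain B where B: "finite B" "B \<subseteq> verts T" "N = fixing B (carrier Aut)" using N(1) by (rule baseE)
    \<comment> \<open>The factor \<open>topspace\<close> covers empty \<open>B\<close>, where the
      intersection alone would be everything.\<close>
    let ?S = "(\<Inter>x\<in>B. {h \<in> carrier Aut. fst h x = fst g x}) \<inter> topspace (aut_topology T arev)"
    have gA: "g \<in> carrier Aut" using g WA by blast
    have "openin (aut_topology T arev) ?S"
      using B openin_generator by (intro openin_INT) auto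
    moreover have "g \<in> ?S" using gA by (simp add: topspace_aut_topology)
    moreover have "?S \<subseteq> W"
    proof
      fix h assume h: "h \<in> ?S"
      then have hA: "h \<in> carrier Aut" by (simp add: topspace_aut_topology)
      have "inv\<^bsub>Aut\<^esub> g \<otimes>\<^bsub>Aut\<^esub> h \<in> N"
        using h hA gA by (simp add: B(3) fixing_def fst_mult fst_inv)
      from N(2)[OF this] show "h \<in> W" using gA hA by (simp add: Aut.m_assoc[symmetric])
    qed
    ultimately show "\<exists>S. openin (aut_topology T arev) S \<and> g \<in> S \<and> S \<subseteq> W" by blast
  qed
  ultimately show ?thesis by (auto simp: topology_eq)
qed

lemma subtopology_aut_topology:
  assumes "subgroup K Aut"
  shows "subtopology (aut_topology T arev) K = coset_topology (sub K) (base K)"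
proof -
  interpret B: subgroup_base Aut "base (carrier Aut)" by (rule subgroup_base_Aut)
  show ?thesis
    using B.subtopology_coset_topology[OF assms] base_Int[OF subgroup.subset[OF assms]]
    by (simp add: aut_topology_eq)
qed

lemma subtopology_coset_base:
  assumes K: "subgroup K Aut" and L: "subgroup L Aut" and KL: "K \<subseteq> L" and M: "subgroup M Aut" and MsubL: "M \<subseteq> L"
  shows "subtopology (coset_topology (sub L) (base K)) M = coset_topology (sub M) ((\<inter>) M ` base K)"
proof -
  interpret B: subgroup_base "sub L" "base K" by (rule subgroup_base_base[OF K L KL])
  show ?thesis using B.subtopology_coset_topology[OF subgroup_sub[OF M L MsubL]] by simp
qed

lemma topological_group_self:
  assumes K: "subgroup K Aut"
  shows "topological_group (sub K, coset_topology (sub K) (base K))"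
proof -
  interpret B: subgroup_base "sub K" "base K" by (rule subgroup_base_base[OF K K order_refl])
  show ?thesis
    using base_conj_self[OF K] Aut.m_inv_consistent[OF K]
    by (intro B.topological_group_coset_topology) simp
qed

lemma extension_topology_base:
  assumes K: "subgroup K Aut" and L: "subgroup L Aut" and KL: "K \<subseteq> L"
    and conj: "\<And>g N. g \<in> L \<Longrightarrow> N \<in> base K \<Longrightarrow> \<exists>M \<in> base K. \<forall>k \<in> M. g \<otimes>\<^bsub>Aut\<^esub> k \<otimes>\<^bsub>Aut\<^esub> inv\<^bsub>Aut\<^esub> g \<in> N"
  shows "extension_topology (sub L) (coset_topology (sub K) (base K)) = coset_topology (sub L) (base K)"
proof -
  interpret B: subgroup_base "sub L" "base K" by (rule subgroup_base_base[OF K L KL])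
  have "extension_topology (sub L) (coset_topology ((sub L)\<lparr>carrier := K\<rparr>) (base K)) = coset_topology (sub L) (base K)"
  proof (rule B.extension_topology_coset_topology[OF subgroup_sub[OF K L KL]])
    fix N assume "N \<in> base K"
    then show "N \<subseteq> K" by (rule baseE) (simp add: fixing_subset)
  next
    fix g N assume "g \<in> carrier (sub L)" "N \<in> base K"
    then show "\<exists>M\<in>base K. \<forall>k\<in>M. g \<otimes>\<^bsub>sub L\<^esub> k \<otimes>\<^bsub>sub L\<^esub> inv\<^bsub>sub L\<^esub> g \<in> N"
      using conj Aut.m_inv_consistent[OF L] by simp
  qed
  then show ?thesis by simp
qed

lemma local_action_fixing:
  assumes "k \<in> carrier Aut" "x \<in> verts T" "fst k x = x" "\<And>\<omega>. \<omega> \<in> \<Omega> \<Longrightarrow> fst k (nb x \<omega>) = nb x \<omega>"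
  shows "\<sigma> k x = id"
  using local_action_determined[of k "\<one>\<^bsub>Aut\<^esub>" x] assms by (simp add: fst_one local_action_one)

text \<open>If \<open>k\<close> fixes \<open>x\<close>, the right-hand side is the conjugate of
  \<open>\<sigma> k x\<close> by \<open>\<sigma> g x\<close>. In this way conjugation of
  automorphisms becomes conjugation of permutations, and commensuration of \<open>S\<close> becomes
  a normalizer condition.\<close>

lemma local_action_conj:
  assumes "g \<in> carrier Aut" "k \<in> carrier Aut" "x \<in> verts T"
  shows "\<sigma> (g \<otimes>\<^bsub>Aut\<^esub> k \<otimes>\<^bsub>Aut\<^esub> inv\<^bsub>Aut\<^esub> g) (fst g x) = \<sigma> g (fst k x) \<circ> \<sigma> k x \<circ> inv_into UNIV (\<sigma> g x)"
  using assms by (simp add: local_action_mult fst_in fst_inv local_action_inv_eq)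

end

section \<open>The topologies of \<open>G(F)\<close> and \<open>G(F,F')\<close>\<close>

locale finite_colored_tree = rooted_colored_tree T arev \<Omega> l b
  for T :: "('v, 'e) pre_digraph" and arev and \<Omega> :: "'c set" and l and b :: 'v +
  assumes finite_colors: "finite \<Omega>"
begin

text \<open>Away from the finite set \<open>X\<close> of singular vertices of \<open>g\<close>, all
  three factors of the conjugated local action lie in \<open>H\<close>. At \<open>X\<close> the
  middle factor must be trivial, so that the outer two cancel; fixing \<open>X\<close> together with
  its neighbours achieves this.\<close>

lemma G_conj:
  assumes H: "subgroup H (Sym \<Omega>)" and g: "g \<in> Gs H" and N: "N \<in> base (U H)"
  shows "\<exists>M \<in> base (U H). \<forall>k \<in> M. g \<otimes>\<^bsub>Aut\<^esub> k \<otimes>\<^bsub>Aut\<^esub> inv\<^bsub>Aut\<^esub> g \<in> N"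
proof -
  obtain B where B: "finite B" "B \<subseteq> verts T" "N = fixing B (U H)" using N by (rule baseE)
  have gA: "g \<in> carrier Aut" and fin: "finite {x \<in> verts T. \<sigma> g x \<notin> H}"
    using g by (auto simp: G_set_def)
  define X where "X = {x \<in> verts T. \<sigma> g x \<notin> H}"
  \<comment> \<open>The last part makes the conjugate fix \<open>B\<close>. The neighbours of
    \<open>X\<close> form a finite set because there are finitely many colours.\<close>
  define C where "C = X \<union> (\<Union>x\<in>X. nb x ` \<Omega>) \<union> fst (inv\<^bsub>Aut\<^esub> g) ` B"
  have XV: "X \<subseteq> verts T" by (auto simp: X_def)
  have C: "finite C" "C \<subseteq> verts T"
    using fin B finite_colors nb_in fst_in[of "inv\<^bsub>Aut\<^esub> g"] gA by (auto simp: C_def X_def)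
  have "g \<otimes>\<^bsub>Aut\<^esub> k \<otimes>\<^bsub>Aut\<^esub> inv\<^bsub>Aut\<^esub> g \<in> N" if k: "k \<in> fixing C (U H)" for k
  proof -
    let ?h = "g \<otimes>\<^bsub>Aut\<^esub> k \<otimes>\<^bsub>Aut\<^esub> inv\<^bsub>Aut\<^esub> g"
    have kA: "k \<in> carrier Aut" and kH: "\<And>x. x \<in> verts T \<Longrightarrow> \<sigma> k x \<in> H" and kC: "\<And>x. x \<in> C \<Longrightarrow> fst k x = x"
      using k by (auto simp: fixing_def U_set_def)
    have hx: "\<sigma> ?h (fst g x) \<in> H" if x: "x \<in> verts T" for x
    proof (cases "x \<in> X")
      case True
      then have kx: "fst k x = x" using kC by (simp add: C_def)
      have "\<sigma> k x = id"
        using True by (intro local_action_fixing kA x kx kC) (auto simp: C_def)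
      moreover have "\<sigma> g x \<circ> inv_into UNIV (\<sigma> g x) = id"
        using local_action_permutes[OF gA x] by (rule permutes_inv_o)
      ultimately have "\<sigma> ?h (fst g x) = id"
        by (simp add: local_action_conj gA kA x kx)
      then show ?thesis using subgroup_SymD(2)[OF H] by simp
    next
      case False
      \<comment> \<open>The left factor is taken at \<open>fst k x\<close>, which must be regular
        too: \<open>k\<close> fixes \<open>X\<close> pointwise and is injective, so it moves no
        other vertex into \<open>X\<close>.\<close>
      have "fst k x \<notin> X"
      proof
        assume "fst k x \<in> X"
        then have "fst k (fst k x) = fst k x" using kC by (simp add: C_def)
        then have "fst k x = x" using fst_inv[OF kA] by metis
        with \<open>fst k x \<in> X\<close> False show False by simp
      qed
      then have "\<sigma> g (fst k x) \<in> H" "\<sigma> g x \<in> H"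
        using False x kA by (auto simp: X_def fst_in)
      then show ?thesis
        using subgroup_SymD(3,4)[OF H] kH[OF x] by (simp add: local_action_conj gA kA x)
    qed
    have "\<sigma> ?h y \<in> H" if "y \<in> verts T" for y
      using hx[of "fst (inv\<^bsub>Aut\<^esub> g) y"] that gA by (simp add: fst_inv' fst_in)
    moreover have "fst ?h x = x" if "x \<in> B" for x
      using that kC by (intro fst_conj_fixes gA) (simp add: C_def)
    ultimately show ?thesis
      using gA kA by (simp add: B(3) fixing_def U_set_def)
  qed
  then show ?thesis using baseI[OF C] by blast
qed

lemma G_group_eq:
  assumes H: "subgroup H (Sym \<Omega>)"
  shows "G_group T arev \<Omega> l H = (sub (Gs H), coset_topology (sub (Gs H)) (base (U H)))"
  using extension_topology_base[OF subgroup_U[OF H] subgroup_G[OF H] U_subset_G] G_conj[OF H]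
  by (simp add: G_group_def U_group_def Let_def subtopology_aut_topology[OF subgroup_U[OF H]])

lemma GG_group_eq:
  assumes H: "subgroup H (Sym \<Omega>)" and H': "subgroup H' (Sym \<Omega>)" and HH: "H \<subseteq> H'"
  shows "GG_group T arev \<Omega> l H H' = (sub (Gs H \<inter> U H'), coset_topology (sub (Gs H \<inter> U H')) (base (U H)))"
proof -
  have "subgroup (Gs H \<inter> U H') Aut"
    using subgroup_U[OF H'] subgroup_G[OF H] by (rule Aut.subgroups_Inter_pair[rotated])
  from subtopology_coset_base[OF subgroup_U[OF H] subgroup_G[OF H] U_subset_G this]
  show ?thesis
    using base_Int_supset[of "U H" "Gs H \<inter> U H'"] U_subset_G[of H] U_mono[OF HH]
    by (simp add: GG_group_def G_group_eq[OF H])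
qed

section \<open>Compactness of vertex stabilizers\<close>

text \<open>
  The stabilizer is a continuous image of the closed set of consistent families in the product
  of copies of \<open>H\<close> indexed by the vertices.
\<close>

lemma compactin_stabilizer:
  assumes H: "subgroup H (Sym \<Omega>)"
  shows "compactin (aut_topology T arev) (fixing {b} (U H))"
proof -
  have finH: "finite H"
    using finite_permutations[OF finite_colors] subgroup_SymD(1)[OF H] by (auto elim!: rev_finite_subset)
  define X where "X = product_topology (\<lambda>_. discrete_topology H) (verts T)"
  have X: "topspace X = (verts T \<rightarrow>\<^sub>E H)" by (simp add: X_def)
  have cX: "compact_space X"
    unfolding X_def compact_space_product_topology using finH by (simp add: compact_space_discrete_topology)
  define C where "C = {\<tau> \<in> topspace X. \<forall>x \<in> verts T. \<forall>\<omega> \<in> \<Omega>. \<tau> (nb x \<omega>) \<omega> = \<tau> x \<omega>}"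
  have op1: "openin X {\<tau> \<in> topspace X. P (\<tau> x)}" if "x \<in> verts T" for x P
  proof -
    have "continuous_map X (discrete_topology H) (\<lambda>\<tau>. \<tau> x)"
      unfolding X_def using that by (rule continuous_map_product_projection)
    then have "openin X {\<tau> \<in> topspace X. \<tau> x \<in> {\<pi> \<in> H. P \<pi>}}"
      by (rule openin_continuous_map_preimage) simp
    moreover have "{\<tau> \<in> topspace X. \<tau> x \<in> {\<pi> \<in> H. P \<pi>}} = {\<tau> \<in> topspace X. P (\<tau> x)}"
      using that by (auto simp: X)
    ultimately show ?thesis by simp
  qed
  have "openin X {\<tau> \<in> topspace X. \<tau> (nb x \<omega>) \<omega> \<noteq> \<tau> x \<omega>}" if x: "x \<in> verts T" "\<omega> \<in> \<Omega>" for x \<omega>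
  proof -
    \<comment> \<open>Splitting by the common value \<alpha> leaves conditions on single
      coordinates, each open because the factors are discrete.\<close>
    have "{\<tau> \<in> topspace X. \<tau> (nb x \<omega>) \<omega> \<noteq> \<tau> x \<omega>} =
       (\<Union>\<alpha>. {\<tau> \<in> topspace X. \<tau> (nb x \<omega>) \<omega> = \<alpha>} \<inter> {\<tau> \<in> topspace X. \<tau> x \<omega> \<noteq> \<alpha>})" by auto
    also have "openin X \<dots>"
      using x op1[of "nb x \<omega>" "\<lambda>\<pi>. \<pi> \<omega> = _"] op1[of x "\<lambda>\<pi>. \<pi> \<omega> \<noteq> _"]
      by (intro openin_Union) (auto simp: nb_in intro!: openin_Int)
    finally show ?thesis .
  qed
  then have "openin X (\<Union>x\<in>verts T. \<Union>\<omega>\<in>\<Omega>. {\<tau> \<in> topspace X. \<tau> (nb x \<omega>) \<omega> \<noteq> \<tau> x \<omega>})"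
    by (intro openin_Union) auto
  then have "closedin X (topspace X - (\<Union>x\<in>verts T. \<Union>\<omega>\<in>\<Omega>. {\<tau> \<in> topspace X. \<tau> (nb x \<omega>) \<omega> \<noteq> \<tau> x \<omega>}))"
    by blast
  also have "topspace X - (\<Union>x\<in>verts T. \<Union>\<omega>\<in>\<Omega>. {\<tau> \<in> topspace X. \<tau> (nb x \<omega>) \<omega> \<noteq> \<tau> x \<omega>}) = C"
    unfolding C_def by blast
  finally have cC: "compactin X C" using cX closedin_compact_space by blast
  have CX: "C \<subseteq> topspace X" by (auto simp: C_def)
  have consC: "consistent \<tau>" if "\<tau> \<in> C" for \<tau>
    using that subgroup_SymD(1)[OF H] unfolding C_def consistent_def X by (auto dest!: PiE_mem)
  define \<Phi> where "\<Phi> \<tau> = (SOME g. g \<in> carrier Aut \<and> fst g b = b \<and> (\<forall>x \<in> verts T. \<sigma> g x = \<tau> x))" for \<tau>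
  have \<Phi>: "\<Phi> \<tau> \<in> carrier Aut \<and> fst (\<Phi> \<tau>) b = b \<and> (\<forall>x \<in> verts T. \<sigma> (\<Phi> \<tau>) x = \<tau> x)" if \<tau>: "\<tau> \<in> C" for \<tau>
  proof -
    obtain g where g: "g \<in> carrier Aut" "fst g b = b" "\<And>x. x \<in> verts T \<Longrightarrow> \<sigma> g x = \<tau> x"
      using ex_automorphism[OF consC[OF \<tau>] b_in] by blast
    show ?thesis unfolding \<Phi>_def by (rule someI[of _ g]) (simp add: g)
  qed
  have op: "openin (subtopology X C) {\<tau> \<in> C. P (\<tau> x)}" if "x \<in> verts T" for x P
    unfolding openin_subtopology using op1[OF that, of P] CX by (intro exI[of _ "{\<tau> \<in> topspace X. P (\<tau> x)}"]) blast
  \<comment> \<open>Evaluation at \<open>x\<close> is locally constant in the family: the image of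
    \<open>x\<close> is determined by the image of its parent and by one coordinate, which is the
    inductive step.\<close>
  have ev: "openin (subtopology X C) {\<tau> \<in> C. fst (\<Phi> \<tau>) x = y}" if "x \<in> verts T" for x y
    using that
  proof (induction "word x" arbitrary: x y rule: rev_induct)
    case Nil
    then have "x = b" using depth_0_iff[of x] by simp
    then have eq: "{\<tau> \<in> C. fst (\<Phi> \<tau>) x = y} = (if b = y then C else {})" using \<Phi> by auto
    show ?case unfolding eq using CX by (simp add: openin_subtopology_refl)
  next
    case (snoc \<omega> u)
    note p = word_parent[OF snoc.prems snoc.hyps(2)[symmetric]]
    let ?x = "foldl nb b u"
    have "fst (\<Phi> \<tau>) x = nb (fst (\<Phi> \<tau>) ?x) (\<tau> ?x \<omega>)" if "\<tau> \<in> C" for \<tau>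
      using fst_nb[of "\<Phi> \<tau>" ?x \<omega>] \<Phi>[OF that] p by simp
    then have "{\<tau> \<in> C. fst (\<Phi> \<tau>) x = y} =
        (\<Union>\<alpha>. \<Union>z\<in>{z. nb z \<alpha> = y}. {\<tau> \<in> C. fst (\<Phi> \<tau>) ?x = z} \<inter> {\<tau> \<in> C. \<tau> ?x \<omega> = \<alpha>})"
      by auto
    also have "openin (subtopology X C) \<dots>"
      using snoc.hyps(1)[of ?x] p op[OF p(1), of "\<lambda>\<pi>. \<pi> \<omega> = _"]
      by (intro openin_Union) (auto intro!: openin_Int openin_Union)
    finally show ?case .
  qed
  have "continuous_map (subtopology X C) (aut_topology T arev) \<Phi>"
    unfolding aut_topology_def
  proof (rule continuous_on_generated_topo)
    fix W assume "W \<in> {{g \<in> carrier Aut. fst g x = y} |x y. x \<in> verts T \<and> y \<in> verts T}"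
    then obtain x y where W: "W = {g \<in> carrier Aut. fst g x = y}" "x \<in> verts T" by auto
    have "\<Phi> -` W \<inter> topspace (subtopology X C) = {\<tau> \<in> C. fst (\<Phi> \<tau>) x = y}"
      using CX \<Phi> by (auto simp: W(1))
    then show "openin (subtopology X C) (\<Phi> -` W \<inter> topspace (subtopology X C))"
      using ev[OF W(2)] by simp
  next
    show "\<Phi> ` topspace (subtopology X C) \<subseteq> \<Union> {{g \<in> carrier Aut. fst g x = y} |x y. x \<in> verts T \<and> y \<in> verts T}"
      using topspace_aut_topology[unfolded aut_topology_def topology_generated_by_topspace] \<Phi> by auto
  qed
  moreover have "compactin (subtopology X C) C"
    using cC by (simp add: compactin_subtopology)
  ultimately have "compactin (aut_topology T arev) (\<Phi> ` C)"
    using image_compactin by blast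
  moreover have "\<Phi> ` C = fixing {b} (U H)"
  proof (intro equalityI subsetI)
    fix g assume "g \<in> \<Phi> ` C"
    then obtain \<tau> where "\<tau> \<in> C" "g = \<Phi> \<tau>" by blast
    then show "g \<in> fixing {b} (U H)"
      using \<Phi>[of \<tau>] CX by (auto simp: fixing_def U_set_def X PiE_mem)
  next
    fix g assume "g \<in> fixing {b} (U H)"
    then have g: "g \<in> carrier Aut" "fst g b = b" "\<And>x. x \<in> verts T \<Longrightarrow> \<sigma> g x \<in> H"
      by (auto simp: fixing_def U_set_def)
    define \<tau> where "\<tau> = restrict (\<sigma> g) (verts T)"
    have \<tau>: "\<tau> \<in> C"
      using g local_action_nb[OF g(1)] by (auto simp: C_def X \<tau>_def nb_in)
    have "\<Phi> \<tau> = g"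
      using fst_agree[of "\<Phi> \<tau>" g] \<Phi>[OF \<tau>] g by (intro Aut_eqI) (auto simp: \<tau>_def)
    then show "g \<in> \<Phi> ` C" using \<tau> by blast
  qed
  ultimately show ?thesis by simp
qed

text \<open>The conditions \<open>fst g x = y\<close> define sets that are open together with their
  complements and that separate points, whence Hausdorffness and total disconnectedness.\<close>

lemma profinite_stabilizer:
  assumes H: "subgroup H (Sym \<Omega>)"
  shows "profinite (sub (fixing {b} (U H)), coset_topology (sub (fixing {b} (U H))) (base (fixing {b} (U H))))"
proof -
  let ?K = "fixing {b} (U H)"
  have K: "subgroup ?K Aut" by (rule subgroup_fixing[OF subgroup_U[OF H]])
  have KA: "?K \<subseteq> carrier Aut" using subgroup.subset[OF K] .
  have top: "coset_topology (sub ?K) (base ?K) = subtopology (aut_topology T arev) ?K"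
    using subtopology_aut_topology[OF K] by simp
  have op: "openin (coset_topology (sub ?K) (base ?K)) {g \<in> ?K. fst g x = y}" if "x \<in> verts T" for x y
  proof -
    have "{g \<in> ?K. fst g x = y} = {g \<in> carrier Aut. fst g x = y} \<inter> ?K" using KA by blast
    moreover have "openin (aut_topology T arev) {g \<in> carrier Aut. fst g x = y}"
      using that by (rule openin_generator)
    ultimately show ?thesis
      unfolding top openin_subtopology by blast
  qed
  have sep: "\<exists>x \<in> verts T. fst g x \<noteq> fst h x" if "g \<in> ?K" "h \<in> ?K" "g \<noteq> h" for g h
    using that Aut_eqI KA by blast
  have ts: "topspace (coset_topology (sub ?K) (base ?K)) = ?K"
    unfolding top using KA by (auto simp: topspace_aut_topology)
  have "compact_space (coset_topology (sub ?K) (base ?K))"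
    using compactin_stabilizer[OF H] by (simp add: top compact_space_subtopology)
  moreover have "Hausdorff_space (coset_topology (sub ?K) (base ?K))"
    unfolding Hausdorff_space_def ts
  proof (intro allI impI)
    fix g h assume gh: "g \<in> ?K \<and> h \<in> ?K \<and> g \<noteq> h"
    then obtain x where x: "x \<in> verts T" "fst g x \<noteq> fst h x" using sep by blast
    show "\<exists>V W. openin (coset_topology (sub ?K) (base ?K)) V \<and> openin (coset_topology (sub ?K) (base ?K)) W \<and>
        g \<in> V \<and> h \<in> W \<and> disjnt V W"
      using gh x op[OF x(1)]
      by (intro exI[of _ "{k \<in> ?K. fst k x = fst g x}"] exI[of _ "{k \<in> ?K. fst k x = fst h x}"])
        (auto simp: disjnt_def)
  qed
  moreover have "\<exists>g. C \<subseteq> {g}" if C: "connectedin (coset_topology (sub ?K) (base ?K)) C" for C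
  proof (rule ccontr)
    assume "\<not> (\<exists>g. C \<subseteq> {g})"
    then obtain g h where gh: "g \<in> C" "h \<in> C" "g \<noteq> h" by blast
    have CK: "C \<subseteq> ?K" using connectedin_subset_topspace[OF C] ts by simp
    then obtain x where x: "x \<in> verts T" "fst g x \<noteq> fst h x" using sep gh by blast
    have "openin (coset_topology (sub ?K) (base ?K)) (\<Union>y\<in>- {fst g x}. {k \<in> ?K. fst k x = y})"
      using op[OF x(1)] by (intro openin_Union) auto
    moreover have "C \<subseteq> {k \<in> ?K. fst k x = fst g x} \<union> (\<Union>y\<in>- {fst g x}. {k \<in> ?K. fst k x = y})"
      using CK by auto
    moreover have "{k \<in> ?K. fst k x = fst g x} \<inter> (\<Union>y\<in>- {fst g x}. {k \<in> ?K. fst k x = y}) \<inter> C = {}" by auto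
    moreover have "{k \<in> ?K. fst k x = fst g x} \<inter> C \<noteq> {}" using gh CK by auto
    moreover have "h \<in> (\<Union>y\<in>- {fst g x}. {k \<in> ?K. fst k x = y}) \<inter> C" using gh CK x by auto
    then have "(\<Union>y\<in>- {fst g x}. {k \<in> ?K. fst k x = y}) \<inter> C \<noteq> {}" by blast
    ultimately show False by (rule connectedinD[OF C op[OF x(1), of "fst g x"]])
  qed
  ultimately show ?thesis
    using topological_group_self[OF K] by simp
qed

end

section \<open>Permutation groups and their point stabilizers\<close>

lemma perm_stab_eq: "perm_stab \<Omega> H \<omega> = {\<pi> \<in> H. \<pi> \<omega> = \<omega>}"
  by (simp add: perm_stab_def stabilizer_def)

lemma perm_orbits_eq: "perm_orbits \<Omega> H = (\<lambda>\<omega>. (\<lambda>\<pi>. \<pi> \<omega>) ` H) ` \<Omega>"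
  by (auto simp: perm_orbits_def orbits_def orbit_def)

lemma subgroup_perm_stab:
  assumes H: "subgroup H (Sym A)" shows "subgroup (perm_stab \<Omega> H \<omega>) (Sym A)"
proof (rule group.subgroupI[OF group_Sym])
  show "perm_stab \<Omega> H \<omega> \<subseteq> carrier (Sym A)"
    using subgroup.subset[OF H] by (auto simp: perm_stab_eq)
  have "id \<in> perm_stab \<Omega> H \<omega>" using subgroup_SymD(2)[OF H] by (simp add: perm_stab_eq)
  then show "perm_stab \<Omega> H \<omega> \<noteq> {}" by blast
next
  fix \<pi> assume \<pi>: "\<pi> \<in> perm_stab \<Omega> H \<omega>"
  then have "inv_into UNIV \<pi> \<omega> = \<omega>"
    using permutes_inv_eq[OF subgroup_SymD(1)[OF H], of \<pi> \<omega> \<omega>] by (simp add: perm_stab_eq)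
  then show "inv\<^bsub>Sym A\<^esub> \<pi> \<in> perm_stab \<Omega> H \<omega>"
    using \<pi> subgroup_SymD(1,4)[OF H] by (simp add: perm_stab_eq inv_Sym)
next
  fix \<pi> \<rho> assume "\<pi> \<in> perm_stab \<Omega> H \<omega>" "\<rho> \<in> perm_stab \<Omega> H \<omega>"
  then show "\<pi> \<otimes>\<^bsub>Sym A\<^esub> \<rho> \<in> perm_stab \<Omega> H \<omega>"
    using subgroup_SymD(3)[OF H] by (simp add: perm_stab_eq mult_Sym)
qed

lemma finite_subgroup_Sym: "finite A \<Longrightarrow> subgroup H (Sym A) \<Longrightarrow> finite H"
  using finite_permutations[of A] subgroup_SymD(1)[of H A] by (auto elim!: rev_finite_subset)

lemma pow_Sym: "\<pi> [^]\<^bsub>(Sym A)\<lparr>carrier := H\<rparr>\<^esub> (n::nat) = \<pi> ^^ n"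
  by (induction n) (simp_all add: nat_pow_def one_Sym mult_Sym funpow_swap1 fun_eq_iff)

lemma funpow_card_subgroup:
  assumes "finite A" "subgroup H (Sym A)" "\<pi> \<in> H"
  shows "\<pi> ^^ card H = id"
  using group.pow_order_eq_1[OF group.subgroup_imp_group[OF group_Sym assms(2)], of \<pi>] assms(3)
  by (simp add: pow_Sym order_def one_Sym)

lemma card_orbit_stab:
  assumes H: "subgroup H (Sym A)" and fin: "finite A"
  shows "card H = card ((\<lambda>\<pi>. \<pi> \<omega>) ` H) * card (perm_stab \<Omega> H \<omega>)"
proof -
  have finH: "finite H" by (rule finite_subgroup_Sym[OF fin H])
  have "card {\<pi> \<in> H. \<pi> \<omega> = \<alpha>} = card (perm_stab \<Omega> H \<omega>)" if \<alpha>: "\<alpha> \<in> (\<lambda>\<pi>. \<pi> \<omega>) ` H" for \<alpha>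
  proof -
    obtain \<rho> where \<rho>: "\<rho> \<in> H" "\<rho> \<omega> = \<alpha>" using \<alpha> by blast
    have \<rho>A: "\<rho> permutes A" using subgroup_SymD(1)[OF H \<rho>(1)] .
    have "bij_betw (\<lambda>\<pi>. \<rho> \<circ> \<pi>) (perm_stab \<Omega> H \<omega>) {\<pi> \<in> H. \<pi> \<omega> = \<alpha>}"
    proof (rule bij_betw_byWitness[where f' = "\<lambda>\<pi>. inv_into UNIV \<rho> \<circ> \<pi>"])
      show "\<forall>\<pi>\<in>perm_stab \<Omega> H \<omega>. inv_into UNIV \<rho> \<circ> (\<rho> \<circ> \<pi>) = \<pi>"
        using \<rho>A by (simp add: o_assoc permutes_inv_o)
      show "\<forall>\<pi>\<in>{\<pi> \<in> H. \<pi> \<omega> = \<alpha>}. \<rho> \<circ> (inv_into UNIV \<rho> \<circ> \<pi>) = \<pi>"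
        using \<rho>A by (simp add: o_assoc permutes_inv_o)
      show "(\<lambda>\<pi>. \<rho> \<circ> \<pi>) ` perm_stab \<Omega> H \<omega> \<subseteq> {\<pi> \<in> H. \<pi> \<omega> = \<alpha>}"
        using \<rho> subgroup_SymD(3)[OF H] by (auto simp: perm_stab_eq)
      show "(\<lambda>\<pi>. inv_into UNIV \<rho> \<circ> \<pi>) ` {\<pi> \<in> H. \<pi> \<omega> = \<alpha>} \<subseteq> perm_stab \<Omega> H \<omega>"
        using \<rho> \<rho>A subgroup_SymD(3,4)[OF H] by (auto simp: perm_stab_eq permutes_inv_eq)
    qed
    then show ?thesis by (rule bij_betw_same_card[THEN sym])
  qed
  then show ?thesis
    using sum.image_gen[OF finH, of "\<lambda>_. 1::nat" "\<lambda>\<pi>. \<pi> \<omega>"] by simp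
qed

text \<open>On a single colour an element of the hull behaves like an element of \<open>Fp\<close>,
  since it preserves the orbit of that colour and the two groups have the same orbits.\<close>

lemma same_orbit_witness:
  assumes F: "subgroup F (Sym \<Omega>)" and Fp: "subgroup Fp (Sym \<Omega>)"
    and orb: "perm_orbits \<Omega> F = perm_orbits \<Omega> Fp" and \<omega>: "\<omega> \<in> \<Omega>"
    and \<pi>: "\<pi> \<in> orbit_hull \<Omega> F"
  shows "\<exists>\<rho> \<in> Fp. \<pi> \<omega> = \<rho> \<omega>"
proof -
  let ?B = "(\<lambda>\<pi>. \<pi> \<omega>) ` F"
  have \<omega>B: "\<omega> \<in> ?B" using subgroup_SymD(2)[OF F] by (intro image_eqI[of _ _ id]) auto
  have B: "?B \<in> perm_orbits \<Omega> F" using \<omega> by (simp add: perm_orbits_eq)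
  then have "restrict_id \<pi> ?B permutes ?B"
    using \<pi> by (simp add: orbit_hull_def carrier_Sym)
  then have "restrict_id \<pi> ?B \<omega> \<in> ?B" using \<omega>B permutes_in_image by metis
  then have \<pi>B: "\<pi> \<omega> \<in> ?B" using \<omega>B by (simp add: restrict_id_def)
  \<comment> \<open>As a set \<open>?B\<close> is an orbit of \<open>Fp\<close>, but presented from
    a base point that need not be \<open>\<omega>\<close>; the witness is therefore a quotient of
    two elements.\<close>
  obtain \<alpha> where "\<alpha> \<in> \<Omega>" "?B = (\<lambda>\<pi>. \<pi> \<alpha>) ` Fp"
    using B[unfolded orb] unfolding perm_orbits_eq by (rule imageE)
  with \<omega>B \<pi>B obtain \<rho>1 \<rho>2 where \<rho>: "\<rho>1 \<in> Fp" "\<rho>2 \<in> Fp" "\<omega> = \<rho>1 \<alpha>" "\<pi> \<omega> = \<rho>2 \<alpha>" by auto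
  have "\<pi> \<omega> = (\<rho>2 \<circ> inv_into UNIV \<rho>1) \<omega>"
    using \<rho> permutes_inverses(2)[OF subgroup_SymD(1)[OF Fp \<rho>(1)]] by simp
  moreover have "\<rho>2 \<circ> inv_into UNIV \<rho>1 \<in> Fp"
    using subgroup_SymD(3,4)[OF Fp] \<rho> by simp
  ultimately show ?thesis by blast
qed

lemma orbit_eq_of_perm_orbits:
  assumes F: "subgroup F (Sym \<Omega>)" and Fp: "subgroup Fp (Sym \<Omega>)" and sub: "Fp \<subseteq> F"
    and orb: "perm_orbits \<Omega> F = perm_orbits \<Omega> Fp" and \<omega>: "\<omega> \<in> \<Omega>"
  shows "(\<lambda>\<pi>. \<pi> \<omega>) ` F = (\<lambda>\<pi>. \<pi> \<omega>) ` Fp"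
proof
  have "F \<subseteq> orbit_hull \<Omega> F"
  proof
    fix \<pi> assume \<pi>: "\<pi> \<in> F"
    have "restrict_id \<pi> B permutes B" if "B \<in> perm_orbits \<Omega> F" for B
    proof (rule bij_imp_permutes)
      obtain \<alpha> where B: "B = (\<lambda>\<pi>. \<pi> \<alpha>) ` F" using \<open>B \<in> perm_orbits \<Omega> F\<close> by (auto simp: perm_orbits_eq)
      have \<pi>p: "\<pi> permutes \<Omega>" using subgroup_SymD(1)[OF F \<pi>] .
      have inB: "\<rho> x \<in> B" if "\<rho> \<in> F" "x \<in> B" for \<rho> x
      proof -
        obtain \<rho>' where "\<rho>' \<in> F" "x = \<rho>' \<alpha>" using \<open>x \<in> B\<close> B by blast
        then show ?thesis
          unfolding B using subgroup_SymD(3)[OF F \<open>\<rho> \<in> F\<close>] by (intro image_eqI[of _ _ "\<rho> \<circ> \<rho>'"]) auto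
      qed
      show "bij_betw (restrict_id \<pi> B) B B"
      proof (rule bij_betw_byWitness[where f' = "inv_into UNIV \<pi>"])
        show "\<forall>a\<in>B. inv_into UNIV \<pi> (restrict_id \<pi> B a) = a"
          using \<pi>p by (simp add: restrict_id_def permutes_inverses)
        show "\<forall>a\<in>B. restrict_id \<pi> B (inv_into UNIV \<pi> a) = a"
          using \<pi>p inB subgroup_SymD(4)[OF F \<pi>] by (simp add: restrict_id_def permutes_inverses)
        show "restrict_id \<pi> B ` B \<subseteq> B" using inB \<pi> by (auto simp: restrict_id_def)
        show "inv_into UNIV \<pi> ` B \<subseteq> B" using inB subgroup_SymD(4)[OF F \<pi>] by auto
      qed
    qed (simp add: restrict_id_def)
    then show "\<pi> \<in> orbit_hull \<Omega> F"
      using subgroup_SymD(1)[OF F \<pi>] by (simp add: orbit_hull_def carrier_Sym)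
  qed
  then show "(\<lambda>\<pi>. \<pi> \<omega>) ` F \<subseteq> (\<lambda>\<pi>. \<pi> \<omega>) ` Fp"
    using same_orbit_witness[OF F Fp orb \<omega>] by blast
qed (use sub in blast)

text \<open>By orbit and stabilizer, \<open>card F\<close> and \<open>card Fp\<close> are the same
  orbit length \<open>?r\<close> times the orders of the stabilizers. As a divisor of
  \<open>card Fp\<close> this length is a power of p, so the p-parts of both stabilizers drop by the
  same factor and remain equal.\<close>

lemma sylow_perm_stab:
  assumes fin: "finite \<Omega>" and p: "prime p"
    and F: "subgroup F (Sym \<Omega>)" and Fp: "subgroup Fp (Sym \<Omega>)" and sub: "Fp \<subseteq> F"
    and syl: "sylow_subgroup p Fp ((Sym \<Omega>)\<lparr>carrier := F\<rparr>)"
    and orb: "perm_orbits \<Omega> F = perm_orbits \<Omega> Fp" and \<omega>: "\<omega> \<in> \<Omega>"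
  shows "sylow_subgroup p (perm_stab \<Omega> Fp \<omega>) ((Sym \<Omega>)\<lparr>carrier := perm_stab \<Omega> F \<omega>\<rparr>)"
proof -
  let ?r = "card ((\<lambda>\<pi>. \<pi> \<omega>) ` F)" and ?m = "multiplicity p (card F)"
  have cF: "card F = ?r * card (perm_stab \<Omega> F \<omega>)"
    by (rule card_orbit_stab[OF F fin])
  have cFp: "card Fp = ?r * card (perm_stab \<Omega> Fp \<omega>)"
    using card_orbit_stab[OF Fp fin, of \<omega> \<Omega>] orbit_eq_of_perm_orbits[OF F Fp sub orb \<omega>] by simp
  have Fpm: "card Fp = p ^ ?m"
    using syl by (simp add: sylow_subgroup_def order_def)
  have "card F > 0"
    using finite_subgroup_Sym[OF fin F] subgroup_SymD(2)[OF F] by (auto simp: card_gt_0_iff)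
  then have nz: "?r \<noteq> 0" "card (perm_stab \<Omega> F \<omega>) \<noteq> 0" using cF by (metis mult_is_0 neq0_conv)+
  obtain j where j: "?r = p ^ j"
    using cFp Fpm p by (metis divides_primepow_nat dvd_triv_left)
  obtain i where i: "card (perm_stab \<Omega> Fp \<omega>) = p ^ i"
    using cFp Fpm p by (metis divides_primepow_nat dvd_triv_right)
  have "p ^ ?m = p ^ (j + i)" using cFp Fpm i j by (simp add: power_add)
  then have "?m = j + i" using p prime_gt_1_nat power_inject_exp by blast
  moreover have "?m = multiplicity p ?r + multiplicity p (card (perm_stab \<Omega> F \<omega>))"
    using nz p by (subst cF, intro prime_elem_multiplicity_mult_distrib) auto
  moreover have "multiplicity p ?r = j" using j p by (simp add: multiplicity_same_power not_prime_unit)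
  ultimately have "i = multiplicity p (card (perm_stab \<Omega> F \<omega>))" by simp
  moreover have "subgroup (perm_stab \<Omega> Fp \<omega>) ((Sym \<Omega>)\<lparr>carrier := perm_stab \<Omega> F \<omega>\<rparr>)"
    using sub by (intro group.subgroup_incl[OF group_Sym] subgroup_perm_stab F Fp) (auto simp: perm_stab_eq)
  ultimately show ?thesis by (simp add: sylow_subgroup_def order_def i)
qed

text \<open>Commensuration yields only an inclusion of the conjugate of \<open>P\<close> in
  \<open>P\<close>. Conjugation is injective and \<open>P\<close> is finite, so the inclusion is an
  equality and \<open>\<beta>\<close> normalizes \<open>P\<close>.\<close>

lemma self_normalizing:
  assumes fin: "finite A" and M: "subgroup M (Sym A)" and P: "subgroup P (Sym A)" and PM: "P \<subseteq> M"
    and norm: "normalizer ((Sym A)\<lparr>carrier := M\<rparr>) P = P"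
    and \<beta>: "\<beta> \<in> M" and conj: "\<And>\<pi>. \<pi> \<in> P \<Longrightarrow> \<beta> \<circ> \<pi> \<circ> inv_into UNIV \<beta> \<in> P"
  shows "\<beta> \<in> P"
proof -
  have \<beta>A: "\<beta> permutes A" using subgroup_SymD(1)[OF M \<beta>] .
  let ?c = "\<lambda>\<pi>. \<beta> \<circ> \<pi> \<circ> inv_into UNIV \<beta>"
  have inv: "inv\<^bsub>(Sym A)\<lparr>carrier := M\<rparr>\<^esub> \<beta> = inv_into UNIV \<beta>"
    using group.m_inv_consistent[OF group_Sym M \<beta>] inv_Sym[OF \<beta>A] by simp
  have "inj_on ?c P"
  proof (rule inj_on_inverseI[where g = "\<lambda>\<pi>. inv_into UNIV \<beta> \<circ> \<pi> \<circ> \<beta>"])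
    show "inv_into UNIV \<beta> \<circ> ?c \<pi> \<circ> \<beta> = \<pi>" for \<pi>
      using \<beta>A by (simp add: fun_eq_iff permutes_inverses)
  qed
  then have "?c ` P = P"
    using conj finite_subgroup_Sym[OF fin P] by (intro endo_inj_surj) auto
  moreover have "\<beta> <#\<^bsub>(Sym A)\<lparr>carrier := M\<rparr>\<^esub> P #>\<^bsub>(Sym A)\<lparr>carrier := M\<rparr>\<^esub> inv_into UNIV \<beta> = ?c ` P"
    by (auto simp: l_coset_def r_coset_def mult_Sym)
  ultimately have "\<beta> \<in> normalizer ((Sym A)\<lparr>carrier := M\<rparr>) P"
    using \<beta> PM by (simp add: normalizer_def stabilizer_def inv)
  then show ?thesis using norm by simp
qed

section \<open>Cosets and p-power index\<close>

text \<open>Passes to the quotient group. Finiteness is a separate assumption because exponents of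
  elements do not bound the index, and an infinite index would have cardinality 0.\<close>

lemma (in group) card_rcosets_prime_power:
  assumes N: "N \<lhd> G" and fin: "finite (rcosets N)" and p: "prime p"
    and pow: "\<And>x. x \<in> carrier G \<Longrightarrow> \<exists>k. x [^] (p ^ k :: nat) \<in> N"
  shows "\<exists>n. card (rcosets N) = p ^ n"
proof -
  interpret N: normal N G by fact
  have Q: "group (G Mod N)" by (rule N.factorgroup_is_group)
  have c: "carrier (G Mod N) = rcosets N" by (simp add: FactGroup_def)
  have "\<exists>k. X [^]\<^bsub>G Mod N\<^esub> (p ^ k) = \<one>\<^bsub>G Mod N\<^esub>" if X: "X \<in> carrier (G Mod N)" for X
  proof -
    obtain x where x: "x \<in> carrier G" "X = N #> x" using X by (auto simp: carrier_FactGroup)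
    obtain k where k: "x [^] (p ^ k) \<in> N" using pow[OF x(1)] by blast
    have "X [^]\<^bsub>G Mod N\<^esub> (p ^ k) = N #> (x [^] (p ^ k))"
      using N.FactGroup_pow[OF x(1)] x(2) by simp
    also have "\<dots> = N" using N.rcos_const[OF is_group k] .
    finally show ?thesis by auto
  qed
  then have "\<exists>n. order (G Mod N) = p ^ n"
    using fin c by (intro group.order_prime_power[OF Q _ p]) auto
  then show ?thesis by (simp add: order_def c)
qed

lemma (in group) pow_card_rcosets:
  assumes N: "N \<lhd> G" and x: "x \<in> carrier G"
  shows "x [^] card (rcosets N) \<in> N"
proof -
  interpret N: normal N G by fact
  have Q: "group (G Mod N)" by (rule N.factorgroup_is_group)
  have c: "carrier (G Mod N) = rcosets N" by (simp add: FactGroup_def)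
  have "N #> x \<in> carrier (G Mod N)" using x by (auto simp: carrier_FactGroup)
  from group.pow_order_eq_1[OF Q this] have "N #> (x [^] card (rcosets N)) = N"
    using N.FactGroup_pow[OF x] by (simp add: order_def c)
  then show ?thesis
    using rcos_self[OF _ N.subgroup_axioms, of "x [^] card (rcosets N)"] x by auto
qed

lemma (in group) r_coset_mult_subgroup:
  assumes N: "subgroup N G" and t: "t \<in> N" and x: "x \<in> carrier G"
  shows "N #> (t \<otimes> x) = N #> x"
  using coset_mult_assoc[OF subgroup.subset[OF N] subgroup.mem_carrier[OF N t] x] subgroup.rcos_const[OF N is_group t]
  by simp

lemma finite_image_factor:
  assumes "finite (\<phi> ` S)" and "\<And>s s'. s \<in> S \<Longrightarrow> s' \<in> S \<Longrightarrow> \<phi> s = \<phi> s' \<Longrightarrow> f s = f s'"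
  shows "finite (f ` S)"
proof (rule finite_surj[OF assms(1)])
  show "f ` S \<subseteq> (\<lambda>y. f (SOME s. s \<in> S \<and> \<phi> s = y)) ` \<phi> ` S"
  proof
    fix z assume "z \<in> f ` S"
    then obtain s where s: "s \<in> S" "z = f s" by blast
    let ?s = "SOME s'. s' \<in> S \<and> \<phi> s' = \<phi> s"
    have "?s \<in> S \<and> \<phi> ?s = \<phi> s" by (rule someI[of _ s]) (simp add: s)
    then have "f ?s = z" using assms(2)[of ?s s] s by simp
    then show "z \<in> (\<lambda>y. f (SOME s. s \<in> S \<and> \<phi> s = y)) ` \<phi> ` S" using s by blast
  qed
qed

context finite_colored_tree
begin

section \<open>Powers and congruence subgroups\<close>

abbreviation ball_V :: "nat \<Rightarrow> 'v set" where
  "ball_V n \<equiv> {x \<in> verts T. depth x \<le> n}"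

abbreviation stab_b :: "('c \<Rightarrow> 'c) set \<Rightarrow> (('v \<Rightarrow> 'v) \<times> ('e \<Rightarrow> 'e)) set" where
  "stab_b H \<equiv> fixing {b} (U H)"

lemma pow_sub: "g [^]\<^bsub>sub K\<^esub> (n::nat) = g [^]\<^bsub>Aut\<^esub> n"
  by (simp add: nat_pow_def)

lemma subgroup_stab_b: "subgroup H (Sym \<Omega>) \<Longrightarrow> subgroup (stab_b H) Aut"
  by (intro subgroup_fixing subgroup_U)

lemma subgroup_pow_closed: "subgroup K Aut \<Longrightarrow> g \<in> K \<Longrightarrow> g [^]\<^bsub>Aut\<^esub> (n::nat) \<in> K"
  by (induction n) (simp_all add: subgroup.one_closed subgroup.m_closed)

lemma fst_pow: "fst g x = x \<Longrightarrow> fst (g [^]\<^bsub>Aut\<^esub> (n::nat)) x = x"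
  by (induction n) (simp_all add: fst_one fst_mult)

lemma local_action_pow:
  assumes "g \<in> carrier Aut" "x \<in> verts T" "fst g x = x"
  shows "\<sigma> (g [^]\<^bsub>Aut\<^esub> (n::nat)) x = \<sigma> g x ^^ n"
proof (induction n)
  case 0
  then show ?case using assms by (simp add: local_action_one)
next
  case (Suc n)
  then show ?case
    using assms by (simp add: local_action_mult fun_eq_iff funpow_swap1)
qed

lemma bounded_depth:
  assumes "finite B" "B \<subseteq> verts T"
  obtains n where "B \<subseteq> ball_V n"
proof -
  have "finite (depth ` B)" using assms by simp
  then obtain n where "\<forall>k \<in> depth ` B. k \<le> n" using finite_nat_set_iff_bounded_le by blast
  then show thesis using that assms(2) by blast
qed

lemma fixing_ball_step:
  assumes "g \<in> carrier Aut" "\<And>x. x \<in> ball_V n \<Longrightarrow> fst g x = x" "\<And>x. x \<in> ball_V n \<Longrightarrow> \<sigma> g x = id"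
    and "y \<in> ball_V (Suc n)"
  shows "fst g y = y"
proof (cases "word y" rule: rev_cases)
  case Nil
  then show ?thesis using assms(2,4) by auto
next
  case (snoc u \<omega>)
  have y: "y \<in> verts T" using assms(4) by simp
  note p = word_parent[OF y snoc]
  have "foldl nb b u \<in> ball_V n" using p snoc assms(4) by simp
  then show ?thesis
    using fst_nb[OF assms(1) p(1,4)] assms(2,3) p(3) by simp
qed

text \<open>At a fixed vertex, powers of an automorphism act locally by powers of the local action
  (\<open>local_action_pow\<close>), and the exponent \<open>card H\<close> kills all elements of
  \<open>H\<close>. Raising to it makes the local actions on a fixed ball trivial and hence fixes
  the next ball, so \<open>n\<close> repetitions give the exponent
  \<open>card H ^ n\<close>.\<close>

lemma pow_fixing_ball:
  assumes H: "subgroup H (Sym \<Omega>)" and s: "s \<in> stab_b H"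
  shows "s [^]\<^bsub>Aut\<^esub> (card H ^ n) \<in> fixing (ball_V n) (stab_b H)"
proof (induction n)
  case 0
  have "x = b" if "x \<in> ball_V 0" for x using that depth_0_iff[of x] by simp
  then show ?case using s subgroup_pow_closed[OF subgroup_stab_b[OF H] s, of 1]
    by (auto simp: fixing_def)
next
  case (Suc n)
  let ?t = "s [^]\<^bsub>Aut\<^esub> (card H ^ n)" and ?u = "s [^]\<^bsub>Aut\<^esub> (card H ^ Suc n)"
  have sA: "s \<in> carrier Aut" using subgroup.mem_carrier[OF subgroup_stab_b[OF H] s] .
  have u: "?u = ?t [^]\<^bsub>Aut\<^esub> card H"
    using sA by (simp add: Aut.nat_pow_pow mult.commute)
  have tA: "?t \<in> carrier Aut" using sA by simp
  have t: "fst ?t x = x" "\<sigma> ?t x \<in> H" if "x \<in> ball_V n" for x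
    using Suc that by (auto simp: fixing_def U_set_def)
  have "fst ?u y = y" if "y \<in> ball_V (Suc n)" for y
  proof (rule fixing_ball_step[OF _ _ _ that])
    fix x assume x: "x \<in> ball_V n"
    show "fst ?u x = x" unfolding u by (rule fst_pow[OF t(1)[OF x]])
    have "\<sigma> ?u x = \<sigma> ?t x ^^ card H"
      unfolding u using local_action_pow[OF tA _ t(1)[OF x]] x by simp
    then show "\<sigma> ?u x = id"
      using funpow_card_subgroup[OF finite_colors H t(2)[OF x]] by simp
  qed (use sA in simp)
  then show ?case
    using subgroup_pow_closed[OF subgroup_stab_b[OF H] s] by (simp add: fixing_def)
qed

text \<open>A statement about indices, with \<open>f\<close> in the role of the map to right cosets.
  The form with an arbitrary \<open>f\<close> also covers cosets in a conjugate of \<open>S\<close>,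
  pulled back to \<open>S\<close> along the conjugation.\<close>

lemma finite_index_image:
  assumes H: "subgroup H (Sym \<Omega>)" and B: "finite B" "B \<subseteq> verts T"
    and f: "\<And>s s'. s \<in> stab_b H \<Longrightarrow> s' \<in> stab_b H \<Longrightarrow> s \<otimes>\<^bsub>Aut\<^esub> inv\<^bsub>Aut\<^esub> s' \<in> fixing B (stab_b H) \<Longrightarrow> f s = f s'"
  shows "finite (f ` stab_b H)"
proof (rule finite_image_factor)
  \<comment> \<open>Right cosets are compared through inverses: \<open>s s'^-1\<close> fixes
    \<open>B\<close> if the inverses of \<open>s\<close> and \<open>s'\<close> agree on
    \<open>B\<close>. Automorphisms fixing the root preserve the depth, so only finitely many such
    restrictions occur.\<close>
  let ?S = "stab_b H" and ?\<phi> = "\<lambda>s. restrict (fst (inv\<^bsub>Aut\<^esub> s)) B"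
  have S: "subgroup ?S Aut" by (rule subgroup_stab_b[OF H])
  obtain n where n: "B \<subseteq> ball_V n" using bounded_depth[OF B] .
  have "?\<phi> ` ?S \<subseteq> B \<rightarrow>\<^sub>E ball_V n"
  proof (intro image_subsetI PiE_I)
    fix s x assume s: "s \<in> ?S" and x: "x \<in> B"
    then have i: "inv\<^bsub>Aut\<^esub> s \<in> ?S" using subgroup.m_inv_closed[OF S] by blast
    then have "fst (inv\<^bsub>Aut\<^esub> s) b = b" "inv\<^bsub>Aut\<^esub> s \<in> carrier Aut"
      using subgroup.mem_carrier[OF S] by (auto simp: fixing_def)
    then show "?\<phi> s x \<in> ball_V n"
      using x n depth_fst[of "inv\<^bsub>Aut\<^esub> s" x] fst_in[of "inv\<^bsub>Aut\<^esub> s" x] by auto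
  qed simp
  from finite_subset[OF this finite_PiE[OF B(1) finite_ball[OF finite_colors]]]
  show "finite (?\<phi> ` ?S)" .
next
  let ?S = "stab_b H" and ?\<phi> = "\<lambda>s. restrict (fst (inv\<^bsub>Aut\<^esub> s)) B"
  have S: "subgroup ?S Aut" by (rule subgroup_stab_b[OF H])
  fix s s' assume s: "s \<in> ?S" and s': "s' \<in> ?S" and eq: "?\<phi> s = ?\<phi> s'"
  have "fst (s \<otimes>\<^bsub>Aut\<^esub> inv\<^bsub>Aut\<^esub> s') x = x" if "x \<in> B" for x
    using fun_cong[OF eq, of x] that fst_inv'[OF subgroup.mem_carrier[OF S s], of x] by (simp add: fst_mult)
  moreover have "s \<otimes>\<^bsub>Aut\<^esub> inv\<^bsub>Aut\<^esub> s' \<in> ?S"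
    using subgroup.m_closed[OF S s subgroup.m_inv_closed[OF S s']] .
  ultimately have "s \<otimes>\<^bsub>Aut\<^esub> inv\<^bsub>Aut\<^esub> s' \<in> fixing B ?S" by (simp add: fixing_def)
  then show "f s = f s'" by (rule f[OF s s'])
qed

lemma rcosets_sub: "rcosets\<^bsub>sub D\<^esub> N = (\<lambda>x. N #>\<^bsub>Aut\<^esub> x) ` D"
  by (auto simp: RCOSETS_def r_coset_def)

lemma mult_inv_cancel:
  "s \<in> carrier Aut \<Longrightarrow> s' \<in> carrier Aut \<Longrightarrow> s \<otimes>\<^bsub>Aut\<^esub> inv\<^bsub>Aut\<^esub> s' \<otimes>\<^bsub>Aut\<^esub> s' = s"
  by (simp add: Aut.m_assoc)

text \<open>An open normal subgroup contains the fixator of a finite vertex set, hence that of a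
  ball. It therefore has finite index and contains a p-power of every element.\<close>

lemma pro_p_stab_b:
  assumes H: "subgroup H (Sym \<Omega>)" and p: "prime p" and card: "card H = p ^ m"
  shows "pro_p p (sub (stab_b H), coset_topology (sub (stab_b H)) (base (stab_b H)))"
  unfolding pro_p.simps
proof (intro conjI allI impI)
  let ?S = "stab_b H"
  have S: "subgroup ?S Aut" by (rule subgroup_stab_b[OF H])
  show "profinite (sub ?S, coset_topology (sub ?S) (base ?S))" by (rule profinite_stabilizer[OF H])
  fix N assume N: "N \<lhd> sub ?S \<and> openin (coset_topology (sub ?S) (base ?S)) N"
  then have NS: "subgroup N (sub ?S)" by (simp add: normal_imp_subgroup)
  have N_Aut: "subgroup N Aut" using Aut.incl_subgroup[OF S NS] .
  interpret B: subgroup_base "sub ?S" "base ?S" by (rule subgroup_base_base[OF S S order_refl])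
  have "\<one>\<^bsub>Aut\<^esub> \<in> N" using subgroup.one_closed[OF N_Aut] .
  then obtain M where M: "M \<in> base ?S" "\<And>k. k \<in> M \<Longrightarrow> \<one>\<^bsub>Aut\<^esub> \<otimes>\<^bsub>Aut\<^esub> k \<in> N"
    using B.openin_coset_topologyE[of N "\<one>\<^bsub>Aut\<^esub>"] N by auto
  obtain B where B: "finite B" "B \<subseteq> verts T" "M = fixing B ?S" using M(1) by (rule baseE)
  have BN: "fixing B ?S \<subseteq> N"
  proof
    fix k assume k: "k \<in> fixing B ?S"
    then have "k \<in> carrier Aut" using subgroup.mem_carrier[OF S] by (simp add: fixing_def)
    then show "k \<in> N" using M(2)[of k] k B(3) by simp
  qed
  have "finite ((\<lambda>x. N #>\<^bsub>Aut\<^esub> x) ` ?S)"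
  proof (rule finite_index_image[OF H B(1,2)])
    fix s s' assume s: "s \<in> ?S" "s' \<in> ?S" "s \<otimes>\<^bsub>Aut\<^esub> inv\<^bsub>Aut\<^esub> s' \<in> fixing B ?S"
    have A: "s \<in> carrier Aut" "s' \<in> carrier Aut" using subgroup.mem_carrier[OF S] s(1,2) by simp_all
    have "s \<otimes>\<^bsub>Aut\<^esub> inv\<^bsub>Aut\<^esub> s' \<in> N" using BN s(3) by blast
    from Aut.r_coset_mult_subgroup[OF N_Aut this A(2)]
    show "N #>\<^bsub>Aut\<^esub> s = N #>\<^bsub>Aut\<^esub> s'" by (simp add: mult_inv_cancel[OF A])
  qed
  then have fin: "finite (rcosets\<^bsub>sub ?S\<^esub> N)" by (simp add: rcosets_sub)
  obtain n where n: "B \<subseteq> ball_V n" using bounded_depth[OF B(1,2)] .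
  show "\<exists>n. card (rcosets\<^bsub>sub ?S\<^esub> N) = p ^ n"
  proof (rule group.card_rcosets_prime_power[OF group_sub[OF S] _ fin p])
    show "N \<lhd> sub ?S" using N by blast
    fix s assume "s \<in> carrier (sub ?S)"
    then have "s [^]\<^bsub>Aut\<^esub> (card H ^ n) \<in> fixing (ball_V n) ?S"
      using pow_fixing_ball[OF H] by simp
    also have "\<dots> \<subseteq> N" using BN n by (auto simp: fixing_def)
    finally have "s [^]\<^bsub>Aut\<^esub> (p ^ (m * n)) \<in> N" by (simp add: card power_mult)
    then show "\<exists>k. s [^]\<^bsub>sub ?S\<^esub> (p ^ k) \<in> N" unfolding pow_sub by blast
  qed
qed

text \<open>Since \<open>P\<close> fixes the root it preserves balls, so the fixator of a ball is
  normal in \<open>P\<close> as well as open. Its index is a power of p and serves as the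
  exponent.\<close>

lemma pro_p_power:
  assumes P: "subgroup P Aut" and Pb: "\<And>g. g \<in> P \<Longrightarrow> fst g b = b"
    and pro: "pro_p p (sub P, coset_topology (sub P) (base P))" and g: "g \<in> P"
  shows "\<exists>k. g [^]\<^bsub>Aut\<^esub> (p ^ k :: nat) \<in> fixing (ball_V n) P"
proof -
  let ?N = "fixing (ball_V n) P"
  interpret B: subgroup_base "sub P" "base P" by (rule subgroup_base_base[OF P P order_refl])
  have NB: "?N \<in> base P" using finite_ball[OF finite_colors] by (intro baseI) auto
  have NA: "subgroup ?N Aut" by (rule subgroup_fixing[OF P])
  have "openin (coset_topology (sub P) (base P)) ?N"
  proof (rule B.openin_coset_topologyI)
    fix k assume "k \<in> ?N"
    then show "\<exists>N\<in>base P. \<forall>k'\<in>N. k \<otimes>\<^bsub>sub P\<^esub> k' \<in> ?N"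
      using NB subgroup.m_closed[OF NA] by (intro bexI[of _ ?N]) auto
  qed (simp add: fixing_subset)
  moreover have norm: "?N \<lhd> sub P"
    unfolding B.normal_inv_iff
  proof (intro conjI ballI)
    show "subgroup ?N (sub P)" by (rule subgroup_sub[OF NA P fixing_subset])
    fix h k assume "h \<in> carrier (sub P)" and k: "k \<in> ?N"
    then have h: "h \<in> P" by simp
    then have hA: "h \<in> carrier Aut" and ih: "inv\<^bsub>Aut\<^esub> h \<in> P"
      using subgroup.mem_carrier[OF P] subgroup.m_inv_closed[OF P] by simp_all
    have kP: "k \<in> P" using k by (simp add: fixing_def)
    have "fst (h \<otimes>\<^bsub>Aut\<^esub> k \<otimes>\<^bsub>Aut\<^esub> inv\<^bsub>Aut\<^esub> h) x = x" if x: "x \<in> ball_V n" for x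
    proof (rule fst_conj_fixes[OF hA])
      have "fst (inv\<^bsub>Aut\<^esub> h) x \<in> ball_V n"
        using x hA depth_fst[of "inv\<^bsub>Aut\<^esub> h" x] Pb[OF ih] fst_in[of "inv\<^bsub>Aut\<^esub> h" x] by simp
      then show "fst k (fst (inv\<^bsub>Aut\<^esub> h) x) = fst (inv\<^bsub>Aut\<^esub> h) x"
        using k unfolding fixing_def by blast
    qed
    then have "h \<otimes>\<^bsub>Aut\<^esub> k \<otimes>\<^bsub>Aut\<^esub> inv\<^bsub>Aut\<^esub> h \<in> ?N"
      using subgroup.m_closed[OF P subgroup.m_closed[OF P h kP] ih] by (simp add: fixing_def)
    then show "h \<otimes>\<^bsub>sub P\<^esub> k \<otimes>\<^bsub>sub P\<^esub> inv\<^bsub>sub P\<^esub> h \<in> ?N"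
      using Aut.m_inv_consistent[OF P h] by simp
  qed
  ultimately obtain k where "card (rcosets\<^bsub>sub P\<^esub> ?N) = p ^ k"
    using pro by auto
  then show ?thesis
    using B.pow_card_rcosets[OF norm, of g] g by (auto simp: pow_sub)
qed

section \<open>Local actions of congruence subgroups\<close>

text \<open>The last letter of \<open>word x\<close> is the colour of the edge from \<open>x\<close> towards the root.\<close>

definition link_group :: "('c \<Rightarrow> 'c) set \<Rightarrow> 'v \<Rightarrow> ('c \<Rightarrow> 'c) set" where
  "link_group H x = (if x = b then H else perm_stab \<Omega> H (last (word x)))"

lemma link_group_subset: "link_group H x \<subseteq> H"
  by (simp add: link_group_def perm_stab_eq)

text \<open>The parent of \<open>x\<close> lies in the ball, so the edge towards it is fixed and the
  local action fixes its colour.\<close>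

lemma local_action_link:
  assumes k: "k \<in> carrier Aut" and x: "x \<in> verts T" and fix_ball: "\<And>y. y \<in> ball_V (depth x) \<Longrightarrow> fst k y = y"
    and H: "\<sigma> k x \<in> H"
  shows "\<sigma> k x \<in> link_group H x"
proof (cases "word x" rule: rev_cases)
  case Nil
  then show ?thesis using H depth_0_iff[OF x] by (simp add: link_group_def)
next
  case (snoc u \<omega>)
  note p = word_parent[OF x snoc]
  have n: "nb x \<omega> = foldl nb b u" using p nb_nb by metis
  have "nb (fst k x) (\<sigma> k x \<omega>) = nb x \<omega>"
    using fst_nb[OF k x p(4)] fix_ball[of "nb x \<omega>"] n p snoc by simp
  then have "\<sigma> k x \<omega> = \<omega>"
    using fix_ball[of x] x p(4) local_action_in[OF k x p(4)] nb_inj[OF x, of "\<sigma> k x \<omega>" \<omega>] by simp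
  moreover have "x \<noteq> b" using snoc by auto
  ultimately show ?thesis using H snoc by (simp add: link_group_def perm_stab_eq)
qed

text \<open>Converse to \<open>local_action_link\<close>: apart from the colour towards the root,
  nothing constrains within \<open>H\<close> the local action at \<open>x\<close> of an element that
  fixes the ball.\<close>

lemma ex_fixing_ball:
  assumes H: "subgroup H (Sym \<Omega>)" and x: "x \<in> verts T" and \<pi>: "\<pi> \<in> link_group H x"
  obtains k where "k \<in> fixing (ball_V (depth x)) (stab_b H)" "\<sigma> k x = \<pi>"
proof -
  \<comment> \<open>The identity at smaller depth and \<open>\<pi>\<close> at \<open>x\<close> are
    compatible because \<open>\<pi>\<close> fixes the colour towards the root. Trivial local actions
    below \<open>depth x\<close> already fix all vertices of that depth.\<close>
  define D where "D = {y \<in> verts T. depth y < depth x} \<union> {x}"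
  define t0 where "t0 = (\<lambda>y. if y = x then \<pi> else id)"
  have \<pi>H: "\<pi> \<in> H" using \<pi> link_group_subset by blast
  have tH: "t0 y \<in> H" for y using \<pi>H subgroup_SymD(2)[OF H] by (simp add: t0_def)
  have t0_nb: "y \<in> D \<and> t0 (nb y \<omega>) \<omega> = t0 y \<omega>"
    if y: "y \<in> verts T" "\<omega> \<in> \<Omega>" "depth (nb y \<omega>) = Suc (depth y)" "nb y \<omega> \<in> D" for y \<omega>
  proof -
    have d: "depth y < depth x" using y by (auto simp: D_def)
    have "t0 (nb y \<omega>) \<omega> = \<omega>"
    proof (cases "nb y \<omega> = x")
      case True
      then have "word x = word y @ [\<omega>]" using word_nb[OF y(1,2)] y(3) by auto
      then have "x \<noteq> b" "last (word x) = \<omega>" by auto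
      then show ?thesis using \<pi> True by (simp add: t0_def link_group_def perm_stab_eq)
    qed (simp add: t0_def)
    moreover have "y \<noteq> x" using d by auto
    ultimately show ?thesis using d y by (simp add: D_def t0_def)
  qed
  obtain k where k: "k \<in> carrier Aut" "fst k b = b" "\<And>y. y \<in> D \<Longrightarrow> y \<in> verts T \<Longrightarrow> \<sigma> k y = t0 y"
    "\<And>y. y \<in> verts T \<Longrightarrow> y \<notin> D \<Longrightarrow> \<sigma> k y \<in> H"
    by (rule extend_local_data[of b H D t0, OF b_in subgroup_SymD(1,2)[OF H]])
      (use tH subgroup_SymD(1)[OF H] t0_nb in blast)+
  have kx: "\<sigma> k x = \<pi>" using k(3)[of x] x by (simp add: D_def t0_def)
  have "fst k y = y" if y: "y \<in> ball_V (depth x)" for y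
  proof -
    have "\<sigma> k z = \<sigma> \<one>\<^bsub>Aut\<^esub> z" if "z \<in> verts T" "depth z < depth x" for z
      using k(3)[of z] that by (auto simp: D_def t0_def local_action_one)
    then have "fst k y = fst \<one>\<^bsub>Aut\<^esub> y"
      using y k by (intro fst_agree[of k "\<one>\<^bsub>Aut\<^esub>" "depth x" y]) (auto simp: fst_one)
    then show ?thesis by (simp add: fst_one)
  qed
  moreover have "\<sigma> k y \<in> H" if "y \<in> verts T" for y using k(3,4) tH that by (metis (full_types))
  ultimately have "k \<in> fixing (ball_V (depth x)) (stab_b H)"
    using k by (simp add: fixing_def U_set_def)
  then show thesis using that kx by blast
qed

text \<open>Supplies the corrections by elements of \<open>S\<close> in the maximality proof: the
  local actions of \<open>g\<close> are kept at depth below \<open>n\<close> and continued in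
  \<open>H\<close> outside.\<close>

lemma ex_agreeing:
  assumes H: "subgroup H (Sym \<Omega>)" and g: "g \<in> carrier Aut" "fst g b = b"
    and gH: "\<And>y. y \<in> verts T \<Longrightarrow> depth y < n \<Longrightarrow> \<sigma> g y \<in> H"
  obtains s where "s \<in> stab_b H" "\<And>y. y \<in> ball_V n \<Longrightarrow> fst s y = fst g y"
proof -
  define D where "D = {y \<in> verts T. depth y < n}"
  have t0_nb: "y \<in> D \<and> \<sigma> g (nb y \<omega>) \<omega> = \<sigma> g y \<omega>"
    if "y \<in> verts T" "\<omega> \<in> \<Omega>" "depth (nb y \<omega>) = Suc (depth y)" "nb y \<omega> \<in> D" for y \<omega>
    using that local_action_nb[OF g(1)] by (auto simp: D_def)
  have tH: "\<sigma> g y \<in> H" if "y \<in> D" for y using that gH by (simp add: D_def)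
  obtain s where s: "s \<in> carrier Aut" "fst s b = b" "\<And>y. y \<in> D \<Longrightarrow> y \<in> verts T \<Longrightarrow> \<sigma> s y = \<sigma> g y"
    "\<And>y. y \<in> verts T \<Longrightarrow> y \<notin> D \<Longrightarrow> \<sigma> s y \<in> H"
    by (rule extend_local_data[of b H D "\<sigma> g", OF b_in subgroup_SymD(1,2)[OF H]])
      (use tH subgroup_SymD(1)[OF H] t0_nb in blast)+
  have "\<sigma> s y \<in> H" if "y \<in> verts T" for y using s(3,4) tH that by metis
  then have "s \<in> stab_b H" using s by (simp add: fixing_def U_set_def)
  moreover have "fst s y = fst g y" if "y \<in> ball_V n" for y
    using that s g by (intro fst_agree[of s g n y]) (auto simp: D_def)
  ultimately show thesis using that by blast
qed

end

lemma (in group) mult_inv_assoc: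
  assumes "x \<in> carrier G" "y \<in> carrier G"
  shows "inv x \<otimes> (x \<otimes> y) = y" "x \<otimes> (inv x \<otimes> y) = y"
  using assms by (simp_all add: m_assoc[symmetric])

section \<open>Maximality of \<open>S\<close> among the pro-p subgroups of
  \<open>U(F)_b\<close>\<close>

locale sylow_data = finite_colored_tree T arev \<Omega> l b
  for T :: "('v, 'e) pre_digraph" and arev and \<Omega> :: "'c set" and l and b :: 'v +
  fixes F F' Fp :: "('c \<Rightarrow> 'c) set" and p :: nat
  assumes p: "prime p"
    and F: "subgroup F (Sym \<Omega>)" and F': "subgroup F' (Sym \<Omega>)"
    and FF': "F \<subseteq> F'" and F'_hull: "F' \<subseteq> orbit_hull \<Omega> F"
    and syl: "sylow_subgroup p Fp ((Sym \<Omega>)\<lparr>carrier := F\<rparr>)"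
    and orb: "perm_orbits \<Omega> F = perm_orbits \<Omega> Fp"
    and norm: "\<And>\<omega>. \<omega> \<in> \<Omega> \<Longrightarrow>
      normalizer ((Sym \<Omega>)\<lparr>carrier := perm_stab \<Omega> F' \<omega>\<rparr>) (perm_stab \<Omega> Fp \<omega>) = perm_stab \<Omega> Fp \<omega>"
begin

lemma Fp: "subgroup Fp (Sym \<Omega>)" and FpF: "Fp \<subseteq> F" and card_Fp: "card Fp = p ^ multiplicity p (card F)"
proof -
  have *: "subgroup Fp ((Sym \<Omega>)\<lparr>carrier := F\<rparr>)" using syl by (simp add: sylow_subgroup_def)
  show "subgroup Fp (Sym \<Omega>)" using group.incl_subgroup[OF group_Sym F *] .
  show "Fp \<subseteq> F" using subgroup.subset[OF *] by simp
  show "card Fp = p ^ multiplicity p (card F)" using syl by (simp add: sylow_subgroup_def order_def)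
qed

lemma subgroup_link_group: "subgroup H (Sym \<Omega>) \<Longrightarrow> subgroup (link_group H x) (Sym \<Omega>)"
  by (simp add: link_group_def subgroup_perm_stab)

lemma last_word_in:
  assumes "x \<in> verts T" "x \<noteq> b"
  shows "last (word x) \<in> \<Omega>"
  using word_in[OF assms(1)] depth_0_iff[OF assms(1)] assms(2) last_in_set by blast

lemma sylow_link_group:
  assumes "x \<in> verts T"
  shows "sylow_subgroup p (link_group Fp x) ((Sym \<Omega>)\<lparr>carrier := link_group F x\<rparr>)"
  using syl sylow_perm_stab[OF finite_colors p F Fp FpF syl orb last_word_in[OF assms]]
  by (simp add: link_group_def)

lemma pro_p_subgroup_maximal:
  assumes P: "subgroup P Aut" and SP: "stab_b Fp \<subseteq> P" and PK: "P \<subseteq> stab_b F"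
    and pro: "pro_p p (sub P, coset_topology (sub P) (base P))"
  shows "P = stab_b Fp"
proof -
  have Pb: "fst g b = b" if "g \<in> P" for g using PK that by (auto simp: fixing_def)
  have PA: "g \<in> carrier Aut" if "g \<in> P" for g using subgroup.mem_carrier[OF P that] .
  have PF: "\<sigma> g x \<in> F" if "g \<in> P" "x \<in> verts T" for g x using PK that by (auto simp: fixing_def U_set_def)
  have main: "\<sigma> g x \<in> Fp" if "g \<in> P" "x \<in> verts T" for g x
    using that
  proof (induction "depth x" arbitrary: g x rule: less_induct)
    case less
    let ?n = "depth x"
    \<comment> \<open>The induction hypothesis holds for all elements of \<open>P\<close> at all
      smaller depths, so \<open>g\<close> agrees on the ball with an element of \<open>S\<close>.
      The quotient \<open>k\<close> then fixes the ball and carries the unknown part of the local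
      action at \<open>x\<close>.\<close>
    obtain s where s: "s \<in> stab_b Fp" "\<And>y. y \<in> ball_V ?n \<Longrightarrow> fst s y = fst g y"
      using ex_agreeing[OF Fp PA[OF less.prems(1)] Pb[OF less.prems(1)], of ?n] less.hyps less.prems(1) by blast
    have sP: "s \<in> P" using s SP by blast
    define k where "k = inv\<^bsub>Aut\<^esub> s \<otimes>\<^bsub>Aut\<^esub> g"
    have kP: "k \<in> P" unfolding k_def
      by (intro subgroup.m_closed[OF P] subgroup.m_inv_closed[OF P] sP less.prems(1))
    have kfix: "fst k y = y" if "y \<in> ball_V ?n" for y
      using s(2)[OF that] fst_inv[OF PA[OF sP], of y] by (simp add: k_def fst_mult)
    \<comment> \<open>Elements fixing \<open>x\<close> have multiplicative local actions at
      \<open>x\<close>, so \<open>Q\<close> is a group; it lies between the two link groups.\<close>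
    define Q where "Q = (\<lambda>h. \<sigma> h x) ` fixing (ball_V ?n) P"
    let ?N = "fixing (ball_V ?n) P"
    have N: "subgroup ?N Aut" by (rule subgroup_fixing[OF P])
    have NP: "?N \<subseteq> P" by (rule fixing_subset)
    have Nx: "fst h x = x" if "h \<in> ?N" for h using that less.prems(2) by (simp add: fixing_def)
    have NA: "h \<in> carrier Aut" if "h \<in> ?N" for h using that NP PA by blast
    have QF: "Q \<subseteq> link_group F x"
    proof
      fix \<pi> assume "\<pi> \<in> Q"
      then obtain h where h: "h \<in> ?N" "\<pi> = \<sigma> h x" by (auto simp: Q_def)
      have "fst h y = y" if "y \<in> ball_V ?n" for y using h(1) that unfolding fixing_def by blast
      then show "\<pi> \<in> link_group F x"
        unfolding h(2) using less.prems(2) PF[OF subsetD[OF NP h(1)] less.prems(2)]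
        by (intro local_action_link NA[OF h(1)]) auto
    qed
    have FpQ: "link_group Fp x \<subseteq> Q"
    proof
      fix \<pi> assume "\<pi> \<in> link_group Fp x"
      then obtain h where h: "h \<in> fixing (ball_V ?n) (stab_b Fp)" "\<sigma> h x = \<pi>"
        by (rule ex_fixing_ball[OF Fp less.prems(2)])
      then have "h \<in> ?N" using SP by (auto simp: fixing_def)
      then show "\<pi> \<in> Q" unfolding Q_def using h(2) by blast
    qed
    have QSym: "subgroup Q (Sym \<Omega>)"
    proof (rule group.subgroupI[OF group_Sym])
      show "Q \<subseteq> carrier (Sym \<Omega>)"
        using QF subgroup.subset[OF subgroup_link_group[OF F]] by blast
      show "Q \<noteq> {}" unfolding Q_def using subgroup.one_closed[OF N] by blast
    next
      fix \<pi> assume "\<pi> \<in> Q"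
      then obtain h where h: "h \<in> ?N" "\<pi> = \<sigma> h x" by (auto simp: Q_def)
      have "\<sigma> (inv\<^bsub>Aut\<^esub> h) x = inv_into UNIV \<pi>"
        using local_action_inv_eq[OF NA[OF h(1)] less.prems(2)] h(2) Nx[OF h(1)] by simp
      then have "inv\<^bsub>Sym \<Omega>\<^esub> \<pi> = \<sigma> (inv\<^bsub>Aut\<^esub> h) x"
        using inv_Sym[OF local_action_permutes[OF NA[OF h(1)] less.prems(2)]] h(2) by simp
      then show "inv\<^bsub>Sym \<Omega>\<^esub> \<pi> \<in> Q"
        unfolding Q_def using subgroup.m_inv_closed[OF N h(1)] by (rule image_eqI)
    next
      fix \<pi> \<rho> assume "\<pi> \<in> Q" "\<rho> \<in> Q"
      then obtain h k where h: "h \<in> ?N" "\<pi> = \<sigma> h x" "k \<in> ?N" "\<rho> = \<sigma> k x" by (auto simp: Q_def)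
      have "\<pi> \<otimes>\<^bsub>Sym \<Omega>\<^esub> \<rho> = \<sigma> (h \<otimes>\<^bsub>Aut\<^esub> k) x"
        using local_action_mult[OF NA[OF h(1)] NA[OF h(3)] less.prems(2)] h Nx[OF h(3)] by (simp add: mult_Sym)
      then show "\<pi> \<otimes>\<^bsub>Sym \<Omega>\<^esub> \<rho> \<in> Q"
        unfolding Q_def using subgroup.m_closed[OF N h(1,3)] by (rule image_eqI)
    qed
    have Qpow: "\<exists>j. \<pi> [^]\<^bsub>(Sym \<Omega>)\<lparr>carrier := link_group F x\<rparr>\<^esub> (p ^ j) = \<one>\<^bsub>(Sym \<Omega>)\<lparr>carrier := link_group F x\<rparr>\<^esub>"
      if "\<pi> \<in> Q" for \<pi>
    proof -
      obtain h where h: "h \<in> ?N" "\<pi> = \<sigma> h x" using \<open>\<pi> \<in> Q\<close> by (auto simp: Q_def)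
      \<comment> \<open>The next larger ball is taken because it contains the neighbours of
        \<open>x\<close>; fixing these makes the local action at \<open>x\<close> trivial.\<close>
      obtain j where j: "h [^]\<^bsub>Aut\<^esub> (p ^ j) \<in> fixing (ball_V (Suc ?n)) P"
        using pro_p_power[OF P Pb pro, of h] h NP by blast
      have hA: "h [^]\<^bsub>Aut\<^esub> (p ^ j) \<in> carrier Aut" using NA[OF h(1)] by simp
      have "\<sigma> (h [^]\<^bsub>Aut\<^esub> (p ^ j)) x = id"
        using j less.prems(2) depth_nb[OF less.prems(2)] nb_in[OF less.prems(2)]
        by (intro local_action_fixing hA) (auto simp: fixing_def)
      then have "\<pi> ^^ (p ^ j) = id"
        using local_action_pow[OF NA[OF h(1)] less.prems(2) Nx[OF h(1)], of "p ^ j"] h(2) by simp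
      then show ?thesis unfolding pow_Sym by (auto simp: one_Sym)
    qed
    have "Q = link_group Fp x"
    proof (rule sylow_subgroup_maximal[OF _ _ p sylow_link_group[OF less.prems(2)] _ FpQ Qpow])
      show "group ((Sym \<Omega>)\<lparr>carrier := link_group F x\<rparr>)"
        using group.subgroup_imp_group[OF group_Sym subgroup_link_group[OF F]] .
      show "finite (carrier ((Sym \<Omega>)\<lparr>carrier := link_group F x\<rparr>))"
        using finite_subgroup_Sym[OF finite_colors subgroup_link_group[OF F]] by simp
      show "subgroup Q ((Sym \<Omega>)\<lparr>carrier := link_group F x\<rparr>)"
        using group.subgroup_incl[OF group_Sym QSym subgroup_link_group[OF F] QF] .
    qed
    moreover have "\<sigma> k x \<in> Q" unfolding Q_def using kP kfix by (auto simp: fixing_def)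
    ultimately have kx: "\<sigma> k x \<in> Fp" using link_group_subset by blast
    have "g = s \<otimes>\<^bsub>Aut\<^esub> k"
      unfolding k_def using PA[OF sP] PA[OF less.prems(1)] by (simp add: Aut.m_assoc[symmetric])
    then have "\<sigma> g x = \<sigma> s x \<circ> \<sigma> k x"
      using local_action_mult[OF PA[OF sP] PA[OF kP] less.prems(2)] kfix[of x] less.prems(2) by simp
    moreover have "\<sigma> s x \<in> Fp" using s(1) less.prems(2) by (simp add: fixing_def U_set_def)
    ultimately show ?case using kx subgroup_SymD(3)[OF Fp] by simp
  qed
  have "P \<subseteq> stab_b Fp"
  proof
    fix g assume "g \<in> P"
    then show "g \<in> stab_b Fp" using main PA Pb by (simp add: fixing_def U_set_def)
  qed
  then show ?thesis using SP by blast
qed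

abbreviation L :: "(('v \<Rightarrow> 'v) \<times> ('e \<Rightarrow> 'e)) set" where
  "L \<equiv> Gs F \<inter> U F'"

lemma subgroup_L: "subgroup L Aut"
  by (intro Aut.subgroups_Inter_pair subgroup_G subgroup_U F F')

lemma U_F_subset_L: "U F \<subseteq> L"
  using U_subset_G U_mono[OF FF'] by blast

lemma stab_b_subset: "stab_b Fp \<subseteq> stab_b F" "stab_b F \<subseteq> U F"
  using U_mono[OF FpF] by (auto simp: fixing_def)

text \<open>Inside \<open>U F\<close> the topology of \<open>L\<close> is the permutation topology,
  so compactness and the pro-p property may be tested there.\<close>

lemma subtopology_L:
  assumes M: "subgroup M Aut" and MF: "M \<subseteq> U F"
  shows "subtopology (coset_topology (sub L) (base (U F))) M = coset_topology (sub M) (base M)"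
  using subtopology_coset_base[OF subgroup_U[OF F] subgroup_L U_F_subset_L M subset_trans[OF MF U_F_subset_L]]
    base_Int[OF MF] by simp

lemma local_sylow_stab_b:
  "local_sylow p (stab_b Fp) (sub L, coset_topology (sub L) (base (U F)))"
proof -
  let ?T = "coset_topology (sub L) (base (U F))"
  interpret B: subgroup_base "sub L" "base (U F)"
    by (rule subgroup_base_base[OF subgroup_U[OF F] subgroup_L U_F_subset_L])
  have K: "subgroup (stab_b F) Aut" and S: "subgroup (stab_b Fp) Aut"
    by (rule subgroup_stab_b[OF F], rule subgroup_stab_b[OF Fp])
  have KL: "stab_b F \<subseteq> L" using stab_b_subset U_F_subset_L by blast
  have SL: "stab_b Fp \<subseteq> L" using stab_b_subset U_F_subset_L by blast
  have "compactin ?T (stab_b F)"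
    unfolding compactin_subspace subtopology_L[OF K stab_b_subset(2)]
    using profinite_stabilizer[OF F] KL by simp
  moreover have "openin ?T (stab_b F)"
  proof (rule B.openin_coset_topologyI)
    fix g assume "g \<in> stab_b F"
    then show "\<exists>N\<in>base (U F). \<forall>k\<in>N. g \<otimes>\<^bsub>sub L\<^esub> k \<in> stab_b F"
      using subgroup.m_closed[OF K] b_in by (intro bexI[of _ "stab_b F"] baseI) auto
  qed (use KL in simp)
  moreover have "subgroup (stab_b F) (sub L)" by (rule subgroup_sub[OF K subgroup_L KL])
  moreover have "pro_p_subgroup p (stab_b Fp) (sub L, ?T)"
    using pro_p_stab_b[OF Fp p card_Fp] subtopology_L[OF S] stab_b_subset
      subgroup_sub[OF S subgroup_L SL]
    by (simp add: pro_p_subgroup_def del: pro_p.simps)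
  moreover have "P = stab_b Fp"
    if P: "pro_p_subgroup p P (sub L, ?T) \<and> stab_b Fp \<subseteq> P \<and> P \<subseteq> stab_b F" for P
  proof -
    have "subgroup P (sub L)" using P by (simp add: pro_p_subgroup_def)
    then have PA: "subgroup P Aut" by (rule Aut.incl_subgroup[OF subgroup_L])
    have "P \<subseteq> U F" using P stab_b_subset by blast
    with P have "pro_p p (sub P, coset_topology (sub P) (base P))"
      using subtopology_L[OF PA] by (simp add: pro_p_subgroup_def del: pro_p.simps)
    then show ?thesis using pro_p_subgroup_maximal[OF PA] P by blast
  qed
  ultimately show ?thesis
    using stab_b_subset(1) by auto
qed

section \<open>The commensurator\<close>

lemma conjugate_eq:
  assumes "g \<in> L"
  shows "conjugate (sub L) g H = (\<lambda>h. g \<otimes>\<^bsub>Aut\<^esub> h \<otimes>\<^bsub>Aut\<^esub> inv\<^bsub>Aut\<^esub> g) ` H"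
  using Aut.m_inv_consistent[OF subgroup_L assms]
  by (auto simp: conjugate_def l_coset_def r_coset_def)

lemma mem_conjugate_iff:
  assumes "g \<in> L" "H \<subseteq> carrier Aut" "h \<in> carrier Aut"
  shows "h \<in> conjugate (sub L) g H \<longleftrightarrow> inv\<^bsub>Aut\<^esub> g \<otimes>\<^bsub>Aut\<^esub> h \<otimes>\<^bsub>Aut\<^esub> g \<in> H"
proof -
  have gA: "g \<in> carrier Aut" using subgroup.mem_carrier[OF subgroup_L assms(1)] .
  have e: "h = g \<otimes>\<^bsub>Aut\<^esub> (inv\<^bsub>Aut\<^esub> g \<otimes>\<^bsub>Aut\<^esub> h \<otimes>\<^bsub>Aut\<^esub> g) \<otimes>\<^bsub>Aut\<^esub> inv\<^bsub>Aut\<^esub> g"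
    using gA assms(3) by (simp add: Aut.m_assoc) (simp add: Aut.m_assoc[symmetric])
  show ?thesis
  proof
    assume "h \<in> conjugate (sub L) g H"
    then obtain k where k: "k \<in> H" "h = g \<otimes>\<^bsub>Aut\<^esub> k \<otimes>\<^bsub>Aut\<^esub> inv\<^bsub>Aut\<^esub> g"
      unfolding conjugate_eq[OF assms(1)] by blast
    then have "inv\<^bsub>Aut\<^esub> g \<otimes>\<^bsub>Aut\<^esub> h \<otimes>\<^bsub>Aut\<^esub> g = k"
      using gA subsetD[OF assms(2) k(1)] by (simp add: Aut.m_assoc) (simp add: Aut.m_assoc[symmetric])
    then show "inv\<^bsub>Aut\<^esub> g \<otimes>\<^bsub>Aut\<^esub> h \<otimes>\<^bsub>Aut\<^esub> g \<in> H" using k by simp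
  next
    assume "inv\<^bsub>Aut\<^esub> g \<otimes>\<^bsub>Aut\<^esub> h \<otimes>\<^bsub>Aut\<^esub> g \<in> H"
    then show "h \<in> conjugate (sub L) g H"
      unfolding conjugate_eq[OF assms(1)] by (intro image_eqI[of h _ "inv\<^bsub>Aut\<^esub> g \<otimes>\<^bsub>Aut\<^esub> h \<otimes>\<^bsub>Aut\<^esub> g"] e)
  qed
qed

lemma subgroup_conjugate:
  assumes g: "g \<in> L" and H: "subgroup H Aut"
  shows "subgroup (conjugate (sub L) g H) Aut"
proof -
  have gA: "g \<in> carrier Aut" using subgroup.mem_carrier[OF subgroup_L g] .
  have HA: "H \<subseteq> carrier Aut" using subgroup.subset[OF H] .
  let ?C = "conjugate (sub L) g H"
  have CA: "?C \<subseteq> carrier Aut" unfolding conjugate_eq[OF g] using gA HA by auto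
  show ?thesis
  proof (rule Aut.subgroupI[OF CA])
    have "\<one>\<^bsub>Aut\<^esub> \<in> ?C"
      using mem_conjugate_iff[OF g HA, of "\<one>\<^bsub>Aut\<^esub>"] gA subgroup.one_closed[OF H] by simp
    then show "?C \<noteq> {}" by blast
  next
    fix c assume c: "c \<in> ?C"
    then have cA: "c \<in> carrier Aut" using CA by blast
    have "inv\<^bsub>Aut\<^esub> (inv\<^bsub>Aut\<^esub> g \<otimes>\<^bsub>Aut\<^esub> c \<otimes>\<^bsub>Aut\<^esub> g) \<in> H"
      using subgroup.m_inv_closed[OF H] mem_conjugate_iff[OF g HA cA] c by blast
    then show "inv\<^bsub>Aut\<^esub> c \<in> ?C"
      using mem_conjugate_iff[OF g HA, of "inv\<^bsub>Aut\<^esub> c"] gA cA by (simp add: Aut.inv_mult_group Aut.m_assoc)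
  next
    fix c c' assume c: "c \<in> ?C" "c' \<in> ?C"
    then have cA: "c \<in> carrier Aut" "c' \<in> carrier Aut" using CA by auto
    have "inv\<^bsub>Aut\<^esub> g \<otimes>\<^bsub>Aut\<^esub> c \<otimes>\<^bsub>Aut\<^esub> g \<otimes>\<^bsub>Aut\<^esub> (inv\<^bsub>Aut\<^esub> g \<otimes>\<^bsub>Aut\<^esub> c' \<otimes>\<^bsub>Aut\<^esub> g) \<in> H"
      using subgroup.m_closed[OF H] mem_conjugate_iff[OF g HA cA(1)] mem_conjugate_iff[OF g HA cA(2)] c by blast
    also have "inv\<^bsub>Aut\<^esub> g \<otimes>\<^bsub>Aut\<^esub> c \<otimes>\<^bsub>Aut\<^esub> g \<otimes>\<^bsub>Aut\<^esub> (inv\<^bsub>Aut\<^esub> g \<otimes>\<^bsub>Aut\<^esub> c' \<otimes>\<^bsub>Aut\<^esub> g) = inv\<^bsub>Aut\<^esub> g \<otimes>\<^bsub>Aut\<^esub> (c \<otimes>\<^bsub>Aut\<^esub> c') \<otimes>\<^bsub>Aut\<^esub> g"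
      using gA cA by (simp add: Aut.m_assoc Aut.mult_inv_assoc)
    finally show "c \<otimes>\<^bsub>Aut\<^esub> c' \<in> ?C"
      using mem_conjugate_iff[OF g HA, of "c \<otimes>\<^bsub>Aut\<^esub> c'"] gA cA by simp
  qed
qed

text \<open>\<open>S\<close> belongs to the base of \<open>U Fp\<close> as the fixator of the root,
  so this is \<open>G_conj\<close> with \<open>N\<close> equal to \<open>S\<close>.\<close>

lemma stab_b_conj:
  assumes "g \<in> Gs Fp"
  obtains B where "finite B" "B \<subseteq> verts T"
    "\<And>k. k \<in> fixing B (stab_b Fp) \<Longrightarrow> g \<otimes>\<^bsub>Aut\<^esub> k \<otimes>\<^bsub>Aut\<^esub> inv\<^bsub>Aut\<^esub> g \<in> stab_b Fp"
proof -
  have "stab_b Fp \<in> base (U Fp)" using b_in by (intro baseI) auto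
  from G_conj[OF Fp assms this] obtain M
    where M: "M \<in> base (U Fp)" "\<forall>k\<in>M. g \<otimes>\<^bsub>Aut\<^esub> k \<otimes>\<^bsub>Aut\<^esub> inv\<^bsub>Aut\<^esub> g \<in> stab_b Fp" by blast
  obtain B where B: "finite B" "B \<subseteq> verts T" "M = fixing B (U Fp)" using M(1) by (rule baseE)
  show thesis by (rule that[OF B(1,2)]) (use M(2) B(3) in \<open>auto simp: fixing_def\<close>)
qed

text \<open>Both \<open>g\<close> and its inverse conjugate a fixator in \<open>S\<close> into
  \<open>S\<close>. Hence the intersection of \<open>S\<close> with its conjugate contains a fixator
  in \<open>S\<close> and also the conjugate of one, and these have finite index in \<open>S\<close>
  and in the conjugate respectively.\<close>

lemma G_subset_commensurator:
  assumes g: "g \<in> Gs Fp" "g \<in> U F'"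
  shows "g \<in> commensurator (sub L) (stab_b Fp)"
proof -
  let ?S = "stab_b Fp" and ?C = "conjugate (sub L) g (stab_b Fp)"
  have gL: "g \<in> L" using g G_mono[OF FpF] by blast
  have gA: "g \<in> carrier Aut" using subgroup.mem_carrier[OF subgroup_L gL] .
  have S: "subgroup ?S Aut" by (rule subgroup_stab_b[OF Fp])
  have SA: "?S \<subseteq> carrier Aut" using subgroup.subset[OF S] .
  have C: "subgroup ?C Aut" by (rule subgroup_conjugate[OF gL S])
  have SC: "subgroup (?S \<inter> ?C) Aut" by (rule Aut.subgroups_Inter_pair[OF S C])
  have "inv\<^bsub>Aut\<^esub> g \<in> Gs Fp" using subgroup.m_inv_closed[OF subgroup_G[OF Fp] g(1)] .
  then obtain B where B: "finite B" "B \<subseteq> verts T"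
    "\<And>k. k \<in> fixing B ?S \<Longrightarrow> inv\<^bsub>Aut\<^esub> g \<otimes>\<^bsub>Aut\<^esub> k \<otimes>\<^bsub>Aut\<^esub> inv\<^bsub>Aut\<^esub> (inv\<^bsub>Aut\<^esub> g) \<in> ?S"
    by (rule stab_b_conj) blast
  obtain B' where B': "finite B'" "B' \<subseteq> verts T"
    "\<And>k. k \<in> fixing B' ?S \<Longrightarrow> g \<otimes>\<^bsub>Aut\<^esub> k \<otimes>\<^bsub>Aut\<^esub> inv\<^bsub>Aut\<^esub> g \<in> ?S"
    using g(1) by (rule stab_b_conj) blast
  have "finite ((\<lambda>x. (?S \<inter> ?C) #>\<^bsub>Aut\<^esub> x) ` ?S)"
  proof (rule finite_index_image[OF Fp B(1,2)])
    fix s s' assume s: "s \<in> ?S" "s' \<in> ?S" "s \<otimes>\<^bsub>Aut\<^esub> inv\<^bsub>Aut\<^esub> s' \<in> fixing B ?S"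
    have A: "s \<in> carrier Aut" "s' \<in> carrier Aut" using SA s(1,2) by auto
    have "s \<otimes>\<^bsub>Aut\<^esub> inv\<^bsub>Aut\<^esub> s' \<in> ?C"
      using mem_conjugate_iff[OF gL SA, of "s \<otimes>\<^bsub>Aut\<^esub> inv\<^bsub>Aut\<^esub> s'"] B(3)[OF s(3)] A gA by simp
    moreover have "s \<otimes>\<^bsub>Aut\<^esub> inv\<^bsub>Aut\<^esub> s' \<in> ?S" using s(3) fixing_subset by blast
    ultimately have "s \<otimes>\<^bsub>Aut\<^esub> inv\<^bsub>Aut\<^esub> s' \<in> ?S \<inter> ?C" by blast
    from Aut.r_coset_mult_subgroup[OF SC this A(2)]
    show "(?S \<inter> ?C) #>\<^bsub>Aut\<^esub> s = (?S \<inter> ?C) #>\<^bsub>Aut\<^esub> s'" by (simp add: mult_inv_cancel[OF A])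
  qed
  \<comment> \<open>The cosets in the conjugate are parametrized by \<open>S\<close> through
    conjugation by \<open>g\<close>, so the same counting lemma applies.\<close>
  moreover have "finite ((\<lambda>s. (?C \<inter> ?S) #>\<^bsub>Aut\<^esub> (g \<otimes>\<^bsub>Aut\<^esub> s \<otimes>\<^bsub>Aut\<^esub> inv\<^bsub>Aut\<^esub> g)) ` ?S)"
  proof (rule finite_index_image[OF Fp B'(1,2)])
    fix s s' assume s: "s \<in> ?S" "s' \<in> ?S" "s \<otimes>\<^bsub>Aut\<^esub> inv\<^bsub>Aut\<^esub> s' \<in> fixing B' ?S"
    have A: "s \<in> carrier Aut" "s' \<in> carrier Aut" using SA s(1,2) by auto
    let ?t = "g \<otimes>\<^bsub>Aut\<^esub> (s \<otimes>\<^bsub>Aut\<^esub> inv\<^bsub>Aut\<^esub> s') \<otimes>\<^bsub>Aut\<^esub> inv\<^bsub>Aut\<^esub> g"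
    have "s \<otimes>\<^bsub>Aut\<^esub> inv\<^bsub>Aut\<^esub> s' \<in> ?S" using s(3) fixing_subset by blast
    then have "?t \<in> ?C" unfolding conjugate_eq[OF gL] by blast
    then have t: "?t \<in> ?S \<inter> ?C" using B'(3)[OF s(3)] by blast
    have "g \<otimes>\<^bsub>Aut\<^esub> s \<otimes>\<^bsub>Aut\<^esub> inv\<^bsub>Aut\<^esub> g = ?t \<otimes>\<^bsub>Aut\<^esub> (g \<otimes>\<^bsub>Aut\<^esub> s' \<otimes>\<^bsub>Aut\<^esub> inv\<^bsub>Aut\<^esub> g)"
      using gA A by (simp add: Aut.m_assoc Aut.mult_inv_assoc)
    moreover have "(?S \<inter> ?C) #>\<^bsub>Aut\<^esub> (?t \<otimes>\<^bsub>Aut\<^esub> (g \<otimes>\<^bsub>Aut\<^esub> s' \<otimes>\<^bsub>Aut\<^esub> inv\<^bsub>Aut\<^esub> g))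
        = (?S \<inter> ?C) #>\<^bsub>Aut\<^esub> (g \<otimes>\<^bsub>Aut\<^esub> s' \<otimes>\<^bsub>Aut\<^esub> inv\<^bsub>Aut\<^esub> g)"
      using gA A by (intro Aut.r_coset_mult_subgroup[OF SC t]) simp
    ultimately show "(?C \<inter> ?S) #>\<^bsub>Aut\<^esub> (g \<otimes>\<^bsub>Aut\<^esub> s \<otimes>\<^bsub>Aut\<^esub> inv\<^bsub>Aut\<^esub> g)
        = (?C \<inter> ?S) #>\<^bsub>Aut\<^esub> (g \<otimes>\<^bsub>Aut\<^esub> s' \<otimes>\<^bsub>Aut\<^esub> inv\<^bsub>Aut\<^esub> g)"
      by (simp add: Int_commute)
  qed
  then have "finite ((\<lambda>x. (?C \<inter> ?S) #>\<^bsub>Aut\<^esub> x) ` ?C)"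
    by (simp add: conjugate_eq[OF gL, of "stab_b Fp"] image_image)
  ultimately show ?thesis
    using gL by (simp add: commensurator_def rcosets_sub)
qed

text \<open>
  A coset representative \<open>r\<close> with \<open>g\<^sup>-\<^sup>1 r g \<notin> S\<close> violates the definition of \<open>S\<close> at a single vertex,
  and so does every element of its coset; elements fixing finitely many vertices satisfy it there.
  Avoiding the finitely many bad cosets gives the required stabilizer.
\<close>

lemma finite_index_imp_open:
  assumes g: "g \<in> L" and fin: "finite (rcosets\<^bsub>sub (stab_b Fp)\<^esub> (stab_b Fp \<inter> conjugate (sub L) g (stab_b Fp)))"
  obtains B where "finite B" "B \<subseteq> verts T"
    "\<And>t. t \<in> fixing B (stab_b Fp) \<Longrightarrow> inv\<^bsub>Aut\<^esub> g \<otimes>\<^bsub>Aut\<^esub> t \<otimes>\<^bsub>Aut\<^esub> g \<in> stab_b Fp"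
proof -
  let ?S = "stab_b Fp" and ?C = "conjugate (sub L) g (stab_b Fp)"
  let ?f = "\<lambda>x. (?S \<inter> ?C) #>\<^bsub>Aut\<^esub> x"
  let ?c = "\<lambda>t. inv\<^bsub>Aut\<^esub> g \<otimes>\<^bsub>Aut\<^esub> t \<otimes>\<^bsub>Aut\<^esub> g"
  have gA: "g \<in> carrier Aut" using subgroup.mem_carrier[OF subgroup_L g] .
  have igA: "inv\<^bsub>Aut\<^esub> g \<in> carrier Aut" using gA by simp
  have S: "subgroup ?S Aut" by (rule subgroup_stab_b[OF Fp])
  have SA: "?S \<subseteq> carrier Aut" using subgroup.subset[OF S] .
  have C: "subgroup ?C Aut" by (rule subgroup_conjugate[OF g S])
  have SC: "subgroup (?S \<inter> ?C) Aut" by (rule Aut.subgroups_Inter_pair[OF S C])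
  have fin': "finite (?f ` ?S)" using fin by (simp add: rcosets_sub)
  obtain R where R: "R \<subseteq> ?S" "finite R" "?f ` ?S = ?f ` R"
    using finite_subset_image[OF fin' order_refl] by metis
  have bad: "\<exists>B. finite B \<and> B \<subseteq> verts T \<and> (\<forall>t \<in> fixing B ?S. ?f t \<noteq> ?f r)" if r: "r \<in> R" "?c r \<notin> ?S" for r
  proof -
    have rA: "r \<in> carrier Aut" using r R SA by blast
    have crA: "?c r \<in> carrier Aut" using rA gA by simp
    have shift: "\<exists>s \<in> ?S. ?c t = s \<otimes>\<^bsub>Aut\<^esub> ?c r" if t: "t \<in> ?S" "?f t = ?f r" for t
    proof -
      have tA: "t \<in> carrier Aut" using t SA by blast
      have "t \<in> ?f r" using Aut.rcos_self[OF tA SC] t(2) by simp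
      then obtain c where c: "c \<in> ?S \<inter> ?C" "t = c \<otimes>\<^bsub>Aut\<^esub> r" by (auto simp: r_coset_def)
      have cA: "c \<in> carrier Aut" using c SA by blast
      have "?c t = ?c c \<otimes>\<^bsub>Aut\<^esub> ?c r"
        using gA rA cA c(2) by (simp add: Aut.m_assoc Aut.mult_inv_assoc)
      moreover have "?c c \<in> ?S" using mem_conjugate_iff[OF g SA cA] c by blast
      ultimately show ?thesis by blast
    qed
    have ct: "?c t = inv\<^bsub>Aut\<^esub> g \<otimes>\<^bsub>Aut\<^esub> t \<otimes>\<^bsub>Aut\<^esub> inv\<^bsub>Aut\<^esub> (inv\<^bsub>Aut\<^esub> g)" for t
      using gA by simp
    \<comment> \<open>Membership of \<open>?c r\<close> in \<open>S\<close> fails at the root or in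
      the local action at some \<open>y\<close>. The failure survives left multiplication by
      elements of \<open>S\<close>, but it cannot occur for \<open>?c t\<close> once
      \<open>t\<close> fixes the image of the root under \<open>g\<close>, or the image of
      \<open>y\<close> with its neighbours.\<close>
    show ?thesis
    proof (cases "fst (?c r) b = b")
      case False
      have "?f t \<noteq> ?f r" if t: "t \<in> fixing {fst g b} ?S" for t
      proof
        assume "?f t = ?f r"
        then obtain s where s: "s \<in> ?S" "?c t = s \<otimes>\<^bsub>Aut\<^esub> ?c r"
          using shift[of t] t fixing_subset by blast
        have "fst t (fst g b) = fst g b" using t by (simp add: fixing_def)
        then have "fst (?c t) b = b" by (simp add: fst_mult fst_inv[OF gA])
        then have "fst s (fst (?c r) b) = b" using s(2) by (simp add: fst_mult)
        moreover have "fst s b = b" using s(1) by (simp add: fixing_def)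
        ultimately have "fst (inv\<^bsub>Aut\<^esub> s) (fst s (fst (?c r) b)) = fst (inv\<^bsub>Aut\<^esub> s) (fst s b)" by simp
        then have "fst (?c r) b = b" by (simp only: fst_inv[OF subsetD[OF SA s(1)]])
        with False show False by simp
      qed
      then show ?thesis using fst_in[OF gA b_in] by (intro exI[of _ "{fst g b}"]) auto
    next
      case True
      then obtain y where y: "y \<in> verts T" "\<sigma> (?c r) y \<notin> Fp"
        using r(2) crA by (auto simp: fixing_def U_set_def)
      let ?y = "fst g y" and ?B = "insert (fst g y) (nb (fst g y) ` \<Omega>)"
      have yV: "?y \<in> verts T" using fst_in[OF gA y(1)] .
      have "?f t \<noteq> ?f r" if t: "t \<in> fixing ?B ?S" for t
      proof
        assume "?f t = ?f r"
        then obtain s where s: "s \<in> ?S" "?c t = s \<otimes>\<^bsub>Aut\<^esub> ?c r"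
          using shift[of t] t fixing_subset by blast
        have sA: "s \<in> carrier Aut" using s(1) SA by blast
        have tA: "t \<in> carrier Aut" using t SA fixing_subset by blast
        have ty: "fst t ?y = ?y" using t by (simp add: fixing_def)
        have "\<sigma> t ?y = id" using t by (intro local_action_fixing tA yV ty) (simp add: fixing_def)
        then have "\<sigma> (?c t) (fst (inv\<^bsub>Aut\<^esub> g) ?y) = id"
          unfolding ct using local_action_conj[OF igA tA yV] ty
            permutes_inv_o(1)[OF local_action_permutes[OF igA yV]] by simp
        then have "\<sigma> (?c t) y = id" by (simp add: fst_inv[OF gA])
        moreover have "\<sigma> (?c t) y = \<sigma> s (fst (?c r) y) \<circ> \<sigma> (?c r) y"
          unfolding s(2) by (rule local_action_mult[OF sA crA y(1)])
        ultimately have e: "\<sigma> s (fst (?c r) y) \<circ> \<sigma> (?c r) y = id" by simp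
        have sF: "\<sigma> s (fst (?c r) y) \<in> Fp"
          using s(1) fst_in[OF crA y(1)] by (simp add: fixing_def U_set_def)
        have "inv_into UNIV (\<sigma> s (fst (?c r) y)) \<circ> (\<sigma> s (fst (?c r) y) \<circ> \<sigma> (?c r) y) = \<sigma> (?c r) y"
          using permutes_inv_o(2)[OF subgroup_SymD(1)[OF Fp sF]] by (simp add: o_assoc)
        then have "\<sigma> (?c r) y = inv_into UNIV (\<sigma> s (fst (?c r) y))" using e by simp
        then show False using subgroup_SymD(4)[OF Fp sF] y(2) by simp
      qed
      then show ?thesis using yV nb_in finite_colors by (intro exI[of _ ?B]) auto
    qed
  qed
  define R' where "R' = {r \<in> R. ?c r \<notin> ?S}"
  have "\<forall>r \<in> R'. \<exists>B. finite B \<and> B \<subseteq> verts T \<and> (\<forall>t \<in> fixing B ?S. ?f t \<noteq> ?f r)"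
    using bad by (simp add: R'_def)
  from bchoice[OF this] obtain Br
    where Br: "\<forall>r \<in> R'. finite (Br r) \<and> Br r \<subseteq> verts T \<and> (\<forall>t \<in> fixing (Br r) ?S. ?f t \<noteq> ?f r)" by blast
  let ?B = "\<Union>r\<in>R'. Br r"
  have "?c t \<in> ?S" if t: "t \<in> fixing ?B ?S" for t
  proof -
    have tS: "t \<in> ?S" using t fixing_subset by blast
    then have tA: "t \<in> carrier Aut" using SA by blast
    obtain r where r: "r \<in> R" "?f t = ?f r" using R(3) tS by blast
    have "r \<notin> R'"
    proof
      assume r': "r \<in> R'"
      then have "t \<in> fixing (Br r) ?S" using t by (auto simp: fixing_def)
      then show False using Br r' r(2) by blast
    qed
    then have "?c r \<in> ?S" using r(1) by (simp add: R'_def)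
    moreover have rA: "r \<in> carrier Aut" using r R SA by blast
    ultimately have "r \<in> ?C" using mem_conjugate_iff[OF g SA] by blast
    have "t \<in> ?f r" using Aut.rcos_self[OF tA SC] r(2) by simp
    then obtain c where c: "c \<in> ?S \<inter> ?C" "t = c \<otimes>\<^bsub>Aut\<^esub> r" by (auto simp: r_coset_def)
    then have "t \<in> ?C" using subgroup.m_closed[OF C _ \<open>r \<in> ?C\<close>] by simp
    then show ?thesis using mem_conjugate_iff[OF g SA tA] by blast
  qed
  moreover have "finite ?B" "?B \<subseteq> verts T" using Br R(2) by (auto simp: R'_def)
  ultimately show thesis using that by blast
qed

lemma commensurator_subset_G:
  assumes "g \<in> commensurator (sub L) (stab_b Fp)"
  shows "g \<in> Gs Fp"
proof -
  let ?S = "stab_b Fp" and ?e = "inv\<^bsub>Aut\<^esub> g"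
  have g: "g \<in> L" and fin: "finite (rcosets\<^bsub>sub ?S\<^esub> (?S \<inter> conjugate (sub L) g ?S))"
    using assms by (auto simp: commensurator_def)
  have gA: "g \<in> carrier Aut" using subgroup.mem_carrier[OF subgroup_L g] .
  have eA: "?e \<in> carrier Aut" using gA by simp
  have eL: "?e \<in> L" using subgroup.m_inv_closed[OF subgroup_L g] .
  \<comment> \<open>The index of the intersection in \<open>S\<close> controls conjugation by the
    inverse of \<open>g\<close>, so the local actions of \<open>?e\<close> are studied; this
    suffices because \<open>Gs Fp\<close> is a group.\<close>
  obtain B where B: "finite B" "B \<subseteq> verts T" "\<And>t. t \<in> fixing B ?S \<Longrightarrow> ?e \<otimes>\<^bsub>Aut\<^esub> t \<otimes>\<^bsub>Aut\<^esub> g \<in> ?S"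
    using finite_index_imp_open[OF g fin] by blast
  obtain n where n: "B \<subseteq> ball_V n" using bounded_depth[OF B(1,2)] .
  \<comment> \<open>Beyond depth \<open>n\<close> the fixator of the ball through \<open>x\<close>
    is contained in that of \<open>B\<close>, and \<open>x\<close> is not the root, so its link
    group is a point stabilizer.\<close>
  have far: "\<sigma> ?e x \<in> Fp" if x: "x \<in> verts T" "n < depth x" for x
  proof -
    have xb: "x \<noteq> b" using x by auto
    let ?\<omega> = "last (word x)" and ?\<alpha> = "\<sigma> ?e x"
    have \<omega>: "?\<omega> \<in> \<Omega>" by (rule last_word_in[OF x(1) xb])
    have \<alpha>F: "?\<alpha> \<in> F'" using eL x by (simp add: U_set_def)
    have \<alpha>p: "?\<alpha> permutes \<Omega>" by (rule local_action_permutes[OF eA x(1)])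
    obtain \<rho> where \<rho>: "\<rho> \<in> Fp" "?\<alpha> ?\<omega> = \<rho> ?\<omega>"
      using same_orbit_witness[OF F Fp orb \<omega>] F'_hull \<alpha>F by blast
    have \<rho>p: "\<rho> permutes \<Omega>" using subgroup_SymD(1)[OF Fp \<rho>(1)] .
    have \<rho>F: "inv_into UNIV \<rho> \<in> Fp" using subgroup_SymD(4)[OF Fp \<rho>(1)] .
    define \<beta> where "\<beta> = inv_into UNIV \<rho> \<circ> ?\<alpha>"
    have \<beta>\<omega>: "\<beta> ?\<omega> = ?\<omega>" using \<rho>(2) \<rho>p by (simp add: \<beta>_def permutes_inverses)
    have "\<beta> \<in> F'" unfolding \<beta>_def
      using \<rho>F FpF FF' \<alpha>F subgroup_SymD(3)[OF F'] by blast
    then have \<beta>F: "\<beta> \<in> perm_stab \<Omega> F' ?\<omega>" using \<beta>\<omega> by (simp add: perm_stab_eq)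
    have \<beta>p: "\<beta> permutes \<Omega>" using subgroup_SymD(1)[OF F' \<open>\<beta> \<in> F'\<close>] .
    have inv\<beta>: "inv_into UNIV \<beta> = inv_into UNIV ?\<alpha> \<circ> \<rho>"
      unfolding \<beta>_def using \<rho>p \<alpha>p
      by (simp add: o_inv_distrib permutes_bij bij_imp_bij_inv inv_inv_eq)
    have "\<beta> \<in> perm_stab \<Omega> Fp ?\<omega>"
    proof (rule self_normalizing[OF finite_colors subgroup_perm_stab[OF F'] subgroup_perm_stab[OF Fp] _ norm[OF \<omega>] \<beta>F])
      show "perm_stab \<Omega> Fp ?\<omega> \<subseteq> perm_stab \<Omega> F' ?\<omega>" using FpF FF' by (auto simp: perm_stab_eq)
      fix \<pi> assume \<pi>: "\<pi> \<in> perm_stab \<Omega> Fp ?\<omega>"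
      then have "\<pi> \<in> link_group Fp x" using xb by (simp add: link_group_def)
      then obtain k where k: "k \<in> fixing (ball_V (depth x)) ?S" "\<sigma> k x = \<pi>"
        by (rule ex_fixing_ball[OF Fp x(1)])
      have kA: "k \<in> carrier Aut" and kx: "fst k x = x"
        using k(1) x(1) by (auto simp: fixing_def U_set_def)
      have "k \<in> fixing B ?S" using k(1) n x(2) by (auto simp: fixing_def)
      then have "?e \<otimes>\<^bsub>Aut\<^esub> k \<otimes>\<^bsub>Aut\<^esub> g \<in> ?S" by (rule B(3))
      then have "\<sigma> (?e \<otimes>\<^bsub>Aut\<^esub> k \<otimes>\<^bsub>Aut\<^esub> inv\<^bsub>Aut\<^esub> ?e) (fst ?e x) \<in> Fp"
        using gA fst_in[OF eA x(1)] by (simp add: fixing_def U_set_def)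
      then have a: "?\<alpha> \<circ> \<pi> \<circ> inv_into UNIV ?\<alpha> \<in> Fp"
        using local_action_conj[OF eA kA x(1)] kx k(2) by simp
      \<comment> \<open>Conjugation by \<open>\<beta>\<close> differs from conjugation by
        \<open>?\<alpha>\<close> only by an inner automorphism of \<open>Fp\<close>.\<close>
      have "\<beta> \<circ> \<pi> \<circ> inv_into UNIV \<beta> = inv_into UNIV \<rho> \<circ> (?\<alpha> \<circ> \<pi> \<circ> inv_into UNIV ?\<alpha>) \<circ> \<rho>"
        unfolding inv\<beta> by (simp add: \<beta>_def o_assoc)
      then have "\<beta> \<circ> \<pi> \<circ> inv_into UNIV \<beta> \<in> Fp"
        using a \<rho>(1) \<rho>F subgroup_SymD(3)[OF Fp] by simp
      moreover have "inv_into UNIV \<beta> ?\<omega> = ?\<omega>"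
        using permutes_inv_eq[OF \<beta>p, of ?\<omega> ?\<omega>] \<beta>\<omega> by simp
      ultimately show "\<beta> \<circ> \<pi> \<circ> inv_into UNIV \<beta> \<in> perm_stab \<Omega> Fp ?\<omega>"
        using \<pi> \<beta>\<omega> by (simp add: perm_stab_eq)
    qed
    then have "\<rho> \<circ> \<beta> \<in> Fp" using \<rho>(1) subgroup_SymD(3)[OF Fp] by (simp add: perm_stab_eq)
    moreover have "\<rho> \<circ> \<beta> = ?\<alpha>" using \<rho>p by (simp add: \<beta>_def o_assoc permutes_inv_o)
    ultimately show ?thesis by simp
  qed
  have "{x \<in> verts T. \<sigma> ?e x \<notin> Fp} \<subseteq> ball_V n" using far by (auto simp: not_less[symmetric])
  then have "?e \<in> Gs Fp"
    using finite_subset[OF _ finite_ball[OF finite_colors]] eA by (simp add: G_set_def)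
  then have "inv\<^bsub>Aut\<^esub> ?e \<in> Gs Fp" by (rule subgroup.m_inv_closed[OF subgroup_G[OF Fp]])
  then show ?thesis using gA by simp
qed

lemma commensurator_eq: "commensurator (sub L) (stab_b Fp) = Gs Fp \<inter> U F'"
proof
  have "commensurator (sub L) (stab_b Fp) \<subseteq> L" by (auto simp: commensurator_def)
  then show "commensurator (sub L) (stab_b Fp) \<subseteq> Gs Fp \<inter> U F'" using commensurator_subset_G by blast
qed (use G_subset_commensurator in blast)

text \<open>The localization is topologized from \<open>S\<close>, the group
  \<open>G(F(p),F')\<close> from \<open>U(F(p))\<close>. The two bases at the unit are cofinal since
  \<open>S\<close> is itself a fixator, that of the root, and so open in
  \<open>U(F(p))\<close>.\<close>

lemma localization_eq:
  "localization (sub L, coset_topology (sub L) (base (U F))) (stab_b Fp) =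
     (sub (Gs Fp \<inter> U F'), coset_topology (sub (Gs Fp \<inter> U F')) (base (U Fp)))"
proof -
  let ?S = "stab_b Fp" and ?L = "Gs Fp \<inter> U F'"
  have S: "subgroup ?S Aut" by (rule subgroup_stab_b[OF Fp])
  have L': "subgroup ?L Aut" by (intro Aut.subgroups_Inter_pair subgroup_G subgroup_U Fp F')
  have SL: "?S \<subseteq> ?L"
    using fixing_subset[of "{b}" "U Fp"] U_subset_G[of Fp] U_mono[of Fp F'] FpF FF' by blast
  have cofinal: "\<exists>M \<in> base ?S. M \<subseteq> N" if "N \<in> base (U Fp)" for N
  proof -
    obtain B where "finite B" "B \<subseteq> verts T" "N = fixing B (U Fp)" using \<open>N \<in> base (U Fp)\<close> by (rule baseE)
    then show ?thesis by (intro bexI[of _ "fixing B ?S"] baseI) (auto simp: fixing_def)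
  qed
  have base_S: "base ?S \<subseteq> base (U Fp)"
  proof
    fix N assume "N \<in> base ?S"
    then obtain B where "finite B" "B \<subseteq> verts T" "N = fixing B ?S" by (rule baseE)
    then show "N \<in> base (U Fp)"
      using b_in baseI[of "B \<union> {b}" "U Fp"] by (simp add: fixing_fixing)
  qed
  have "extension_topology (sub ?L) (coset_topology (sub ?S) (base ?S)) = coset_topology (sub ?L) (base ?S)"
  proof (rule extension_topology_base[OF S L' SL])
    fix g N assume "g \<in> ?L" "N \<in> base ?S"
    then obtain M where M: "M \<in> base (U Fp)" "\<forall>k \<in> M. g \<otimes>\<^bsub>Aut\<^esub> k \<otimes>\<^bsub>Aut\<^esub> inv\<^bsub>Aut\<^esub> g \<in> N"
      using G_conj[OF Fp, of g N] base_S by blast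
    obtain M' where "M' \<in> base ?S" "M' \<subseteq> M" using cofinal[OF M(1)] by blast
    then show "\<exists>M \<in> base ?S. \<forall>k \<in> M. g \<otimes>\<^bsub>Aut\<^esub> k \<otimes>\<^bsub>Aut\<^esub> inv\<^bsub>Aut\<^esub> g \<in> N"
      using M(2) by blast
  qed
  moreover have "coset_topology (sub ?L) (base ?S) = coset_topology (sub ?L) (base (U Fp))"
    using cofinal base_S by (intro coset_topology_cofinal) blast+
  moreover have "subtopology (coset_topology (sub L) (base (U F))) ?S = coset_topology (sub ?S) (base ?S)"
    using subtopology_L[OF S] stab_b_subset by blast
  ultimately show ?thesis
    by (simp add: Let_def commensurator_eq)
qed

end

theorem theorem17:
  fixes T :: "('v, 'e) pre_digraph" and arev :: "'e \<Rightarrow> 'e" and b :: 'v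
    and \<Omega> :: "'c set" and l :: "'e \<Rightarrow> 'c"
    and F F' Fp :: "('c \<Rightarrow> 'c) set" and d p :: nat
  assumes "finite \<Omega>" and "card \<Omega> = d" and "d \<ge> 3"
    and "regular_tree d T arev" and "legal_coloring T arev \<Omega> l" and "b \<in> verts T"
    and "prime p"
    and "subgroup F (Sym \<Omega>)" and "subgroup F' (Sym \<Omega>)"
    and "F \<subseteq> F'" and "F' \<subseteq> orbit_hull \<Omega> F"
    and "sylow_subgroup p Fp ((Sym \<Omega>)\<lparr>carrier := F\<rparr>)"
    and "perm_orbits \<Omega> F = perm_orbits \<Omega> Fp"
    and "\<And>\<omega>. \<omega> \<in> \<Omega> \<Longrightarrow>
           normalizer ((Sym \<Omega>)\<lparr>carrier := perm_stab \<Omega> F' \<omega>\<rparr>) (perm_stab \<Omega> Fp \<omega>) = perm_stab \<Omega> Fp \<omega>"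
  shows "local_sylow p (U_stab T arev \<Omega> l Fp b) (GG_group T arev \<Omega> l F F')
    \<and> localization (GG_group T arev \<Omega> l F F') (U_stab T arev \<Omega> l Fp b) = GG_group T arev \<Omega> l Fp F'"
proof -
  interpret sylow_data T arev \<Omega> l b F F' Fp p
    using assms by (intro sylow_data.intro sylow_data_axioms.intro finite_colored_tree.intro
      finite_colored_tree_axioms.intro rooted_colored_tree.intro rooted_colored_tree_axioms.intro
      colored_tree.intro) (auto simp: regular_tree_def)
  have "U_stab T arev \<Omega> l Fp b = stab_b Fp"
    by (simp add: U_stab_def U_group_def stabilizer_def fixing_def)
  moreover have "GG_group T arev \<Omega> l F F' = (sub L, coset_topology (sub L) (base (U F)))"
    by (rule GG_group_eq[OF F F' FF'])
  moreover have "GG_group T arev \<Omega> l Fp F' =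
      (sub (Gs Fp \<inter> U F'), coset_topology (sub (Gs Fp \<inter> U F')) (base (U Fp)))"
    using FpF FF' by (intro GG_group_eq[OF Fp F']) blast
  ultimately show ?thesis
    using local_sylow_stab_b localization_eq by simp
qed

end
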